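(* Let $(M,g)$ be a connected pseudo-Riemannian manifold of signature $(2,2)$, with Riemann curvature tensor $R$ and Weyl tensor $W$. (a) If $(M,g)$ is globally Jordan Osserman, then for each $P\in M$ there exist, on a neighborhood of $P$, a smooth $\mathrm{Cliff}(1,1)$-structure $(\Phi_1,\Phi_2,\Phi_3)$ and constant functions $\lambda_0,\lambda_1,\lambda_2,\lambda_3$ and $\lambda_{ij}$ ($1\le i<j\le 3$) such that, on that neighborhood, $$R=\lambda_0R_0+\sum_{i=1}^3\lambda_iR_{\Phi_i}+\sum_{1\le i<j\le 3}\lambda_{ij}\left[R_{\Phi_i}+R_{\Phi_j}-R_{(\Phi_i-\Phi_j)}\right].$$ (b) If $(M,g)$ is globally conformally Jordan Osserman, then for each $P\in M$ there exist, on a neighborhood of $P$, a smooth $\mathrm{Cliff}(1,1)$-structure $(\Phi_1,\Phi_2,\Phi_3)$ and constant functions $\lambda_0,\lambda_1,\lambda_2,\lambda_3$ and $\lambda_{ij}$ ($1\le i<j\le 3$) with $\lambda_0-\lambda_1+\lambda_2+\lambda_3=0$ such that, on that neighborhood, $$W=\lambda_0R_0+\sum_{i=1}^3\lambda_iR_{\Phi_i}+\sum_{1\le i<j\le 3}\lambda_{ij}\left[R_{\Phi_i}+R_{\Phi_j}-R_{(\Phi_i-\Phi_j)}\right].$$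
   Context: Signature $(2,2)$ means $\dim M=4$ and $g$ has $2$ negative (timelike) and $2$ positive (spacelike) directions. A tangent vector $x$ is unit timelike if $g(x,x)=-1$. Let $R(x,y,z,v)=g(R(x,y)z,v)$ be the curvature tensor of the Levi-Civita connection (with either fixed sign convention). The Weyl tensor $W$ is defined by $R=\frac{Scal}{24}\,g\cdot g+\frac12\left(Ric-\frac{Scal}{4}g\right)\cdot g+W$, where $Ric$ is the contraction of $R$ in the first and third slots, $Scal$ is the contraction of $Ric$, and for symmetric $2$-tensors $h,k$, $(h\cdot k)(v_1,v_2,v_3,v_4)=h(v_1,v_3)k(v_2,v_4)+h(v_2,v_4)k(v_1,v_3)-h(v_1,v_4)k(v_2,v_3)-h(v_2,v_3)k(v_1,v_4)$. The operator form $W(x,y)z$ is given by $W(x,y,z,v)=g(W(x,y)z,v)$. The Jacobi operator is $J_R(x)y=R(y,x)x$ and the conformal Jacobi operator is $J_W(x)y=W(y,x)x$. $(M,g)$ is globally Jordan Osserman (resp. globally conformally Jordan Osserman) if the Jordan normal form of $J_R(x)$ (resp. $J_W(x)$) is independent of the choice of the unit timelike tangent vector $x$ and of its base point. A smooth $\mathrm{Cliff}(1,1)$-structure on an open set $U\subset M$ is a triple of smooth endomorphism fields $\Phi_1,\Phi_2,\Phi_3$ of $TM|_U$, each skew-adjoint with respect to $g$, with $\Phi_3=\Phi_2\Phi_1$, $\Phi_1^2=-\operatorname{Id}$, $\Phi_2^2=\Phi_3^2=\operatorname{Id}$, and $\Phi_i\Phi_j+\Phi_j\Phi_i=0$ for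 $i\ne j$. $R_0(x,y)z=g(x,z)y-g(y,z)x$, and for a skew-adjoint endomorphism $\Phi$, $R_\Phi(x,y)z=g(\Phi y,z)\Phi x-g(\Phi x,z)\Phi y-2g(\Phi x,y)\Phi z$. *)

theory Defs
  imports
    "HOL-Analysis.Analysis"
    "Jordan_Normal_Form.Jordan_Normal_Form"
begin

text \<open>The symbol for indexing is claimed by both \<open>vec_nth\<close> and \<open>vec_index\<close>; here it is the latter.\<close>
unbundle no vec_syntax

section \<open>Smooth maps between Euclidean spaces\<close>

primrec Ck_on :: "nat \<Rightarrow> ('a::real_normed_vector \<Rightarrow> 'b::real_normed_vector) \<Rightarrow> 'a set \<Rightarrow> bool" where
  "Ck_on 0 f S \<longleftrightarrow> continuous_on S f"
| "Ck_on (Suc k) f S \<longleftrightarrow>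
     (\<forall>x\<in>S. f differentiable (at x)) \<and>
     (\<forall>v. Ck_on k (\<lambda>x. frechet_derivative f (at x) v) S)"

text \<open>Intended for open \<open>S\<close> only, since derivatives are taken within the whole space.\<close>
definition smooth_on :: "('a::real_normed_vector \<Rightarrow> 'b::real_normed_vector) \<Rightarrow> 'a set \<Rightarrow> bool" where
  "smooth_on f S \<longleftrightarrow> (\<forall>k. Ck_on k f S)"


section \<open>Four-dimensional manifolds and tensor fields\<close>

type_synonym coord = "real^4"

text \<open>A chart is its domain together with its coordinate map.\<close>
type_synonym 'm chart = "'m set \<times> ('m \<Rightarrow> coord)"

text \<open>The coordinate image of \<open>U \<inter> dom c\<close>, and the point with given coordinates.\<close>
definition image_of :: "'m chart \<Rightarrow> 'm set \<Rightarrow> coord set" where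
  "image_of c U = snd c ` (U \<inter> fst c)"

definition point_at :: "'m chart \<Rightarrow> coord \<Rightarrow> 'm" where
  "point_at c = inv_into (fst c) (snd c)"

definition is_chart :: "'m topology \<Rightarrow> 'm chart \<Rightarrow> bool" where
  "is_chart X c \<longleftrightarrow> openin X (fst c) \<and> open (snd c ` fst c) \<and>
     homeomorphic_map (subtopology X (fst c)) (top_of_set (snd c ` fst c)) (snd c)"

definition transition :: "'m chart \<Rightarrow> 'm chart \<Rightarrow> coord \<Rightarrow> coord" where
  "transition c d = (\<lambda>q. snd d (point_at c q))"

definition smooth_manifold :: "'m topology \<Rightarrow> 'm chart set \<Rightarrow> bool" where
  "smooth_manifold X A \<longleftrightarrow>
     Hausdorff_space X \<and> second_countable X \<and>
     (\<forall>c\<in>A. is_chart X c) \<and> (\<Union>c\<in>A. fst c) = topspace X \<and>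
     (\<forall>c\<in>A. \<forall>d\<in>A. smooth_on (transition c d) (image_of c (fst d)))"

text \<open>
  A tangent vector at \<open>p\<close> is given by its components \<open>x :: coord\<close> in a chart \<open>c\<close> around \<open>p\<close>;
  its components in another chart \<open>d\<close> are \<open>change c d p x\<close>.  Tensor fields are given, as in
  classical tensor calculus, by their expressions in all charts of the atlas, subject to the
  transformation law.
\<close>
definition change :: "'m chart \<Rightarrow> 'm chart \<Rightarrow> 'm \<Rightarrow> coord \<Rightarrow> coord" where
  "change c d p = frechet_derivative (transition c d) (at (snd c p))"

type_synonym bilin = "coord \<Rightarrow> coord \<Rightarrow> real"
type_synonym 'm bilin_field = "'m chart \<Rightarrow> 'm \<Rightarrow> bilin"
type_synonym 'm endo_field = "'m chart \<Rightarrow> 'm \<Rightarrow> coord \<Rightarrow> coord"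

text \<open>Two negative and two positive directions.  The orthogonality relations
  already force \<open>e\<close> to be a basis, so the form is nondegenerate.\<close>
definition signature_2_2 :: "bilin \<Rightarrow> bool" where
  "signature_2_2 b \<longleftrightarrow> (\<exists>e :: 4 \<Rightarrow> coord. \<forall>i j.
     b (e i) (e j) = (if i \<noteq> j then 0 else if i \<in> {0, 1} then - 1 else 1))"

definition metric_2_2 :: "'m chart set \<Rightarrow> 'm bilin_field \<Rightarrow> bool" where
  "metric_2_2 A g \<longleftrightarrow>
     (\<forall>c\<in>A. \<forall>p\<in>fst c. bilinear (g c p) \<and> (\<forall>x y. g c p x y = g c p y x) \<and> signature_2_2 (g c p)) \<and>
     (\<forall>c\<in>A. \<forall>x y. smooth_on (\<lambda>q. g c (point_at c q) x y) (snd c ` fst c)) \<and>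
     (\<forall>c\<in>A. \<forall>d\<in>A. \<forall>p\<in>fst c \<inter> fst d. \<forall>x y.
        g d p (change c d p x) (change c d p y) = g c p x y)"

text \<open>\<open>U\<close> is meant to be an open subset of the manifold.\<close>
definition smooth_endo_field :: "'m chart set \<Rightarrow> 'm set \<Rightarrow> 'm endo_field \<Rightarrow> bool" where
  "smooth_endo_field A U \<Phi> \<longleftrightarrow>
     (\<forall>c\<in>A. \<forall>p\<in>U \<inter> fst c. linear (\<Phi> c p)) \<and>
     (\<forall>c\<in>A. \<forall>x. smooth_on (\<lambda>q. \<Phi> c (point_at c q) x) (image_of c U)) \<and>
     (\<forall>c\<in>A. \<forall>d\<in>A. \<forall>p\<in>U \<inter> fst c \<inter> fst d. \<forall>x.
        \<Phi> d p (change c d p x) = change c d p (\<Phi> c p x))"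


section \<open>Levi-Civita connection and curvature in a chart\<close>

text \<open>The vector metrically dual to a covector.\<close>
definition sharp :: "bilin \<Rightarrow> (coord \<Rightarrow> real) \<Rightarrow> coord" where
  "sharp b \<alpha> = (THE w. \<forall>v. b w v = \<alpha> v)"

text \<open>Below, \<open>G\<close> is the coordinate expression of the metric as a function of the coordinates
  \<open>q\<close>.  The Koszul formula for coordinate (constant) vector fields gives the Christoffel symbols.\<close>
definition christoffel :: "(coord \<Rightarrow> bilin) \<Rightarrow> coord \<Rightarrow> coord \<Rightarrow> coord \<Rightarrow> coord" where
  "christoffel G q x y = sharp (G q) (\<lambda>z.
     (frechet_derivative (\<lambda>r. G r y z) (at q) x
      + frechet_derivative (\<lambda>r. G r x z) (at q) y
      - frechet_derivative (\<lambda>r. G r x y) (at q) z) / 2)"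

definition nabla ::
  "(coord \<Rightarrow> bilin) \<Rightarrow> (coord \<Rightarrow> coord) \<Rightarrow> (coord \<Rightarrow> coord) \<Rightarrow> coord \<Rightarrow> coord" where
  "nabla G X Y = (\<lambda>q. frechet_derivative Y (at q) (X q) + christoffel G q (X q) (Y q))"

definition lie_bracket :: "(coord \<Rightarrow> coord) \<Rightarrow> (coord \<Rightarrow> coord) \<Rightarrow> coord \<Rightarrow> coord" where
  "lie_bracket X Y =
     (\<lambda>q. frechet_derivative Y (at q) (X q) - frechet_derivative X (at q) (Y q))"

definition curvature_operator ::
  "(coord \<Rightarrow> bilin) \<Rightarrow> (coord \<Rightarrow> coord) \<Rightarrow> (coord \<Rightarrow> coord) \<Rightarrow> (coord \<Rightarrow> coord) \<Rightarrow> coord \<Rightarrow> coord"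
where
  "curvature_operator G X Y Z = (\<lambda>q.
     nabla G X (nabla G Y Z) q - nabla G Y (nabla G X Z) q - nabla G (lie_bracket X Y) Z q)"

type_synonym curv = "coord \<Rightarrow> coord \<Rightarrow> coord \<Rightarrow> coord"
type_synonym 'm curv_field = "'m chart \<Rightarrow> 'm \<Rightarrow> curv"

text \<open>\<open>R(x,y)z\<close> at a point, with \<open>x\<close>, \<open>y\<close>, \<open>z\<close> extended to vector fields with constant
  components.  The factor \<open>\<sigma> = 1\<close> or \<open>\<sigma> = -1\<close> covers both sign conventions for \<open>R\<close>.\<close>
definition riemann :: "real \<Rightarrow> 'm bilin_field \<Rightarrow> 'm curv_field" where
  "riemann \<sigma> g c p x y z =
     \<sigma> *\<^sub>R curvature_operator (\<lambda>q. g c (point_at c q)) (\<lambda>_. x) (\<lambda>_. y) (\<lambda>_. z) (snd c p)"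


section \<open>Weyl tensor\<close>

type_synonym curv4 = "coord \<Rightarrow> coord \<Rightarrow> coord \<Rightarrow> coord \<Rightarrow> real"

definition lower :: "bilin \<Rightarrow> curv \<Rightarrow> curv4" where
  "lower b R x y z v = b (R x y z) v"

text \<open>Contraction with the inverse metric.\<close>
definition contract :: "bilin \<Rightarrow> bilin \<Rightarrow> real" where
  "contract b h = (\<Sum>i\<in>UNIV. \<Sum>j\<in>UNIV.
     vec_nth (vec_nth (matrix_inv (vec_lambda (\<lambda>i. vec_lambda (\<lambda>j. b (axis i 1) (axis j 1))))) i) j
     * h (axis i 1) (axis j 1))"

definition ricci :: "bilin \<Rightarrow> curv4 \<Rightarrow> bilin" where
  "ricci b R y v = contract b (\<lambda>x z. R x y z v)"

definition scal :: "bilin \<Rightarrow> curv4 \<Rightarrow> real" where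
  "scal b R = contract b (ricci b R)"

definition kulkarni :: "bilin \<Rightarrow> bilin \<Rightarrow> curv4" where
  "kulkarni h k v1 v2 v3 v4 =
     h v1 v3 * k v2 v4 + h v2 v4 * k v1 v3 - h v1 v4 * k v2 v3 - h v2 v3 * k v1 v4"

definition weyl4 :: "bilin \<Rightarrow> curv4 \<Rightarrow> curv4" where
  "weyl4 b R x y z v = R x y z v
     - scal b R / 24 * kulkarni b b x y z v
     - 1 / 2 * kulkarni (\<lambda>u w. ricci b R u w - scal b R / 4 * b u w) b x y z v"

definition weyl :: "real \<Rightarrow> 'm bilin_field \<Rightarrow> 'm curv_field" where
  "weyl \<sigma> g c p x y z = sharp (g c p) (weyl4 (g c p) (lower (g c p) (riemann \<sigma> g c p)) x y z)"


section \<open>The Jordan Osserman conditions\<close>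

definition jacobi :: "curv \<Rightarrow> coord \<Rightarrow> coord \<Rightarrow> coord" where
  "jacobi R x y = R y x x"

text \<open>The matrix of an endomorphism in the standard basis; \<open>of_nat\<close> maps \<open>{0..<4}\<close>
  bijectively onto the index type \<open>4\<close>.\<close>
definition complex_matrix :: "(coord \<Rightarrow> coord) \<Rightarrow> complex mat" where
  "complex_matrix f =
     Matrix.mat 4 4 (\<lambda>(i, j). complex_of_real (vec_nth (f (axis (of_nat j) 1)) (of_nat i)))"

text \<open>One list of Jordan blocks serves all unit timelike tangent vectors at all points.  (For
  \<open>jordan_nf\<close> the order of the blocks is immaterial.)\<close>
definition globally_jordan :: "'m chart set \<Rightarrow> 'm bilin_field \<Rightarrow> 'm curv_field \<Rightarrow> bool" where
  "globally_jordan A g R \<longleftrightarrow> (\<exists>blocks. \<forall>c\<in>A. \<forall>p\<in>fst c. \<forall>x. g c p x x = - 1 \<longrightarrow>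
     jordan_nf (complex_matrix (jacobi (R c p) x)) blocks)"

definition globally_jordan_osserman ::
  "real \<Rightarrow> 'm chart set \<Rightarrow> 'm bilin_field \<Rightarrow> bool" where
  "globally_jordan_osserman \<sigma> A g \<longleftrightarrow> globally_jordan A g (riemann \<sigma> g)"

definition globally_conformally_jordan_osserman ::
  "real \<Rightarrow> 'm chart set \<Rightarrow> 'm bilin_field \<Rightarrow> bool" where
  "globally_conformally_jordan_osserman \<sigma> A g \<longleftrightarrow> globally_jordan A g (weyl \<sigma> g)"


section \<open>Clifford structures and the associated curvature tensors\<close>

text \<open>The three fields are \<open>\<Phi> 1\<close>, \<open>\<Phi> 2\<close>, \<open>\<Phi> 3\<close>.\<close>
definition cliff_1_1_structure ::
  "'m chart set \<Rightarrow> 'm bilin_field \<Rightarrow> 'm set \<Rightarrow> (nat \<Rightarrow> 'm endo_field) \<Rightarrow> bool" where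
  "cliff_1_1_structure A g U \<Phi> \<longleftrightarrow>
     (\<forall>i\<in>{1..3}. smooth_endo_field A U (\<Phi> i)) \<and>
     (\<forall>c\<in>A. \<forall>p\<in>U \<inter> fst c.
        (\<forall>i\<in>{1..3}. \<forall>x y. g c p (\<Phi> i c p x) y = - g c p x (\<Phi> i c p y)) \<and>
        (\<forall>x. \<Phi> 3 c p x = \<Phi> 2 c p (\<Phi> 1 c p x)) \<and>
        (\<forall>x. \<Phi> 1 c p (\<Phi> 1 c p x) = - x) \<and>
        (\<forall>x. \<Phi> 2 c p (\<Phi> 2 c p x) = x) \<and>
        (\<forall>x. \<Phi> 3 c p (\<Phi> 3 c p x) = x) \<and>
        (\<forall>i\<in>{1..3}. \<forall>j\<in>{1..3}. i \<noteq> j \<longrightarrow>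
           (\<forall>x. \<Phi> i c p (\<Phi> j c p x) + \<Phi> j c p (\<Phi> i c p x) = 0)))"

definition R_zero :: "bilin \<Rightarrow> curv" where
  "R_zero b x y z = b x z *\<^sub>R y - b y z *\<^sub>R x"

definition R_skew :: "bilin \<Rightarrow> (coord \<Rightarrow> coord) \<Rightarrow> curv" where
  "R_skew b \<phi> x y z =
     b (\<phi> y) z *\<^sub>R \<phi> x - b (\<phi> x) z *\<^sub>R \<phi> y - (2 * b (\<phi> x) y) *\<^sub>R \<phi> z"

definition cliff_curvature ::
  "bilin \<Rightarrow> (nat \<Rightarrow> coord \<Rightarrow> coord) \<Rightarrow> (nat \<Rightarrow> real) \<Rightarrow> (nat \<Rightarrow> nat \<Rightarrow> real) \<Rightarrow> curv" where
  "cliff_curvature b \<phi> l m x y z =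
     l 0 *\<^sub>R R_zero b x y z
     + (\<Sum>i\<in>{1..3}. l i *\<^sub>R R_skew b (\<phi> i) x y z)
     + (\<Sum>(i, j)\<in>{(i, j). 1 \<le> i \<and> i < j \<and> j \<le> 3}.
          m i j *\<^sub>R (R_skew b (\<phi> i) x y z + R_skew b (\<phi> j) x y z
                    - R_skew b (\<lambda>u. \<phi> i u - \<phi> j u) x y z))"


section \<open>Consistency of the coordinate formulas\<close>

lemma signature_2_2_nondegenerate:
  assumes b: "bilinear b" and sig: "signature_2_2 b" and w: "\<forall>v. b w v = 0"
  shows "w = 0"
proof -
  obtain e :: "4 \<Rightarrow> coord" where
    e: "\<And>i j. b (e i) (e j) = (if i \<noteq> j then 0 else if i \<in> {0, 1} then - 1 else 1)"
    using sig unfolding signature_2_2_def by blast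
  have lin: "linear (\<lambda>x. b x y)" for y
    using b unfolding bilinear_def by blast
  have coeff: "b (\<Sum>i\<in>UNIV. u i *\<^sub>R e i) (e j) = u j * (if j \<in> {0, 1} then - 1 else 1)" for u j
  proof -
    have "b (\<Sum>i\<in>UNIV. u i *\<^sub>R e i) (e j) = (\<Sum>i\<in>UNIV. u i * b (e i) (e j))"
      using linear_sum[OF lin[of "e j"], of "\<lambda>i. u i *\<^sub>R e i" UNIV]
        linear_cmul[OF lin[of "e j"]] by simp
    also have "\<dots> = (\<Sum>i\<in>UNIV. if i = j then u j * (if j \<in> {0, 1} then - 1 else 1) else 0)"
      by (rule sum.cong) (auto simp: e)
    finally show ?thesis by simp
  qed
  let ?f = "\<lambda>v :: coord. \<Sum>i\<in>UNIV. vec_nth v i *\<^sub>R e i"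
  have flin: "linear ?f"
    by (rule linearI) (simp_all add: scaleR_add_left sum.distrib scaleR_sum_right)
  have "inj ?f"
  proof (rule linear_injective_0[OF flin, THEN iffD2], intro allI impI)
    fix v assume f0: "?f v = 0"
    have "vec_nth v j = 0" for j
      using coeff[of "vec_nth v" j] linear_0[OF lin[of "e j"]] unfolding f0
      by (auto split: if_splits)
    then show "v = 0" by (simp add: Finite_Cartesian_Product.vec_eq_iff)
  qed
  then have "surj ?f" using linear_injective_imp_surjective[OF flin] by blast
  then obtain v where v: "w = ?f v" unfolding surj_def by blast
  have "vec_nth v j = 0" for j
  proof -
    have "b (?f v) (e j) = 0" using w unfolding v by (rule spec)
    then show ?thesis unfolding coeff by (simp split: if_splits)
  qed
  then show ?thesis unfolding v by simp
qed

lemma sharp_eq: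
  assumes b: "bilinear b" and sig: "signature_2_2 b" and \<alpha>: "linear \<alpha>"
  shows "b (sharp b \<alpha>) v = \<alpha> v"
proof -
  have linl: "linear (\<lambda>x. b x y)" and linr: "linear (b x)" for x y
    using b unfolding bilinear_def by blast+
  let ?f = "\<lambda>w. vec_lambda (\<lambda>i. b w (axis i 1)) :: coord"
  have flin: "linear ?f"
    by (rule linearI) (simp_all add: Finite_Cartesian_Product.vec_eq_iff linear_add[OF linl] linear_cmul[OF linl])
  have expand: "\<beta> v = (\<Sum>i\<in>UNIV. vec_nth v i * \<beta> (axis i 1))" if "linear \<beta>" for \<beta> :: "coord \<Rightarrow> real" and v
  proof -
    have "\<beta> v = \<beta> (\<Sum>i\<in>UNIV. vec_nth v i *\<^sub>R axis i 1)"
      using basis_expansion[of v] by (simp add: scalar_mult_eq_scaleR)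
    also have "\<dots> = (\<Sum>i\<in>UNIV. vec_nth v i * \<beta> (axis i 1))"
      using linear_sum[OF that, of "\<lambda>i. vec_nth v i *\<^sub>R axis i 1" UNIV] linear_cmul[OF that] by simp
    finally show ?thesis .
  qed
  have "inj ?f"
  proof (rule linear_injective_0[OF flin, THEN iffD2], intro allI impI)
    fix w assume "?f w = 0"
    then have "b w (axis i 1) = 0" for i by (simp add: Finite_Cartesian_Product.vec_eq_iff)
    then have "b w v = 0" for v using expand[OF linr[of w], of v] by simp
    then have "\<forall>v. b w v = 0" by blast
    then show "w = 0" by (rule signature_2_2_nondegenerate[OF b sig])
  qed
  then have "surj ?f" using linear_injective_imp_surjective[OF flin] by blast
  then obtain w where w: "vec_lambda (\<lambda>i. \<alpha> (axis i 1)) = ?f w" unfolding surj_def by blast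
  then have "b w (axis i 1) = \<alpha> (axis i 1)" for i by (simp add: Finite_Cartesian_Product.vec_eq_iff)
  then have "b w v = \<alpha> v" for v
    using expand[OF linr[of w], of v] expand[OF \<alpha>, of v] by simp
  then have ex: "\<forall>v. b w v = \<alpha> v" by blast
  have "u = w" if "\<forall>v. b u v = \<alpha> v" for u
  proof -
    have "\<forall>v. b (u - w) v = 0" using that ex by (simp add: linear_diff[OF linl])
    then have "u - w = 0" by (rule signature_2_2_nondegenerate[OF b sig])
    then show ?thesis by simp
  qed
  then have "sharp b \<alpha> = w" unfolding sharp_def using ex by (intro the_equality) blast+
  then show ?thesis using ex by simp
qed

text \<open>\<open>nabla G\<close> is torsion-free and, on fields with constant components, metric.\<close>

context
  fixes G :: "coord \<Rightarrow> bilin" and S :: "coord set" and q :: coord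
  assumes bil: "\<And>r. r \<in> S \<Longrightarrow> bilinear (G r)"
    and sym: "\<And>r x y. r \<in> S \<Longrightarrow> G r x y = G r y x"
    and sig: "signature_2_2 (G q)"
    and S: "open S" "q \<in> S"
    and diff: "\<And>x y. (\<lambda>r. G r x y) differentiable (at q)"
begin

private abbreviation D :: "coord \<Rightarrow> coord \<Rightarrow> coord \<Rightarrow> real" where
  "D x y \<equiv> frechet_derivative (\<lambda>r. G r x y) (at q)"

private lemma D: "((\<lambda>r. G r x y) has_derivative D x y) (at q)"
  using diff frechet_derivative_works by blast

private lemma D_eq:
  assumes H: "(H has_derivative F) (at q)" and eq: "\<And>r. r \<in> S \<Longrightarrow> G r x y = H r"
  shows "D x y = F"
proof -
  have "((\<lambda>r. G r x y) has_derivative F) (at q)"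
    by (rule has_derivative_transform_within_open[OF H S]) (simp add: eq)
  then show ?thesis by (rule frechet_derivative_at[symmetric])
qed

private lemma D_sym: "D x y = D y x"
  by (rule D_eq[OF D]) (rule sym)

private lemma D_add: "D x (y + y') v = D x y v + D x y' v"
proof -
  have "D x (y + y') = (\<lambda>v. D x y v + D x y' v)"
    by (rule D_eq[OF has_derivative_add[OF D D]]) (simp add: bil bilinear_radd)
  then show ?thesis by (rule fun_cong)
qed

private lemma D_scale: "D x (k *\<^sub>R y) v = k * D x y v"
proof -
  have "D x (k *\<^sub>R y) = (\<lambda>v. k * D x y v)"
    by (rule D_eq[OF has_derivative_mult_right[OF D]]) (simp add: bil bilinear_rmul)
  then show ?thesis by (rule fun_cong)
qed

private lemma christoffel_eq:
  "G q (christoffel G q x y) z = (D y z x + D x z y - D x y z) / 2"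
proof -
  have lin: "linear (D x y)" using D has_derivative_linear by blast
  have "linear (\<lambda>z. (D y z x + D x z y - D x y z) / 2)"
  proof (rule linearI)
    fix u v
    show "(D y (u + v) x + D x (u + v) y - D x y (u + v)) / 2
        = (D y u x + D x u y - D x y u) / 2 + (D y v x + D x v y - D x y v) / 2"
      unfolding D_add linear_add[OF lin] by (simp add: field_simps)
  next
    fix k :: real and v
    show "(D y (k *\<^sub>R v) x + D x (k *\<^sub>R v) y - D x y (k *\<^sub>R v)) / 2
        = k *\<^sub>R ((D y v x + D x v y - D x y v) / 2)"
      unfolding D_scale linear_cmul[OF lin] by (simp add: algebra_simps)
  qed
  then show ?thesis
    unfolding christoffel_def by (rule sharp_eq[OF bil[OF S(2)] sig])
qed

lemma nabla_torsion_free: "nabla G X Y q - nabla G Y X q = lie_bracket X Y q"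
proof -
  have "christoffel G q x y = christoffel G q y x" for x y
    unfolding christoffel_def using D_sym[of x y] by (simp only: add.commute)
  from this[of "X q" "Y q"] show ?thesis
    unfolding nabla_def lie_bracket_def by simp
qed

lemma nabla_metric:
  "frechet_derivative (\<lambda>r. G r x y) (at q) z
     = G q (nabla G (\<lambda>_. z) (\<lambda>_. x) q) y + G q x (nabla G (\<lambda>_. z) (\<lambda>_. y) q)"
proof -
  have const: "nabla G (\<lambda>_. z) (\<lambda>_. u) q = christoffel G q z u" for u
    by (simp add: nabla_def)
  have "G q x (christoffel G q z y) = G q (christoffel G q z y) x"
    by (rule sym[OF S(2)])
  moreover have "D y x z = D x y z" "D x z y = D z x y" "D y z x = D z y x"
    by (simp_all only: D_sym[of y x] D_sym[of x z] D_sym[of y z])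
  ultimately show ?thesis
    unfolding const christoffel_eq by (simp add: field_simps)
qed

end

end

theory Submission
  imports Defs
begin

text \<open>
  Let \<open>T\<close> be a curvature tensor at a point whose Jacobi operators \<open>J(x)\<close>, for unit timelike \<open>x\<close>, are all
  similar.  By homogeneity and continuity \<open>tr J(v) = tr J(v)\<^sup>2 = 0\<close> for null \<open>v\<close>.  The first equation says
  that \<open>T\<close> is Einstein.  Identifying the tangent space with a tensor product of two planes, the null
  vectors are the \<open>s \<otimes> t\<close>, and the second trace is a product \<open>p(s) q(t)\<close> of the binary quartics \<open>p\<close>, \<open>q\<close> that
  represent the two halves of the Weyl tensor.  So one half vanishes, and then \<open>T\<close> is determined by a
  single \<open>J(x)\<close>: it is the combination of the polarisations \<open>R_ij\<close> of \<open>R_\<Phi>\<close>, where \<open>\<Phi>_i x = \<plusminus> e_i\<close> for an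
  orthonormal frame \<open>x, e_1, e_2, e_3\<close> and the coefficients are, up to sign and a factor 3, the entries of
  \<open>J(x)\<close> in this frame.  Because of \<open>R_\<Phi>1 - R_\<Phi>2 - R_\<Phi>3 = - 3 R_0\<close>, no multiple of \<open>R_0\<close> is needed.

  It remains to find a smooth frame in which \<open>J(x)\<close> has a constant matrix.  Constancy of the Jordan form
  yields a smooth family of intertwiners between \<open>J\<close> at the base point and \<open>J\<close> at nearby points, and the
  polar decomposition turns them into isometries without spoiling the intertwining property.
\<close>

section \<open>Calculus of smooth maps\<close>

text \<open>The obstacle is the indefinite metric. J(x) is self-adjoint, yet it may have complex
  eigenvalues or nontrivial Jordan blocks, so an orthonormal eigenframe need not exist. This is why
  the mixed coefficients \<lambda>_ij occur and why a frame at the base point is transported instead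
  of diagonalising J pointwise. For the transport a constant characteristic polynomial would be too
  weak. Similarity to J at the base point keeps the dimension of the space of intertwiners constant,
  and this makes a smooth choice possible. The root therefore exists only near the identity, and its
  commutation and symmetry properties come from unique solvability of
  \<open>\<rho> X + X \<tau> = 0\<close>. Which half of the Weyl tensor vanishes might change from
  point to point; continuity of a curvature component that separates the two cases excludes this
  locally. In (b) the coefficient of \<open>R_0\<close> is 0, and the side condition says that J(x)
  is trace-free.\<close>

lemmas cart_eq_iff = Finite_Cartesian_Product.vec_eq_iff

lemma frechet_derivative_unique_at:
  "(f has_derivative f') (at x) \<Longrightarrow> frechet_derivative f (at x) = f'"
  using frechet_derivative_at by metis

lemma frechet_derivative_cong_open:
  assumes "open S" "x \<in> S" "\<And>y. y \<in> S \<Longrightarrow> f y = g y"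
  shows "frechet_derivative f (at x) = frechet_derivative g (at x)"
proof -
  have "(f has_derivative D) (at x) \<longleftrightarrow> (g has_derivative D) (at x)" for D
    using has_derivative_transform_within_open[OF _ assms(1,2), of f D UNIV g]
      has_derivative_transform_within_open[OF _ assms(1,2), of g D UNIV f] assms(3) by auto
  then show ?thesis unfolding frechet_derivative_def by simp
qed

lemma differentiable_cong_open:
  assumes "open S" "x \<in> S" "\<And>y. y \<in> S \<Longrightarrow> f y = g y" "f differentiable (at x)"
  shows "g differentiable (at x)"
  using has_derivative_transform_within_open[OF _ assms(1,2), of f _ UNIV g] assms(3,4)
  unfolding differentiable_def by auto

lemma Ck_on_cong:
  assumes "open S" "\<And>x. x \<in> S \<Longrightarrow> f x = g x" "Ck_on k f S"
  shows "Ck_on k g S"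
  using assms(2,3)
proof (induction k arbitrary: f g)
  case 0
  then show ?case using continuous_on_cong[of S S f g] by simp
next
  case (Suc k)
  have "Ck_on k (\<lambda>x. frechet_derivative g (at x) v) S" for v
    by (rule Suc.IH[of "\<lambda>x. frechet_derivative f (at x) v"])
       (use Suc.prems frechet_derivative_cong_open[OF assms(1), of _ f g] in auto)
  then show ?case using Suc.prems differentiable_cong_open[OF assms(1), of _ f g] by auto
qed

lemma Ck_on_SucI:
  assumes "open S" "\<And>x. x \<in> S \<Longrightarrow> (f has_derivative f' x) (at x)"
    and "\<And>v. Ck_on k (\<lambda>x. f' x v) S"
  shows "Ck_on (Suc k) f S"
proof -
  have "Ck_on k (\<lambda>x. frechet_derivative f (at x) v) S" for v
    by (rule Ck_on_cong[OF assms(1) _ assms(3)[of v]])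
      (simp add: frechet_derivative_unique_at[OF assms(2)])
  moreover have "f differentiable (at x)" if "x \<in> S" for x
    using assms(2)[OF that] unfolding differentiable_def by blast
  ultimately show ?thesis by simp
qed

lemma Ck_on_SucD:
  assumes "Ck_on (Suc k) f S"
  shows "x \<in> S \<Longrightarrow> (f has_derivative frechet_derivative f (at x)) (at x)"
    and "Ck_on k (\<lambda>x. frechet_derivative f (at x) v) S"
  using assms frechet_derivative_works by auto

text \<open>The recursion for \<open>Ck_on\<close> does not list the lower orders; they come back
  because differentiability gives continuity at its bottom.\<close>

lemma Ck_on_Suc_imp: "Ck_on (Suc k) f S \<Longrightarrow> Ck_on k f S"
proof (induction k arbitrary: f)
  case 0
  then have "continuous (at x) f" if "x \<in> S" for x
    using that differentiable_imp_continuous_within by auto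
  then show ?case using continuous_at_imp_continuous_on by auto
next
  case (Suc k)
  then show ?case by (metis Ck_on.simps(2))
qed

lemma Ck_on_subset: "Ck_on k f S \<Longrightarrow> T \<subseteq> S \<Longrightarrow> Ck_on k f T"
  by (induction k arbitrary: f) (auto intro: continuous_on_subset)

lemma Ck_on_const: "Ck_on k (\<lambda>x. c) S"
  by (induction k arbitrary: c) auto

lemma Ck_on_bounded_linear:
  assumes "open S" "bounded_linear L" "Ck_on k f S"
  shows "Ck_on k (\<lambda>x. L (f x)) S"
  using assms(3)
proof (induction k arbitrary: f)
  case 0
  then show ?case using bounded_linear.continuous_on[OF assms(2)] by simp
next
  case (Suc k)
  show ?case
    by (rule Ck_on_SucI[OF assms(1) bounded_linear.has_derivative[OF assms(2) Ck_on_SucD(1)[OF Suc.prems]]])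
      (auto intro: Suc.IH Ck_on_SucD(2)[OF Suc.prems])
qed

lemma Ck_on_add:
  assumes "open S" "Ck_on k f S" "Ck_on k g S"
  shows "Ck_on k (\<lambda>x. f x + g x) S"
  using assms(2,3)
proof (induction k arbitrary: f g)
  case 0
  then show ?case by (auto intro: continuous_intros)
next
  case (Suc k)
  show ?case
    by (rule Ck_on_SucI[OF assms(1) has_derivative_add[OF Ck_on_SucD(1)[OF Suc.prems(1)] Ck_on_SucD(1)[OF Suc.prems(2)]]])
      (auto intro!: Suc.IH Ck_on_SucD(2)[OF Suc.prems(1)] Ck_on_SucD(2)[OF Suc.prems(2)])
qed

lemma Ck_on_bilinear:
  assumes "open S" "bounded_bilinear B" "Ck_on k f S" "Ck_on k g S"
  shows "Ck_on k (\<lambda>x. B (f x) (g x)) S"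
  using assms(3,4)
proof (induction k arbitrary: f g)
  case 0
  then show ?case using bounded_bilinear.continuous_on[OF assms(2)] by auto
next
  case (Suc k)
  show ?case
  proof (rule Ck_on_SucI[OF assms(1) bounded_bilinear.FDERIV[OF assms(2) Ck_on_SucD(1)[OF Suc.prems(1)] Ck_on_SucD(1)[OF Suc.prems(2)]]])
    fix v
    show "Ck_on k (\<lambda>x. B (f x) (frechet_derivative g (at x) v) + B (frechet_derivative f (at x) v) (g x)) S"
      by (intro Ck_on_add[OF assms(1)] Suc.IH Ck_on_SucD(2)[OF Suc.prems(1)] Ck_on_SucD(2)[OF Suc.prems(2)]
          Ck_on_Suc_imp[OF Suc.prems(1)] Ck_on_Suc_imp[OF Suc.prems(2)])
  qed auto
qed

lemmas Ck_on_mult = Ck_on_bilinear[OF _ bounded_bilinear_mult]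
lemmas Ck_on_scaleR = Ck_on_bilinear[OF _ bounded_bilinear_scaleR]

lemma Ck_on_sum:
  assumes "open S" "\<And>i. i \<in> I \<Longrightarrow> Ck_on k (f i) S"
  shows "Ck_on k (\<lambda>x. \<Sum>i\<in>I. f i x) S"
  using assms(2)
  by (induction I rule: infinite_finite_induct) (auto intro!: Ck_on_const Ck_on_add[OF assms(1)])

lemma Ck_on_prod:
  fixes f :: "'i \<Rightarrow> 'a::real_normed_vector \<Rightarrow> real"
  assumes "open S" "\<And>i. i \<in> I \<Longrightarrow> Ck_on k (f i) S"
  shows "Ck_on k (\<lambda>x. \<Prod>i\<in>I. f i x) S"
  using assms(2)
  by (induction I rule: infinite_finite_induct) (auto intro!: Ck_on_const Ck_on_mult[OF assms(1)])

lemma Ck_on_inverse: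
  fixes f :: "'a::real_normed_vector \<Rightarrow> real"
  assumes "open S" "\<And>x. x \<in> S \<Longrightarrow> f x \<noteq> 0" "Ck_on k f S"
  shows "Ck_on k (\<lambda>x. inverse (f x)) S"
  using assms(3)
proof (induction k)
  case 0
  then show ?case using assms(2) by (auto intro!: continuous_intros)
next
  case (Suc k)
  note D = Ck_on_SucD[OF Suc.prems]
  show ?case
  proof (rule Ck_on_SucI[OF assms(1)])
    fix x assume x: "x \<in> S"
    \<comment> \<open>The derivative contains \<open>inverse f\<close> again, to which the induction
      hypothesis applies; the factor - 1 presents the sign as a product.\<close>
    show "((\<lambda>x. inverse (f x)) has_derivative
        (\<lambda>v. - 1 * (inverse (f x) * frechet_derivative f (at x) v * inverse (f x)))) (at x)"
      using Deriv.has_derivative_inverse[OF assms(2)[OF x] D(1)[OF x]] by simp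
  next
    fix v
    show "Ck_on k (\<lambda>x. - 1 * (inverse (f x) * frechet_derivative f (at x) v * inverse (f x))) S"
      by (intro Ck_on_mult[OF assms(1)] Ck_on_const D(2) Suc.IH Ck_on_Suc_imp[OF Suc.prems])
  qed
qed

lemma euclidean_expand:
  fixes x :: "'a::euclidean_space"
  assumes "linear h"
  shows "h x = (\<Sum>b\<in>Basis. (x \<bullet> b) *\<^sub>R h b)"
  by (subst euclidean_representation[symmetric, of x])
    (simp only: linear_sum[OF assms] linear_cmul[OF assms])

text \<open>\<open>Ck_on\<close> differentiates in fixed directions, whereas the chain rule
  differentiates f in the moving direction \<open>Dg v\<close>. Expanding that direction in
  \<open>Basis\<close> leaves products to which the induction hypothesis, with f arbitrary,
  applies.\<close>

lemma Ck_on_compose: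
  fixes g :: "'a::real_normed_vector \<Rightarrow> 'b::euclidean_space"
  assumes "open S" "open T" "\<And>x. x \<in> S \<Longrightarrow> g x \<in> T" "Ck_on k f T" "Ck_on k g S"
  shows "Ck_on k (\<lambda>x. f (g x)) S"
  using assms(4,5)
proof (induction k arbitrary: f)
  case 0
  then show ?case using assms(3) continuous_on_compose2[of T f S g] by auto
next
  case (Suc k)
  note F = Ck_on_SucD[OF Suc.prems(1)] and G = Ck_on_SucD[OF Suc.prems(2)]
  show ?case
  proof (rule Ck_on_SucI[OF assms(1)])
    fix x assume x: "x \<in> S"
    have "linear (frechet_derivative f (at (g x)))"
      using F(1)[OF assms(3)[OF x]] has_derivative_linear by blast
    then show "((\<lambda>x. f (g x)) has_derivative (\<lambda>v. \<Sum>b\<in>Basis.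
        (frechet_derivative g (at x) v \<bullet> b) *\<^sub>R frechet_derivative f (at (g x)) b)) (at x)"
      using has_derivative_compose[OF G(1)[OF x] F(1)[OF assms(3)[OF x]]]
      by (simp add: euclidean_expand[symmetric])
  next
    fix v
    show "Ck_on k (\<lambda>x. \<Sum>b\<in>Basis.
        (frechet_derivative g (at x) v \<bullet> b) *\<^sub>R frechet_derivative f (at (g x)) b) S"
      by (intro Ck_on_sum[OF assms(1)] Ck_on_scaleR[OF assms(1)] Suc.IH F(2) Ck_on_Suc_imp[OF Suc.prems(2)]
          Ck_on_bounded_linear[OF assms(1) bounded_linear_inner_left] G(2))
  qed
qed

lemma Ck_on_componentwise:
  fixes f :: "'a::real_normed_vector \<Rightarrow> real^'n"
  assumes "open S" "\<And>i. Ck_on k (\<lambda>x. vec_nth (f x) i) S"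
  shows "Ck_on k f S"
proof -
  have "Ck_on k (\<lambda>x. \<Sum>i\<in>UNIV. vec_nth (f x) i *\<^sub>R axis i 1 :: real^'n) S"
    by (intro Ck_on_sum Ck_on_scaleR Ck_on_const assms)
  moreover have "(\<Sum>i\<in>UNIV. vec_nth (f x) i *\<^sub>R axis i 1) = f x" for x
    using basis_expansion[of "f x"] by (simp add: scalar_mult_eq_scaleR)
  ultimately show ?thesis by (simp only:)
qed

lemma Ck_on_det:
  fixes M :: "'a::real_normed_vector \<Rightarrow> real^'n^'n"
  assumes "open S" "\<And>i j. Ck_on k (\<lambda>x. vec_nth (vec_nth (M x) i) j) S"
  shows "Ck_on k (\<lambda>x. Determinants.det (M x)) S"
  unfolding Determinants.det_def
  by (intro Ck_on_sum Ck_on_mult Ck_on_prod Ck_on_const assms)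

text \<open>Cramer's rule writes the solution as quotients of determinants. As w only has to satisfy
  the equation, solutions obtained by choice or by \<open>THE\<close> are covered.\<close>

lemma Ck_on_solve:
  fixes M :: "'a::real_normed_vector \<Rightarrow> real^'n^'n" and w y :: "'a \<Rightarrow> real^'n"
  assumes "open S" "\<And>i j. Ck_on k (\<lambda>x. vec_nth (vec_nth (M x) i) j) S"
    and "\<And>i. Ck_on k (\<lambda>x. vec_nth (y x) i) S"
    and "\<And>x. x \<in> S \<Longrightarrow> Determinants.det (M x) \<noteq> 0"
    and "\<And>x. x \<in> S \<Longrightarrow> M x *v w x = y x"
  shows "Ck_on k w S"
proof (rule Ck_on_componentwise[OF assms(1)], rule Ck_on_cong[OF assms(1)])
  fix l
  let ?N = "\<lambda>x. vec_lambda (\<lambda>i. vec_lambda (\<lambda>j. if j = l then vec_nth (y x) i else vec_nth (vec_nth (M x) i) j)) :: real^'n^'n"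
  have "Ck_on k (\<lambda>x. vec_nth (vec_nth (?N x) i) j) S" for i j
    by (cases "j = l") (use assms in auto)
  then show "Ck_on k (\<lambda>x. Determinants.det (?N x) * inverse (Determinants.det (M x))) S"
    by (intro Ck_on_mult Ck_on_inverse Ck_on_det assms) auto
  show "Determinants.det (?N x) * inverse (Determinants.det (M x)) = vec_nth (w x) l" if "x \<in> S" for x
    using cramer[OF assms(4)[OF that], of "w x" "y x"] assms(5)[OF that] by (simp add: divide_inverse)
qed

subsection \<open>Smooth maps\<close>

lemma smooth_on_cong: "open S \<Longrightarrow> (\<And>x. x \<in> S \<Longrightarrow> f x = g x) \<Longrightarrow> smooth_on f S \<Longrightarrow> smooth_on g S"
  unfolding smooth_on_def using Ck_on_cong[of S f g] by blast

lemma smooth_on_subset: "smooth_on f S \<Longrightarrow> T \<subseteq> S \<Longrightarrow> smooth_on f T"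
  unfolding smooth_on_def using Ck_on_subset by blast

lemma smooth_on_const: "smooth_on (\<lambda>x. c) S"
  unfolding smooth_on_def using Ck_on_const by blast

lemma smooth_on_bounded_linear: "open S \<Longrightarrow> bounded_linear L \<Longrightarrow> smooth_on f S \<Longrightarrow> smooth_on (\<lambda>x. L (f x)) S"
  unfolding smooth_on_def using Ck_on_bounded_linear by blast

lemma smooth_on_add: "open S \<Longrightarrow> smooth_on f S \<Longrightarrow> smooth_on g S \<Longrightarrow> smooth_on (\<lambda>x. f x + g x) S"
  unfolding smooth_on_def using Ck_on_add by blast

lemma smooth_on_bilinear:
  "open S \<Longrightarrow> bounded_bilinear B \<Longrightarrow> smooth_on f S \<Longrightarrow> smooth_on g S \<Longrightarrow> smooth_on (\<lambda>x. B (f x) (g x)) S"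
  unfolding smooth_on_def using Ck_on_bilinear by blast

lemmas smooth_on_mult = smooth_on_bilinear[OF _ bounded_bilinear_mult]
lemmas smooth_on_scaleR = smooth_on_bilinear[OF _ bounded_bilinear_scaleR]

lemma smooth_on_minus: "open S \<Longrightarrow> smooth_on f S \<Longrightarrow> smooth_on (\<lambda>x. - f x) S"
  by (rule smooth_on_bounded_linear[OF _ bounded_linear_minus[OF bounded_linear_ident]])

lemma smooth_on_diff: "open S \<Longrightarrow> smooth_on f S \<Longrightarrow> smooth_on g S \<Longrightarrow> smooth_on (\<lambda>x. f x - g x) S"
  using smooth_on_add[of S f "\<lambda>x. - g x"] smooth_on_minus by auto

lemma smooth_on_sum:
  "open S \<Longrightarrow> (\<And>i. i \<in> I \<Longrightarrow> smooth_on (f i) S) \<Longrightarrow> smooth_on (\<lambda>x. \<Sum>i\<in>I. f i x) S"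
  unfolding smooth_on_def using Ck_on_sum[of S I _ f] by blast

lemma smooth_on_divide:
  fixes f :: "'a::real_normed_vector \<Rightarrow> real"
  assumes "open S" "smooth_on f S" "smooth_on g S" "\<And>x. x \<in> S \<Longrightarrow> g x \<noteq> 0"
  shows "smooth_on (\<lambda>x. f x / g x) S"
  unfolding divide_inverse
  using assms Ck_on_inverse[of S g] by (intro smooth_on_mult) (auto simp: smooth_on_def)

lemma smooth_on_compose:
  fixes g :: "'a::real_normed_vector \<Rightarrow> 'b::euclidean_space"
  assumes "open S" "open T" "\<And>x. x \<in> S \<Longrightarrow> g x \<in> T" "smooth_on f T" "smooth_on g S"
  shows "smooth_on (\<lambda>x. f (g x)) S"
  using assms Ck_on_compose[of S T g _ f] by (auto simp: smooth_on_def)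

lemma smooth_on_continuous_on: "smooth_on f S \<Longrightarrow> continuous_on S f"
  unfolding smooth_on_def using Ck_on.simps(1) by blast

lemma smooth_on_has_derivative:
  "smooth_on f S \<Longrightarrow> x \<in> S \<Longrightarrow> (f has_derivative frechet_derivative f (at x)) (at x)"
  unfolding smooth_on_def using Ck_on_SucD(1) by blast

lemma smooth_on_linear_derivative:
  "smooth_on f S \<Longrightarrow> x \<in> S \<Longrightarrow> linear (frechet_derivative f (at x))"
  using smooth_on_has_derivative has_derivative_linear by blast

lemma smooth_on_derivative: "smooth_on f S \<Longrightarrow> smooth_on (\<lambda>x. frechet_derivative f (at x) v) S"
  unfolding smooth_on_def using Ck_on_SucD(2) by blast

lemma smooth_on_componentwise:
  fixes f :: "'a::real_normed_vector \<Rightarrow> real^'n"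
  shows "open S \<Longrightarrow> (\<And>i. smooth_on (\<lambda>x. vec_nth (f x) i) S) \<Longrightarrow> smooth_on f S"
  unfolding smooth_on_def using Ck_on_componentwise[of S _ f] by blast

lemma smooth_on_nth: "open S \<Longrightarrow> smooth_on f S \<Longrightarrow> smooth_on (\<lambda>x. vec_nth (f x :: 'b::real_normed_vector ^ 'n) i) S"
  by (rule smooth_on_bounded_linear[OF _ bounded_linear_vec_nth])

text \<open>Tensor fields are known to be smooth on fixed vectors only; this extends the smoothness
  to moving ones.\<close>

lemma smooth_on_linear_apply:
  fixes v :: "'a::real_normed_vector \<Rightarrow> 'b::euclidean_space"
  assumes "open S" "\<And>x. x \<in> S \<Longrightarrow> linear (h x)" "\<And>w. smooth_on (\<lambda>x. h x w) S" "smooth_on v S"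
  shows "smooth_on (\<lambda>x. h x (v x)) S"
proof (rule smooth_on_cong[OF assms(1)])
  show "smooth_on (\<lambda>x. \<Sum>b\<in>Basis. (v x \<bullet> b) *\<^sub>R h x b) S"
    by (intro smooth_on_sum smooth_on_scaleR assms smooth_on_bounded_linear[OF _ bounded_linear_inner_left])
qed (use euclidean_expand[OF assms(2)] in auto)

lemma smooth_on_solve:
  fixes M :: "'a::real_normed_vector \<Rightarrow> real^'n^'n" and w y :: "'a \<Rightarrow> real^'n"
  assumes "open S" "\<And>i j. smooth_on (\<lambda>x. vec_nth (vec_nth (M x) i) j) S"
    and "\<And>i. smooth_on (\<lambda>x. vec_nth (y x) i) S"
    and "\<And>x. x \<in> S \<Longrightarrow> Determinants.det (M x) \<noteq> 0"
    and "\<And>x. x \<in> S \<Longrightarrow> M x *v w x = y x"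
  shows "smooth_on w S"
  using assms Ck_on_solve[of S _ M y w] unfolding smooth_on_def by blast

subsection \<open>Symmetry of the second derivative\<close>

text \<open>The mean value theorem is applied along u and then along v. The second difference is
  symmetric in u and v, so exchanging them expresses both mixed derivatives by one quantity.\<close>

lemma second_difference:
  fixes f :: "'a::real_normed_vector \<Rightarrow> real"
  assumes f: "smooth_on f (ball x r)" and t: "t > 0" "t * norm u + t * norm v < r"
  shows "\<exists>y. norm (y - x) \<le> t * norm u + t * norm v \<and>
     f (x + t *\<^sub>R u + t *\<^sub>R v) - f (x + t *\<^sub>R u) - f (x + t *\<^sub>R v) + f x
       = t * t * frechet_derivative (\<lambda>z. frechet_derivative f (at z) u) (at y) v"
proof -
  have mem: "x + a *\<^sub>R u + b *\<^sub>R v \<in> ball x r" "norm (x + a *\<^sub>R u + b *\<^sub>R v - x) \<le> t * norm u + t * norm v"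
    if "0 \<le> a" "a \<le> t" "0 \<le> b" "b \<le> t" for a b
  proof -
    have "norm (a *\<^sub>R u + b *\<^sub>R v) \<le> a * norm u + b * norm v"
      using that norm_triangle_ineq[of "a *\<^sub>R u" "b *\<^sub>R v"] by simp
    also have "\<dots> \<le> t * norm u + t * norm v" using that by (intro add_mono mult_right_mono) auto
    finally show *: "norm (x + a *\<^sub>R u + b *\<^sub>R v - x) \<le> t * norm u + t * norm v"
      by (simp add: algebra_simps)
    show "x + a *\<^sub>R u + b *\<^sub>R v \<in> ball x r"
      using * t unfolding mem_ball dist_norm norm_minus_commute[of x] by linarith
  qed
  have line: "((\<lambda>a. h (p + a *\<^sub>R d)) has_real_derivative frechet_derivative h (at (p + a *\<^sub>R d)) d) (at a)"
    if "smooth_on h (ball x r)" "p + a *\<^sub>R d \<in> ball x r" for h :: "'a \<Rightarrow> real" and p d and a :: real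
  proof -
    note D = smooth_on_has_derivative[OF that]
    have "((\<lambda>a. p + a *\<^sub>R d) has_derivative (\<lambda>s. s *\<^sub>R d)) (at a)"
      by (auto intro!: derivative_eq_intros)
    from has_derivative_compose[OF this D] have
      "((\<lambda>a. h (p + a *\<^sub>R d)) has_derivative (\<lambda>s. frechet_derivative h (at (p + a *\<^sub>R d)) (s *\<^sub>R d))) (at a)" .
    then show ?thesis
      unfolding has_field_derivative_def
      by (rule has_derivative_eq_rhs) (auto simp: linear_cmul[OF has_derivative_linear[OF D]])
  qed
  let ?du = "\<lambda>z. frechet_derivative f (at z) u"
  let ?phi = "\<lambda>a. f (x + t *\<^sub>R v + a *\<^sub>R u) - f (x + a *\<^sub>R u)"
  have "(?phi has_real_derivative (?du (x + t *\<^sub>R v + a *\<^sub>R u) - ?du (x + a *\<^sub>R u))) (at a)"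
    if "0 \<le> a" "a \<le> t" for a
    using mem[of a t] mem[of a 0] that t(1)
    by (intro DERIV_diff line f) (auto simp: add_ac)
  from MVT2[OF t(1), of ?phi, OF this] obtain a where a: "0 < a" "a < t"
    "?phi t - ?phi 0 = (t - 0) * (?du (x + t *\<^sub>R v + a *\<^sub>R u) - ?du (x + a *\<^sub>R u))" by blast
  have "((\<lambda>b. ?du (x + a *\<^sub>R u + b *\<^sub>R v)) has_real_derivative
      frechet_derivative ?du (at (x + a *\<^sub>R u + b *\<^sub>R v)) v) (at b)" if "0 \<le> b" "b \<le> t" for b
    using mem[of a b] that a by (intro line smooth_on_derivative f) auto
  from MVT2[OF t(1), of "\<lambda>b. ?du (x + a *\<^sub>R u + b *\<^sub>R v)", OF this] obtain b where b: "0 < b" "b < t"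
    "?du (x + a *\<^sub>R u + t *\<^sub>R v) - ?du (x + a *\<^sub>R u) = t * frechet_derivative ?du (at (x + a *\<^sub>R u + b *\<^sub>R v)) v"
    by auto
  show ?thesis
  proof (intro exI conjI)
    show "norm (x + a *\<^sub>R u + b *\<^sub>R v - x) \<le> t * norm u + t * norm v" using mem(2)[of a b] a b by simp
    have "f (x + t *\<^sub>R u + t *\<^sub>R v) - f (x + t *\<^sub>R u) - f (x + t *\<^sub>R v) + f x = ?phi t - ?phi 0"
      by (simp add: add.commute add.left_commute)
    also have "\<dots> = t * (t * frechet_derivative ?du (at (x + a *\<^sub>R u + b *\<^sub>R v)) v)"
      unfolding a(3) b(3)[symmetric] by (simp add: add.commute add.left_commute)
    finally show "f (x + t *\<^sub>R u + t *\<^sub>R v) - f (x + t *\<^sub>R u) - f (x + t *\<^sub>R v) + f x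
       = t * t * frechet_derivative ?du (at (x + a *\<^sub>R u + b *\<^sub>R v)) v" by simp
  qed
qed

lemma second_derivative_symmetric_real:
  fixes f :: "'a::real_normed_vector \<Rightarrow> real"
  assumes S: "open S" "x \<in> S" and f: "smooth_on f S"
  shows "frechet_derivative (\<lambda>z. frechet_derivative f (at z) u) (at x) v
       = frechet_derivative (\<lambda>z. frechet_derivative f (at z) v) (at x) u"
proof -
  obtain r where r: "r > 0" "ball x r \<subseteq> S" using S open_contains_ball by blast
  have fr: "smooth_on f (ball x r)" using smooth_on_subset[OF f r(2)] .
  define D where "D = (\<lambda>u v y. frechet_derivative (\<lambda>z. frechet_derivative f (at z) u) (at y) v)"
  \<comment> \<open>The summand 1 keeps K positive for u = v = 0; steps below \<open>r / K\<close>
    stay inside the ball.\<close>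
  define K where "K = norm u + norm v + 1"
  have K: "K > 0" unfolding K_def by (smt (verit) norm_ge_zero)
  define t where "t = (\<lambda>n. r / K / real (Suc (Suc n)))"
  have t: "t n > 0" for n unfolding t_def using r K by simp
  have tr: "t n * norm u + t n * norm v < r" for n
  proof -
    have "t n * norm u + t n * norm v < t n * K" unfolding K_def using t[of n] by (simp add: algebra_simps)
    also have "\<dots> = r / real (Suc (Suc n))" unfolding t_def using K by simp
    also have "\<dots> \<le> r" using r by (simp add: divide_le_eq)
    finally show ?thesis .
  qed
  have tr': "t n * norm v + t n * norm u < r" for n using tr[of n] by simp
  have t0: "t \<longlonglongrightarrow> 0" unfolding t_def
    by (intro tendsto_divide_0[OF tendsto_const] filterlim_at_top_imp_at_infinity)
      (use filterlim_compose[OF filterlim_real_sequentially filterlim_compose[OF filterlim_Suc filterlim_Suc]] in simp)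
  then have lim0: "(\<lambda>n. t n * norm u + t n * norm v) \<longlonglongrightarrow> 0" by (auto intro!: tendsto_eq_intros)
  from second_difference[OF fr t tr] obtain a where a: "\<And>n. norm (a n - x) \<le> t n * norm u + t n * norm v"
    "\<And>n. f (x + t n *\<^sub>R u + t n *\<^sub>R v) - f (x + t n *\<^sub>R u) - f (x + t n *\<^sub>R v) + f x = t n * t n * D u v (a n)"
    unfolding D_def by metis
  from second_difference[OF fr t tr'] obtain b where b: "\<And>n. norm (b n - x) \<le> t n * norm v + t n * norm u"
    "\<And>n. f (x + t n *\<^sub>R v + t n *\<^sub>R u) - f (x + t n *\<^sub>R v) - f (x + t n *\<^sub>R u) + f x = t n * t n * D v u (b n)"
    unfolding D_def by metis
  have "a \<longlonglongrightarrow> x" "b \<longlonglongrightarrow> x"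
    using a(1) b(1) by (auto intro!: LIM_zero_cancel Lim_null_comparison[OF _ lim0] simp: add.commute)
  moreover have "isCont (D u v) x" "isCont (D v u) x"
    unfolding D_def using S f continuous_on_eq_continuous_at
    by (metis smooth_on_continuous_on smooth_on_derivative)+
  ultimately have "(\<lambda>n. D u v (a n)) \<longlonglongrightarrow> D u v x" "(\<lambda>n. D v u (b n)) \<longlonglongrightarrow> D v u x"
    using isCont_tendsto_compose by blast+
  moreover have "D u v (a n) = D v u (b n)" for n
  proof -
    have "t n * t n * D u v (a n) = t n * t n * D v u (b n)"
      using a(2)[of n] b(2)[of n] unfolding add.assoc[of x] add.commute[of "t n *\<^sub>R v" "t n *\<^sub>R u"] by linarith
    then show ?thesis using t[of n] by simp
  qed
  ultimately have "D u v x = D v u x" using LIMSEQ_unique[of "\<lambda>n. D u v (a n)"] by simp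
  then show ?thesis unfolding D_def .
qed

lemma second_derivative_symmetric:
  fixes f :: "'a::real_normed_vector \<Rightarrow> 'b::euclidean_space"
  assumes S: "open S" "x \<in> S" and f: "smooth_on f S"
  shows "frechet_derivative (\<lambda>z. frechet_derivative f (at z) u) (at x) v
       = frechet_derivative (\<lambda>z. frechet_derivative f (at z) v) (at x) u"
proof (rule euclidean_eqI)
  fix b :: 'b
  assume "b \<in> Basis"
  have *: "frechet_derivative (\<lambda>z. h z \<bullet> b) (at z) w = frechet_derivative h (at z) w \<bullet> b"
    if "smooth_on h S" "z \<in> S" for h :: "'a \<Rightarrow> 'b" and z w
    using frechet_derivative_unique_at[OF has_derivative_inner_left[OF smooth_on_has_derivative[OF that]]] by simp
  have fb: "smooth_on (\<lambda>z. f z \<bullet> b) S"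
    by (rule smooth_on_bounded_linear[OF S(1) bounded_linear_inner_left f])
  have "frechet_derivative (\<lambda>z. frechet_derivative f (at z) u) (at x) v \<bullet> b
      = frechet_derivative (\<lambda>z. frechet_derivative (\<lambda>z. f z \<bullet> b) (at z) u) (at x) v" for u v
    unfolding *[OF smooth_on_derivative[OF f] S(2), symmetric]
    by (rule fun_cong[OF frechet_derivative_cong_open[OF S]]) (simp add: *[OF f])
  then show "frechet_derivative (\<lambda>z. frechet_derivative f (at z) u) (at x) v \<bullet> b
     = frechet_derivative (\<lambda>z. frechet_derivative f (at z) v) (at x) u \<bullet> b"
    using second_derivative_symmetric_real[OF S fb, of u v] by simp
qed

section \<open>Curvature in coordinates\<close>

lemma has_derivative_linear_apply:
  fixes L :: "'a::real_normed_vector \<Rightarrow> 'b::euclidean_space \<Rightarrow> 'c::real_normed_vector"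
  assumes S: "open S" "q \<in> S" and lin: "\<And>r. r \<in> S \<Longrightarrow> linear (L r)"
    and L: "\<And>w. ((\<lambda>r. L r w) has_derivative DL w) (at q)" and W: "(W has_derivative W') (at q)"
  shows "((\<lambda>r. L r (W r)) has_derivative (\<lambda>h. DL (W q) h + L q (W' h))) (at q)"
proof -
  \<comment> \<open>Linearity of DL in w comes from uniqueness of the derivative.\<close>
  have DLw: "DL w = (\<lambda>h. \<Sum>b\<in>Basis. (w \<bullet> b) *\<^sub>R DL b h)" for w
  proof -
    have "((\<lambda>r. \<Sum>b\<in>Basis. (w \<bullet> b) *\<^sub>R L r b) has_derivative (\<lambda>h. \<Sum>b\<in>Basis. (w \<bullet> b) *\<^sub>R DL b h)) (at q)"
      by (intro has_derivative_sum has_derivative_scaleR_right L)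
    then have "((\<lambda>r. L r w) has_derivative (\<lambda>h. \<Sum>b\<in>Basis. (w \<bullet> b) *\<^sub>R DL b h)) (at q)"
      by (rule has_derivative_transform_within_open[OF _ S]) (use euclidean_expand[OF lin] in auto)
    then show ?thesis using L has_derivative_unique by blast
  qed
  have "((\<lambda>r. \<Sum>b\<in>Basis. (W r \<bullet> b) *\<^sub>R L r b) has_derivative
      (\<lambda>h. \<Sum>b\<in>Basis. (W q \<bullet> b) *\<^sub>R DL b h + (W' h \<bullet> b) *\<^sub>R L q b)) (at q)"
    by (intro has_derivative_sum has_derivative_scaleR has_derivative_inner_left L W)
  then have "((\<lambda>r. L r (W r)) has_derivative
      (\<lambda>h. \<Sum>b\<in>Basis. (W q \<bullet> b) *\<^sub>R DL b h + (W' h \<bullet> b) *\<^sub>R L q b)) (at q)"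
    by (rule has_derivative_transform_within_open[OF _ S]) (use euclidean_expand[OF lin] in auto)
  then show ?thesis
    by (rule has_derivative_eq_rhs)
      (subst DLw, simp add: sum.distrib euclidean_expand[OF lin[OF S(2)], symmetric] fun_eq_iff)
qed

lemma has_derivative_bilinear_apply:
  fixes B :: "'a::real_normed_vector \<Rightarrow> 'b::euclidean_space \<Rightarrow> 'b \<Rightarrow> 'c::real_normed_vector"
  assumes S: "open S" "q \<in> S" and bil: "\<And>r. r \<in> S \<Longrightarrow> bilinear (B r)"
    and B: "\<And>u v. ((\<lambda>r. B r u v) has_derivative DB u v) (at q)"
    and U: "(U has_derivative U') (at q)" and V: "(V has_derivative V') (at q)"
  shows "((\<lambda>r. B r (U r) (V r)) has_derivative
    (\<lambda>h. DB (U q) (V q) h + B q (U' h) (V q) + B q (U q) (V' h))) (at q)"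
proof -
  have 1: "((\<lambda>r. B r (U r) v) has_derivative (\<lambda>h. DB (U q) v h + B q (U' h) v)) (at q)" for v
    using has_derivative_linear_apply[where L = "\<lambda>r u. B r u v", OF S _ B U] bil
    unfolding bilinear_def by blast
  have "linear (B r (U r))" if "r \<in> S" for r
    using bil[OF that] unfolding bilinear_def by blast
  from has_derivative_linear_apply[where L = "\<lambda>r. B r (U r)", OF S this 1 V] show ?thesis by simp
qed

lemma coord_expand:
  fixes v :: coord
  assumes "linear \<beta>"
  shows "\<beta> v = (\<Sum>i\<in>UNIV. vec_nth v i *\<^sub>R \<beta> (axis i 1))"
proof -
  have "\<beta> v = \<beta> (\<Sum>i\<in>UNIV. vec_nth v i *\<^sub>R axis i 1)"
    using basis_expansion[of v] by (simp add: scalar_mult_eq_scaleR)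
  also have "\<dots> = (\<Sum>i\<in>UNIV. vec_nth v i *\<^sub>R \<beta> (axis i 1))"
    by (simp only: linear_sum[OF assms] linear_cmul[OF assms])
  finally show ?thesis .
qed

text \<open>The second argument of b is the row index, so that \<open>gram b *v w\<close> lists the
  values of \<open>b w\<close> on the standard basis and \<open>b w = \<alpha>\<close> becomes a
  linear system for w.\<close>

definition gram :: "bilin \<Rightarrow> real^4^4" where
  "gram b = vec_lambda (\<lambda>i. vec_lambda (\<lambda>j. b (axis j 1) (axis i 1)))"

lemma gram_mult:
  assumes "bilinear b"
  shows "gram b *v w = vec_lambda (\<lambda>i. b w (axis i 1))"
proof -
  have "linear (\<lambda>x. b x y)" for y using assms unfolding bilinear_def by blast
  from coord_expand[OF this, of w] show ?thesis
    by (simp add: gram_def matrix_vector_mult_def cart_eq_iff mult.commute)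
qed

lemma det_gram:
  assumes "bilinear b" "signature_2_2 b"
  shows "Determinants.det (gram b) \<noteq> 0"
proof -
  have "w = 0" if "gram b *v w = 0" for w
  proof (rule signature_2_2_nondegenerate[OF assms])
    have "linear (b w)" using assms(1) unfolding bilinear_def by blast
    moreover have "b w (axis i 1) = 0" for i
      using arg_cong[OF gram_mult[OF assms(1), of w], of "\<lambda>u. vec_nth u i"] that by simp
    ultimately show "\<forall>v. b w v = 0"
      by (subst coord_expand[of "b w"]) simp_all
  qed
  then have "\<exists>B. B ** gram b = Finite_Cartesian_Product.mat 1"
    using matrix_left_invertible_ker by blast
  then show ?thesis by (simp add: invertible_det_nz[symmetric] invertible_left_inverse)
qed

lemma metric_eqI:
  assumes "bilinear b" "signature_2_2 b" "\<And>v. b w v = b w' v"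
  shows "w = w'"
proof -
  have "\<forall>v. b (w - w') v = 0" using assms(1,3) by (simp add: bilinear_lsub)
  then have "w - w' = 0" by (rule signature_2_2_nondegenerate[OF assms(1,2)])
  then show ?thesis by simp
qed

section \<open>Connection and curvature of a metric on an open set of coordinates\<close>

locale metric_chart =
  fixes G :: "coord \<Rightarrow> bilin" and S :: "coord set"
  assumes open_S: "open S"
    and bil: "\<And>q. q \<in> S \<Longrightarrow> bilinear (G q)"
    and sym: "\<And>q x y. q \<in> S \<Longrightarrow> G q x y = G q y x"
    and sig: "\<And>q. q \<in> S \<Longrightarrow> signature_2_2 (G q)"
    and smooth: "\<And>x y. smooth_on (\<lambda>q. G q x y) S"
begin

lemmas eqI = metric_eqI[OF bil sig]

lemma smooth_sharp:
  assumes "\<And>q. q \<in> S \<Longrightarrow> linear (\<alpha> q)" "\<And>v. smooth_on (\<lambda>q. \<alpha> q v) S"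
  shows "smooth_on (\<lambda>q. sharp (G q) (\<alpha> q)) S"
proof (rule smooth_on_solve[OF open_S, of "\<lambda>q. gram (G q)" "\<lambda>q. vec_lambda (\<lambda>i. \<alpha> q (axis i 1))"])
  show "gram (G q) *v sharp (G q) (\<alpha> q) = vec_lambda (\<lambda>i. \<alpha> q (axis i 1))" if "q \<in> S" for q
    using gram_mult[OF bil[OF that]] sharp_eq[OF bil[OF that] sig[OF that] assms(1)[OF that]]
    by (simp add: cart_eq_iff)
qed (use det_gram bil sig smooth assms in \<open>auto simp: gram_def\<close>)

abbreviation D :: "coord \<Rightarrow> coord \<Rightarrow> coord \<Rightarrow> coord \<Rightarrow> real" where
  "D q x y \<equiv> frechet_derivative (\<lambda>r. G r x y) (at q)"

lemma D: "q \<in> S \<Longrightarrow> ((\<lambda>r. G r x y) has_derivative D q x y) (at q)"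
  by (rule smooth_on_has_derivative[OF smooth])

lemma D_linear: "q \<in> S \<Longrightarrow> linear (D q x y)"
  using D has_derivative_linear by blast

lemma D_sym: "q \<in> S \<Longrightarrow> D q x y = D q y x"
  by (rule frechet_derivative_cong_open[OF open_S]) (auto intro: sym)

lemma D_add: "q \<in> S \<Longrightarrow> D q x (y + y') v = D q x y v + D q x y' v"
proof -
  assume q: "q \<in> S"
  have "D q x (y + y') = frechet_derivative (\<lambda>r. G r x y + G r x y') (at q)"
    by (rule frechet_derivative_cong_open[OF open_S q]) (simp add: bil bilinear_radd)
  then show ?thesis using frechet_derivative_unique_at[OF has_derivative_add[OF D[OF q] D[OF q]]] by simp
qed

lemma D_scale: "q \<in> S \<Longrightarrow> D q x (k *\<^sub>R y) v = k * D q x y v"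
proof -
  assume q: "q \<in> S"
  have "D q x (k *\<^sub>R y) = frechet_derivative (\<lambda>r. k * G r x y) (at q)"
    by (rule frechet_derivative_cong_open[OF open_S q]) (simp add: bil bilinear_rmul)
  then show ?thesis using frechet_derivative_unique_at[OF has_derivative_mult_right[OF D[OF q]]] by simp
qed

abbreviation Gam :: "coord \<Rightarrow> coord \<Rightarrow> coord \<Rightarrow> coord" where
  "Gam \<equiv> christoffel G"

lemma koszul_linear: "q \<in> S \<Longrightarrow> linear (\<lambda>z. (D q y z x + D q x z y - D q x y z) / 2)"
  by (rule linearI)
    (simp_all add: D_add D_scale linear_add[OF D_linear] linear_cmul[OF D_linear] field_simps)

lemma Gam: "q \<in> S \<Longrightarrow> G q (Gam q x y) z = (D q y z x + D q x z y - D q x y z) / 2"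
  unfolding christoffel_def by (rule sharp_eq[OF bil sig koszul_linear])

lemma Gam_sym: "q \<in> S \<Longrightarrow> Gam q x y = Gam q y x"
  by (rule eqI) (auto simp: Gam D_sym[of q x y])

lemma bilinear_Gam: "q \<in> S \<Longrightarrow> bilinear (Gam q)"
proof -
  assume q: "q \<in> S"
  have "linear (Gam q x)" for x
  proof (rule linearI)
    show "Gam q x (y + y') = Gam q x y + Gam q x y'" for y y'
    proof (rule eqI[OF q q])
      have "D q (y + y') v w = D q y v w + D q y' v w" for v w
        using D_sym[OF q] D_add[OF q] by metis
      then show "G q (Gam q x (y + y')) v = G q (Gam q x y + Gam q x y') v" for v
        using q by (simp add: bilinear_ladd[OF bil] Gam D_add linear_add[OF D_linear] field_simps)
    qed
    show "Gam q x (k *\<^sub>R y) = k *\<^sub>R Gam q x y" for k y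
    proof (rule eqI[OF q q])
      have "D q (k *\<^sub>R y) v w = k * D q y v w" for v w
        using D_sym[OF q] D_scale[OF q] by metis
      then show "G q (Gam q x (k *\<^sub>R y)) v = G q (k *\<^sub>R Gam q x y) v" for v
        using q by (simp add: bilinear_lmul[OF bil] Gam D_scale linear_cmul[OF D_linear] algebra_simps)
    qed
  qed
  moreover from this have "linear (\<lambda>x. Gam q x y)" for y
    using Gam_sym[OF q] by (metis (no_types, lifting) ext)
  ultimately show ?thesis unfolding bilinear_def by blast
qed

lemma smooth_Gam: "smooth_on (\<lambda>q. Gam q x y) S"
  unfolding christoffel_def
proof (rule smooth_sharp[OF koszul_linear])
  fix z
  have "smooth_on (\<lambda>q. (D q y z x + D q x z y - D q x y z) * (1 / 2)) S"
    by (intro smooth_on_mult smooth_on_add smooth_on_diff smooth_on_const smooth_on_derivative smooth open_S)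
  then show "smooth_on (\<lambda>q. (D q y z x + D q x z y - D q x y z) / 2) S" by simp
qed

text \<open>Metric compatibility on constant fields, in a form that can be differentiated once
  more.\<close>

lemma D_Gam: "q \<in> S \<Longrightarrow> D q x y z = G q (Gam q z x) y + G q x (Gam q z y)"
  using sym[of q x "Gam q z y"] D_sym[of q y x] D_sym[of q z x] D_sym[of q z y] by (simp add: Gam field_simps)

abbreviation DGam :: "coord \<Rightarrow> coord \<Rightarrow> coord \<Rightarrow> coord \<Rightarrow> coord" where
  "DGam q x y \<equiv> frechet_derivative (\<lambda>r. Gam r x y) (at q)"

lemma DGam: "q \<in> S \<Longrightarrow> ((\<lambda>r. Gam r x y) has_derivative DGam q x y) (at q)"
  by (rule smooth_on_has_derivative[OF smooth_Gam])

text \<open>The iterated covariant derivative along x and y of fields with constant components. Such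
  fields commute, so curvature is its antisymmetrisation.\<close>

definition cov2 :: "coord \<Rightarrow> coord \<Rightarrow> coord \<Rightarrow> coord \<Rightarrow> coord" where
  "cov2 q x y z = DGam q y z x + Gam q x (Gam q y z)"

definition curv :: "coord \<Rightarrow> curv" where
  "curv q x y z = cov2 q x y z - cov2 q y x z"

lemma curvature_operator_eq:
  assumes q: "q \<in> S"
  shows "curvature_operator G (\<lambda>_. x) (\<lambda>_. y) (\<lambda>_. z) q = curv q x y z"
proof -
  have "nabla G (\<lambda>_. u) (\<lambda>_. v) = (\<lambda>q. Gam q u v)" for u v
    by (simp add: nabla_def)
  moreover have "lie_bracket (\<lambda>_. x) (\<lambda>_. y) = (\<lambda>_. 0)"
    by (simp add: lie_bracket_def)
  ultimately show ?thesis
    using bilinear_lzero[OF bilinear_Gam[OF q]]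
    by (simp add: curvature_operator_def nabla_def curv_def cov2_def)
qed

lemma curv_antisym: "curv q x y z = - curv q y x z"
  by (simp add: curv_def)

text \<open>Absence of torsion makes \<open>cov2\<close> symmetric in its last two vectors, so the
  six terms cancel in pairs.\<close>

lemma curv_bianchi: "q \<in> S \<Longrightarrow> curv q x y z + curv q y z x + curv q z x y = 0"
proof -
  assume q: "q \<in> S"
  have "DGam q u v w = DGam q v u w" for u v w
    by (rule fun_cong[OF frechet_derivative_cong_open[OF open_S q]]) (rule Gam_sym)
  then have "cov2 q u v w = cov2 q u w v" for u v w
    unfolding cov2_def using Gam_sym[OF q] by metis
  then show ?thesis unfolding curv_def by (simp add: algebra_simps)
qed

text \<open>Second derivatives of the function \<open>G r a b\<close> commute. Expressed through
  \<open>D_Gam\<close> they contain products of two \<open>Gam\<close> terms, which are symmetric in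
  the two directions and cancel; the curvature terms remain.\<close>

lemma curv_skew:
  assumes q: "q \<in> S"
  shows "G q (curv q x y a) b = - G q a (curv q x y b)"
proof -
  have DD: "frechet_derivative (\<lambda>r. D r a b u) (at q) v
      = G q (cov2 q v u a) b + G q a (cov2 q v u b) + G q (Gam q u a) (Gam q v b) + G q (Gam q v a) (Gam q u b)" for u v
  proof -
    have "((\<lambda>r. G r (Gam r u a) b) has_derivative
        (\<lambda>h. D q (Gam q u a) b h + G q (DGam q u a h) b + G q (Gam q u a) 0)) (at q)"
      by (rule has_derivative_bilinear_apply[OF open_S q bil D[OF q] DGam[OF q] has_derivative_const])
    moreover have "((\<lambda>r. G r a (Gam r u b)) has_derivative
        (\<lambda>h. D q a (Gam q u b) h + G q 0 (Gam q u b) + G q a (DGam q u b h))) (at q)"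
      by (rule has_derivative_bilinear_apply[OF open_S q bil D[OF q] has_derivative_const DGam[OF q]])
    ultimately have "((\<lambda>r. G r (Gam r u a) b + G r a (Gam r u b)) has_derivative
        (\<lambda>h. (D q (Gam q u a) b h + G q (DGam q u a h) b + G q (Gam q u a) 0)
          + (D q a (Gam q u b) h + G q 0 (Gam q u b) + G q a (DGam q u b h)))) (at q)"
      by (rule has_derivative_add)
    note H = frechet_derivative_unique_at[OF this]
    have "frechet_derivative (\<lambda>r. D r a b u) (at q)
        = frechet_derivative (\<lambda>r. G r (Gam r u a) b + G r a (Gam r u b)) (at q)"
      by (rule frechet_derivative_cong_open[OF open_S q]) (rule D_Gam)
    then show ?thesis unfolding H
      by (simp add: D_Gam[OF q] cov2_def bilinear_ladd[OF bil[OF q]] bilinear_radd[OF bil[OF q]]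
          bilinear_lzero[OF bil[OF q]] bilinear_rzero[OF bil[OF q]])
  qed
  have "frechet_derivative (\<lambda>r. D r a b x) (at q) y = frechet_derivative (\<lambda>r. D r a b y) (at q) x"
    by (rule second_derivative_symmetric[OF open_S q smooth])
  then show ?thesis unfolding DD
    by (simp add: curv_def bilinear_lsub[OF bil[OF q]] bilinear_rsub[OF bil[OF q]])
qed

lemma linear_DGam:
  assumes q: "q \<in> S"
  shows "linear (DGam q x y)" "linear (\<lambda>y. DGam q x y z)" "linear (\<lambda>x. DGam q x y z)"
proof -
  show "linear (DGam q x y)" using DGam[OF q] has_derivative_linear by blast
  note B = bilinear_Gam
  have "DGam q x (y + y') = (\<lambda>h. DGam q x y h + DGam q x y' h)" for x y y'
    by (rule trans[OF frechet_derivative_cong_open[OF open_S q] frechet_derivative_unique_at[OF has_derivative_add[OF DGam[OF q] DGam[OF q]]]])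
      (simp add: bilinear_radd[OF B])
  moreover have "DGam q x (k *\<^sub>R y) = (\<lambda>h. k *\<^sub>R DGam q x y h)" for x k y
    by (rule trans[OF frechet_derivative_cong_open[OF open_S q] frechet_derivative_unique_at[OF has_derivative_scaleR_right[OF DGam[OF q]]]])
      (simp add: bilinear_rmul[OF B])
  ultimately show *: "linear (\<lambda>y. DGam q x y z)" for x by (intro linearI) simp_all
  have "DGam q x y = DGam q y x" for x y
    by (rule frechet_derivative_cong_open[OF open_S q]) (rule Gam_sym)
  then show "linear (\<lambda>x. DGam q x y z)" using *[of y] by simp
qed

lemma linear_curv:
  assumes q: "q \<in> S"
  shows "linear (curv q x y)" "linear (\<lambda>y. curv q x y z)" "linear (\<lambda>x. curv q x y z)"
proof -
  note B = bilinear_Gam[OF q] and L = linear_DGam[OF q]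
  show "linear (curv q x y)" for x y unfolding curv_def cov2_def
    by (rule linearI)
      (simp_all add: bilinear_radd[OF B] bilinear_rmul[OF B] linear_add[OF L(2)] linear_cmul[OF L(2)] algebra_simps)
  show *: "linear (\<lambda>y. curv q x y z)" for x unfolding curv_def cov2_def
    by (rule linearI)
      (simp_all add: bilinear_radd[OF B] bilinear_rmul[OF B] bilinear_ladd[OF B] bilinear_lmul[OF B]
        linear_add[OF L(1)] linear_cmul[OF L(1)] linear_add[OF L(3)] linear_cmul[OF L(3)] algebra_simps)
  have "(\<lambda>x. curv q x y z) = (\<lambda>x. - curv q y x z)" using curv_antisym by blast
  then show "linear (\<lambda>x. curv q x y z)" using linear_compose_neg[OF *[of y]] by simp
qed

lemma smooth_curv: "smooth_on (\<lambda>q. curv q x y z) S"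
proof -
  have lin: "linear (Gam q u)" if "q \<in> S" for q u using bilinear_Gam[OF that] unfolding bilinear_def by blast
  show ?thesis unfolding curv_def cov2_def
    by (intro smooth_on_diff smooth_on_add smooth_on_derivative smooth_Gam smooth_on_linear_apply[OF open_S lin] open_S)
qed

end

subsection \<open>Behaviour under coordinate changes\<close>

locale metric_charts = C1: metric_chart G1 S1 + C2: metric_chart G2 S2 for G1 S1 G2 S2 +
  fixes F :: "coord \<Rightarrow> coord"
  assumes F_S: "\<And>q. q \<in> S1 \<Longrightarrow> F q \<in> S2" and smooth_F: "smooth_on F S1"
    and isometry: "\<And>q x y. q \<in> S1 \<Longrightarrow>
      G2 (F q) (frechet_derivative F (at q) x) (frechet_derivative F (at q) y) = G1 q x y"
begin

abbreviation DF :: "coord \<Rightarrow> coord \<Rightarrow> coord" where "DF q \<equiv> frechet_derivative F (at q)"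
abbreviation DDF :: "coord \<Rightarrow> coord \<Rightarrow> coord \<Rightarrow> coord" where
  "DDF q x y \<equiv> frechet_derivative (\<lambda>r. DF r x) (at q) y"

lemma DF: "q \<in> S1 \<Longrightarrow> (F has_derivative DF q) (at q)"
  by (rule smooth_on_has_derivative[OF smooth_F])

lemma linear_DF: "q \<in> S1 \<Longrightarrow> linear (DF q)"
  using DF has_derivative_linear by blast

lemma DDF: "q \<in> S1 \<Longrightarrow> ((\<lambda>r. DF r x) has_derivative DDF q x) (at q)"
  by (rule smooth_on_has_derivative[OF smooth_on_derivative[OF smooth_F]])

lemma DDF_sym: "q \<in> S1 \<Longrightarrow> DDF q x y = DDF q y x"
  by (rule second_derivative_symmetric[OF C1.open_S _ smooth_F])

lemma DDF_has_derivative: "q \<in> S1 \<Longrightarrow>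
    ((\<lambda>r. DDF r x y) has_derivative frechet_derivative (\<lambda>r. DDF r x y) (at q)) (at q)"
  by (intro smooth_on_has_derivative[of _ S1] smooth_on_derivative smooth_F)

text \<open>A derivative that preserves a nondegenerate metric is injective. Surjectivity then lets
  every test vector be written as \<open>DF q z\<close>.\<close>

lemma surj_DF: "q \<in> S1 \<Longrightarrow> surj (DF q)"
proof -
  assume q: "q \<in> S1"
  have "inj (DF q)"
  proof (rule linear_injective_0[OF linear_DF[OF q], THEN iffD2], intro allI impI)
    fix x assume x: "DF q x = 0"
    have "\<forall>y. G1 q x y = 0"
      using isometry[OF q, of x] unfolding x by (simp add: bilinear_lzero[OF C2.bil[OF F_S[OF q]]])
    then show "x = 0" by (rule signature_2_2_nondegenerate[OF C1.bil[OF q] C1.sig[OF q]])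
  qed
  then show ?thesis using linear_injective_imp_surjective[OF linear_DF[OF q]] by blast
qed

text \<open>The differentiated isometry equation is inserted into the Koszul formula. By symmetry of
  the Hessian of F all its contributions cancel except one, the inhomogeneous term of the
  transformation law.\<close>

lemma Gam_change:
  assumes q: "q \<in> S1"
  shows "DF q (C1.Gam q x y) = C2.Gam (F q) (DF q x) (DF q y) + DDF q x y"
proof (rule C2.eqI[OF F_S[OF q] F_S[OF q]])
  note Fq = F_S[OF q] note bil2 = C2.bil[OF Fq]
  have D1: "C1.D q a b c = C2.D (F q) (DF q a) (DF q b) (DF q c)
     + G2 (F q) (DDF q a c) (DF q b) + G2 (F q) (DF q a) (DDF q b c)" for a b c
  proof -
    have "((\<lambda>r. G2 (F r) (DF r a) (DF r b)) has_derivative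
       (\<lambda>h. C2.D (F q) (DF q a) (DF q b) (DF q h)
         + G2 (F q) (DDF q a h) (DF q b) + G2 (F q) (DF q a) (DDF q b h))) (at q)"
      by (rule has_derivative_bilinear_apply[where B = "\<lambda>r. G2 (F r)", OF C1.open_S q])
        (auto intro: C2.bil F_S has_derivative_compose[OF DF[OF q] C2.D[OF Fq]] DDF[OF q])
    from frechet_derivative_unique_at[OF this]
    have "frechet_derivative (\<lambda>r. G2 (F r) (DF r a) (DF r b)) (at q) c = C2.D (F q) (DF q a) (DF q b) (DF q c)
         + G2 (F q) (DDF q a c) (DF q b) + G2 (F q) (DF q a) (DDF q b c)" by simp
    moreover have "C1.D q a b = frechet_derivative (\<lambda>r. G2 (F r) (DF r a) (DF r b)) (at q)"
      by (rule frechet_derivative_cong_open[OF C1.open_S q]) (simp add: isometry)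
    ultimately show ?thesis by simp
  qed
  fix v
  obtain z where z: "v = DF q z" using surj_DF[OF q] by blast
  have s: "G2 (F q) u w = G2 (F q) w u" for u w by (rule C2.sym[OF Fq])
  have "G2 (F q) (DF q (C1.Gam q x y)) v = (C1.D q y z x + C1.D q x z y - C1.D q x y z) / 2"
    unfolding z isometry[OF q] by (rule C1.Gam[OF q])
  also have "\<dots> = (C2.D (F q) (DF q y) v (DF q x) + C2.D (F q) (DF q x) v (DF q y) - C2.D (F q) (DF q x) (DF q y) v) / 2
      + G2 (F q) (DDF q x y) v"
    unfolding D1 z using s[of "DF q y" "DDF q z x"] s[of "DF q x" "DDF q z y"] s[of "DF q x" "DDF q y z"] s[of "DF q y" "DDF q x z"]
      s[of "DF q z" "DDF q y x"]
    by (simp add: DDF_sym[OF q, of y x] DDF_sym[OF q, of z x] DDF_sym[OF q, of z y] field_simps)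
  also have "\<dots> = G2 (F q) (C2.Gam (F q) (DF q x) (DF q y) + DDF q x y) v"
    by (simp add: bilinear_ladd[OF bil2] C2.Gam[OF Fq])
  finally show "G2 (F q) (DF q (C1.Gam q x y)) v = G2 (F q) (C2.Gam (F q) (DF q x) (DF q y) + DDF q x y) v" .
qed

text \<open>Differentiating \<open>Gam_change\<close> adds to the tensorial part of
  \<open>cov2\<close> a remainder that is symmetric in x and y, because second and third derivatives
  of F commute. It drops out of the antisymmetrisation.\<close>

lemma curv_change:
  assumes q: "q \<in> S1"
  shows "DF q (C1.curv q x y z) = C2.curv (F q) (DF q x) (DF q y) (DF q z)"
proof -
  note Fq = F_S[OF q] note B = C2.bilinear_Gam[OF Fq]
  have cov2: "DF q (C1.cov2 q x y z) = C2.cov2 (F q) (DF q x) (DF q y) (DF q z)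
      + (C2.Gam (F q) (DDF q y x) (DF q z) + (C2.Gam (F q) (DF q y) (DDF q z x) + C2.Gam (F q) (DF q x) (DDF q y z))
      + frechet_derivative (\<lambda>r. DDF r z y) (at q) x)" for x y
  proof -
    have 1: "((\<lambda>r. DF r (C1.Gam r y z)) has_derivative
        (\<lambda>h. DDF q (C1.Gam q y z) h + DF q (C1.DGam q y z h))) (at q)"
      by (rule has_derivative_linear_apply[OF C1.open_S q linear_DF DDF[OF q] C1.DGam[OF q]])
    have 2: "((\<lambda>r. C2.Gam (F r) (DF r y) (DF r z)) has_derivative
       (\<lambda>h. C2.DGam (F q) (DF q y) (DF q z) (DF q h)
         + C2.Gam (F q) (DDF q y h) (DF q z) + C2.Gam (F q) (DF q y) (DDF q z h))) (at q)"
      by (rule has_derivative_bilinear_apply[where B = "\<lambda>r. C2.Gam (F r)", OF C1.open_S q])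
        (auto intro: C2.bilinear_Gam F_S has_derivative_compose[OF DF[OF q] C2.DGam[OF Fq]] DDF[OF q])
    have "((\<lambda>r. C2.Gam (F r) (DF r y) (DF r z) + DDF r z y) has_derivative
       (\<lambda>h. (C2.DGam (F q) (DF q y) (DF q z) (DF q h)
         + C2.Gam (F q) (DDF q y h) (DF q z) + C2.Gam (F q) (DF q y) (DDF q z h))
         + frechet_derivative (\<lambda>r. DDF r z y) (at q) h)) (at q)"
      by (rule has_derivative_add[OF 2 DDF_has_derivative[OF q]])
    then have "((\<lambda>r. DF r (C1.Gam r y z)) has_derivative
       (\<lambda>h. (C2.DGam (F q) (DF q y) (DF q z) (DF q h)
         + C2.Gam (F q) (DDF q y h) (DF q z) + C2.Gam (F q) (DF q y) (DDF q z h))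
         + frechet_derivative (\<lambda>r. DDF r z y) (at q) h)) (at q)"
      by (rule has_derivative_transform_within_open[OF _ C1.open_S q]) (simp add: Gam_change DDF_sym[of _ z y])
    from fun_cong[OF has_derivative_unique[OF 1 this], of x]
    have "DDF q (C1.Gam q y z) x + DF q (C1.DGam q y z x) = C2.DGam (F q) (DF q y) (DF q z) (DF q x)
         + C2.Gam (F q) (DDF q y x) (DF q z) + C2.Gam (F q) (DF q y) (DDF q z x)
         + frechet_derivative (\<lambda>r. DDF r z y) (at q) x" by simp
    moreover have "DF q (C1.cov2 q x y z) = DF q (C1.DGam q y z x)
        + (C2.Gam (F q) (DF q x) (C2.Gam (F q) (DF q y) (DF q z) + DDF q y z) + DDF q (C1.Gam q y z) x)"
      unfolding C1.cov2_def linear_add[OF linear_DF[OF q]] Gam_change[OF q] DDF_sym[OF q, of x "C1.Gam q y z"]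
      by (simp only: Gam_change[OF q])
    ultimately show ?thesis unfolding C2.cov2_def
      by (simp add: bilinear_radd[OF B] algebra_simps)
  qed
  have "frechet_derivative (\<lambda>r. DDF r z y) (at q) x = frechet_derivative (\<lambda>r. DDF r z x) (at q) y"
    by (rule second_derivative_symmetric[OF C1.open_S q smooth_on_derivative[OF smooth_F]])
  then show ?thesis unfolding C1.curv_def C2.curv_def linear_diff[OF linear_DF[OF q]] cov2
    by (simp add: DDF_sym[OF q, of y x] DDF_sym[OF q, of z x] DDF_sym[OF q, of z y] algebra_simps)
qed

end

section \<open>Orthonormal frames and contractions\<close>

lemma matrix_inv_eqI:
  fixes A B :: "real^'n^'n"
  assumes "A ** B = Finite_Cartesian_Product.mat 1" "B ** A = Finite_Cartesian_Product.mat 1"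
  shows "matrix_inv A = B"
proof -
  have "\<exists>A'. A ** A' = Finite_Cartesian_Product.mat 1 \<and> A' ** A = Finite_Cartesian_Product.mat 1" using assms by blast
  from someI_ex[OF this] have "matrix_inv A ** A = Finite_Cartesian_Product.mat 1"
    unfolding matrix_inv_def by blast
  then have "matrix_inv A ** (A ** B) = B" by (simp add: matrix_mul_assoc)
  then show ?thesis using assms(1) by simp
qed

definition metric_at :: "bilin \<Rightarrow> bool" where
  "metric_at b \<longleftrightarrow> bilinear b \<and> (\<forall>x y. b x y = b y x) \<and> signature_2_2 b"

definition eps :: "4 \<Rightarrow> real" where
  "eps i = (if i \<in> {0, 1} then - 1 else 1)"

definition orthonormal :: "bilin \<Rightarrow> (4 \<Rightarrow> coord) \<Rightarrow> bool" where
  "orthonormal b e \<longleftrightarrow> (\<forall>i j. b (e i) (e j) = (if i = j then eps i else 0))"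

lemma orthonormal_exists: "signature_2_2 b \<Longrightarrow> \<exists>e. orthonormal b e"
  unfolding signature_2_2_def orthonormal_def eps_def by (metis (full_types))

lemma eps_mult_self [simp]: "eps i * eps i = 1" "eps i * (eps i * x) = x"
  by (simp_all add: eps_def)

lemma bilin_sum:
  assumes "bilinear b"
  shows "b (\<Sum>i\<in>I. u i *\<^sub>R e i) y = (\<Sum>i\<in>I. u i * b (e i) y :: real)"
    and "b y (\<Sum>i\<in>I. u i *\<^sub>R e i) = (\<Sum>i\<in>I. u i * b y (e i) :: real)"
proof -
  have l: "linear (\<lambda>x. b x y)" and r: "linear (b y)" using assms unfolding bilinear_def by blast+
  show "b (\<Sum>i\<in>I. u i *\<^sub>R e i) y = (\<Sum>i\<in>I. u i * b (e i) y :: real)"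
    using linear_sum[OF l, of "\<lambda>i. u i *\<^sub>R e i" I] linear_cmul[OF l] by simp
  show "b y (\<Sum>i\<in>I. u i *\<^sub>R e i) = (\<Sum>i\<in>I. u i * b y (e i) :: real)"
    using linear_sum[OF r, of "\<lambda>i. u i *\<^sub>R e i" I] linear_cmul[OF r] by simp
qed

context
  fixes b :: bilin and e :: "4 \<Rightarrow> coord"
  assumes b: "metric_at b" and e: "orthonormal b e"
begin

lemma frame_expand: "w = (\<Sum>i\<in>UNIV. (eps i * b w (e i)) *\<^sub>R e i)"
proof (rule metric_eqI)
  show bil: "bilinear b" and "signature_2_2 b" using b unfolding metric_at_def by auto
  let ?f = "\<lambda>v :: coord. \<Sum>i\<in>UNIV. vec_nth v i *\<^sub>R e i"
  have lin: "linear ?f"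
    by (rule linearI) (simp_all add: scaleR_add_left sum.distrib scaleR_sum_right)
  have fe: "b (?f v) (e j) = vec_nth v j * eps j" for v j
  proof -
    have "b (?f v) (e j) = (\<Sum>i\<in>UNIV. vec_nth v i * (if i = j then eps i else 0))"
      using e unfolding orthonormal_def by (simp add: bilin_sum[OF bil])
    also have "\<dots> = (\<Sum>i\<in>UNIV. if i = j then vec_nth v j * eps j else 0)"
      by (rule sum.cong) auto
    finally show ?thesis by simp
  qed
  have "v = 0" if "?f v = 0" for v
  proof -
    have "vec_nth v j * eps j = 0" for j
      using fe[of v j] that bilinear_lzero[OF bil] by simp
    then have "vec_nth v j = 0" for j by (metis eps_mult_self(1) mult_eq_0_iff zero_neq_one)
    then show ?thesis by (simp add: cart_eq_iff)
  qed
  then have "inj ?f" using linear_injective_0[OF lin] by blast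
  then have surj: "surj ?f" using linear_injective_imp_surjective[OF lin] by blast
  fix v
  obtain u where u: "v = ?f u" using surj by blast
  obtain w' where w': "w = ?f w'" using surj by blast
  have "(\<Sum>i\<in>UNIV. (eps i * b w (e i)) *\<^sub>R e i) = w"
    unfolding w' fe by (rule sum.cong) (simp_all add: mult.commute mult.left_commute)
  then show "b w v = b (\<Sum>i\<in>UNIV. (eps i * b w (e i)) *\<^sub>R e i) v" by simp
qed

lemma frame_contraction: "linear \<beta> \<Longrightarrow> (\<Sum>i\<in>UNIV. eps i * b w (e i) * \<beta> (e i)) = (\<beta> w :: real)"
  using linear_sum[of \<beta> "\<lambda>i. (eps i * b w (e i)) *\<^sub>R e i" UNIV] linear_cmul[of \<beta>] frame_expand[of w]
  by simp

lemma contract_frame: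
  assumes h: "bilinear h"
  shows "contract b h = (\<Sum>i\<in>UNIV. eps i * h (e i) (e i))"
proof -
  let ?M = "vec_lambda (\<lambda>i. vec_lambda (\<lambda>j. b (axis i 1) (axis j 1))) :: real^4^4"
  \<comment> \<open>In coordinates the inverse metric is the sum of the squares of the frame
    vectors, weighted by \<open>eps\<close>.\<close>
  let ?N = "vec_lambda (\<lambda>i. vec_lambda (\<lambda>j. \<Sum>k\<in>UNIV. eps k * vec_nth (e k) i * vec_nth (e k) j)) :: real^4^4"
  have bil: "bilinear b" using b unfolding metric_at_def by auto
  have lin: "linear (\<lambda>x. b x y)" "linear (b y)" "linear (\<lambda>x. h x y)" "linear (h y)" for y
    using bil h unfolding bilinear_def by blast+
  have NM: "?N ** ?M = Finite_Cartesian_Product.mat 1"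
  proof -
    have "vec_nth (vec_nth (?N ** ?M) i) j = vec_nth (axis j 1 :: coord) i" for i j
    proof -
      have "vec_nth (vec_nth (?N ** ?M) i) j
          = (\<Sum>k\<in>UNIV. \<Sum>l\<in>UNIV. eps l * vec_nth (e l) i * vec_nth (e l) k * b (axis k 1) (axis j 1))"
        by (simp add: matrix_matrix_mult_def sum_distrib_right)
      also have "\<dots> = (\<Sum>l\<in>UNIV. \<Sum>k\<in>UNIV. eps l * vec_nth (e l) i * vec_nth (e l) k * b (axis k 1) (axis j 1))"
        by (rule sum.swap)
      also have "\<dots> = (\<Sum>l\<in>UNIV. eps l * b (axis j 1) (e l) * vec_nth (e l) i)"
      proof (rule sum.cong[OF refl])
        fix l
        have "b (axis j 1) (e l) = b (e l) (axis j 1)" using b unfolding metric_at_def by blast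
        also have "\<dots> = (\<Sum>k\<in>UNIV. vec_nth (e l) k * b (axis k 1) (axis j 1))"
          using coord_expand[OF lin(1), of "e l"] by simp
        finally show "(\<Sum>k\<in>UNIV. eps l * vec_nth (e l) i * vec_nth (e l) k * b (axis k 1) (axis j 1))
            = eps l * b (axis j 1) (e l) * vec_nth (e l) i"
          by (simp add: sum_distrib_left sum_distrib_right ac_simps)
      qed
      also have "\<dots> = vec_nth (axis j 1 :: coord) i"
        by (rule frame_contraction) (rule linearI, simp_all)
      finally show ?thesis .
    qed
    then show ?thesis
      by (simp add: cart_eq_iff axis_def Finite_Cartesian_Product.mat_def)
  qed
  then have MN: "?M ** ?N = Finite_Cartesian_Product.mat 1" using matrix_left_right_inverse by blast
  have inv: "matrix_inv ?M = ?N" using matrix_inv_eqI[OF MN NM] .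
  have "h w w = (\<Sum>i\<in>UNIV. \<Sum>j\<in>UNIV. vec_nth w i * vec_nth w j * h (axis i 1) (axis j 1))" for w
    using coord_expand[OF lin(3), of w w] coord_expand[OF lin(4), where v = w]
    by (simp add: sum_distrib_left mult.assoc)
  then have "(\<Sum>k\<in>UNIV. eps k * h (e k) (e k))
      = (\<Sum>k\<in>UNIV. \<Sum>i\<in>UNIV. \<Sum>j\<in>UNIV. eps k * vec_nth (e k) i * vec_nth (e k) j * h (axis i 1) (axis j 1))"
    by (simp add: sum_distrib_left mult.assoc)
  also have "\<dots> = (\<Sum>i\<in>UNIV. \<Sum>k\<in>UNIV. \<Sum>j\<in>UNIV. eps k * vec_nth (e k) i * vec_nth (e k) j * h (axis i 1) (axis j 1))"
    by (rule sum.swap)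
  also have "\<dots> = (\<Sum>i\<in>UNIV. \<Sum>j\<in>UNIV. \<Sum>k\<in>UNIV. eps k * vec_nth (e k) i * vec_nth (e k) j * h (axis i 1) (axis j 1))"
    by (rule sum.cong[OF refl], rule sum.swap)
  also have "\<dots> = contract b h"
    unfolding contract_def inv by (simp add: sum_distrib_right)
  finally show ?thesis by simp
qed

end

text \<open>F sends orthonormal frames to orthonormal frames, so both contractions are the same
  frame sum.\<close>

lemma contract_pullback:
  assumes b: "metric_at b" and b': "metric_at b'" and F: "\<And>x y. b (F x) (F y) = b' x y"
    and h: "bilinear h" and h': "bilinear h'" "\<And>x y. h (F x) (F y) = h' x y"
  shows "contract b' h' = contract b h"
proof -
  obtain e where e: "orthonormal b' e"
    using orthonormal_exists b' unfolding metric_at_def by blast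
  then have "orthonormal b (\<lambda>i. F (e i))" unfolding orthonormal_def F .
  then show ?thesis
    by (simp add: contract_frame[OF b' e h'(1)] contract_frame[OF b _ h] h'(2))
qed

section \<open>Algebraic curvature tensors and the Weyl tensor\<close>

text \<open>Linearity is stated for the first slot; the symmetries pass it on to the others.\<close>

definition alg_curv :: "curv4 \<Rightarrow> bool" where
  "alg_curv T \<longleftrightarrow> (\<forall>y z v. linear (\<lambda>x. T x y z v)) \<and> (\<forall>x y z v. T x y z v = - T y x z v) \<and>
     (\<forall>x y z v. T x y z v = - T x y v z) \<and> (\<forall>x y z v. T x y z v + T y z x v + T z x y v = 0)"

lemma alg_curvD:
  assumes "alg_curv T"
  shows "linear (\<lambda>x. T x y z v)" "T x y z v = - T y x z v" "T x y z v = - T x y v z"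
    "T x y z v + T y z x v + T z x y v = 0"
  using assms unfolding alg_curv_def by blast+

text \<open>Four Bianchi identities, each with a different vector in the last slot, are written in
  six common components. Adding the first two and subtracting the sum of the last two leaves twice
  the difference of the two sides.\<close>

lemma alg_curv_pair:
  assumes "alg_curv T"
  shows "T x y z v = T z v x y"
proof -
  note B = alg_curvD(4)[OF assms] and a = alg_curvD(2)[OF assms] and b = alg_curvD(3)[OF assms]
  have "T x y z v + T y z x v - T x z y v = 0"
    using B[of x y z v] a[of z x y v] by linarith
  moreover have "- T y z x v - T z v x y + T y v x z = 0"
    using B[of y z v x] b[of y z v x] b[of z v y x] a[of v y z x] b[of y v z x] by linarith
  moreover have "T z v x y + T x v y z - T x z y v = 0"
    using B[of z v x y] a[of v x z y] b[of x v z y] b[of x z v y] by linarith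
  moreover have "- T x v y z - T x y z v + T y v x z = 0"
    using B[of v x y z] a[of v x y z] b[of x y v z] by linarith
  ultimately show ?thesis by linarith
qed

lemma alg_curv_linear:
  assumes T: "alg_curv T"
  shows "linear (\<lambda>x. T x y z v)" "linear (\<lambda>y. T x y z v)" "linear (\<lambda>z. T x y z v)" "linear (\<lambda>v. T x y z v)"
proof -
  show 1: "linear (\<lambda>x. T x y z v)" for y z v by (rule alg_curvD[OF T])
  have "(\<lambda>y. T x y z v) = (\<lambda>y. - T y x z v)" for x z v using alg_curvD(2)[OF T] by blast
  then show 2: "linear (\<lambda>y. T x y z v)" for x z v using linear_compose_neg[OF 1[of x z v]] by simp
  show "linear (\<lambda>z. T x y z v)" by (subst alg_curv_pair[OF T]) (rule 1)
  show "linear (\<lambda>v. T x y z v)" by (subst alg_curv_pair[OF T]) (rule 2)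
qed

lemma alg_curv_bilinear:
  assumes T: "alg_curv T"
  shows "bilinear (\<lambda>x z. T x y z v)" "bilinear (\<lambda>x v. T x y z v)" "bilinear (\<lambda>y v. T x y z v)"
    "bilinear (\<lambda>y z. T x y z v)"
  unfolding bilinear_def using alg_curv_linear[OF T] by blast+

lemma ricci_frame:
  assumes "metric_at b" "orthonormal b e" "alg_curv T"
  shows "ricci b T y v = (\<Sum>i\<in>UNIV. eps i * T (e i) y (e i) v)"
  unfolding ricci_def by (rule contract_frame[OF assms(1,2) alg_curv_bilinear(1)[OF assms(3)]])

lemma ricci_bilinear:
  assumes "metric_at b" "alg_curv T"
  shows "bilinear (ricci b T)" "ricci b T y v = ricci b T v y"
proof -
  obtain e where e: "orthonormal b e"
    using orthonormal_exists assms(1) unfolding metric_at_def by blast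
  note R = ricci_frame[OF assms(1) e assms(2)]
  show "ricci b T y v = ricci b T v y" for y v
    unfolding R using alg_curv_pair[OF assms(2)] by (intro sum.cong) auto
  have "linear (\<lambda>y. T (e i) y (e i) v)" "linear (\<lambda>v. T (e i) y (e i) v)" for i y v
    by (rule alg_curv_linear[OF assms(2)])+
  then have "linear (\<lambda>y. \<Sum>i\<in>UNIV. eps i *\<^sub>R T (e i) y (e i) v)" "linear (\<lambda>v. \<Sum>i\<in>UNIV. eps i *\<^sub>R T (e i) y (e i) v)" for y v
    using linear_compose_sum[of UNIV "\<lambda>i y. eps i *\<^sub>R T (e i) y (e i) v"]
      linear_compose_sum[of UNIV "\<lambda>i v. eps i *\<^sub>R T (e i) y (e i) v"] linear_compose_scale_right by blast+
  then show "bilinear (ricci b T)" unfolding bilinear_def R by simp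
qed

lemma alg_curv_kulkarni:
  assumes "bilinear h" "bilinear k" "\<And>x y. h x y = h y x" "\<And>x y. k x y = k y x"
  shows "alg_curv (kulkarni h k)"
proof -
  have "linear (\<lambda>x. kulkarni h k x y z v)" for y z v
    unfolding kulkarni_def
    by (rule linearI) (simp_all add: bilinear_ladd[OF assms(1)] bilinear_ladd[OF assms(2)]
        bilinear_lmul[OF assms(1)] bilinear_lmul[OF assms(2)] algebra_simps)
  moreover have "kulkarni h k x y z v + kulkarni h k y z x v + kulkarni h k z x y v = 0" for x y z v
    unfolding kulkarni_def assms(3)[of z x] assms(3)[of z y] assms(3)[of y x]
      assms(4)[of z x] assms(4)[of z y] assms(4)[of y x] by simp
  ultimately show ?thesis
    unfolding alg_curv_def by (simp add: kulkarni_def)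
qed

text \<open>The shape \<open>T - r U - s V\<close> is that of \<open>weyl4\<close>.\<close>

lemma alg_curv_lincomb:
  assumes "alg_curv T" "alg_curv U" "alg_curv V"
  shows "alg_curv (\<lambda>x y z v. T x y z v - r * U x y z v - s * V x y z v)"
proof -
  have "linear (\<lambda>x. T x y z v - r * U x y z v - s * V x y z v)" for y z v
    using linear_compose_sub[OF linear_compose_sub[OF alg_curvD(1)[OF assms(1)]
        linear_compose_scale_right[OF alg_curvD(1)[OF assms(2)]]] linear_compose_scale_right[OF alg_curvD(1)[OF assms(3)]]]
    by simp
  moreover have "T x y z v - r * U x y z v - s * V x y z v = - (T y x z v - r * U y x z v - s * V y x z v)" for x y z v
    unfolding alg_curvD(2)[OF assms(1), of x y z v] alg_curvD(2)[OF assms(2), of x y z v]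
      alg_curvD(2)[OF assms(3), of x y z v] by simp
  moreover have "T x y z v - r * U x y z v - s * V x y z v = - (T x y v z - r * U x y v z - s * V x y v z)" for x y z v
    unfolding alg_curvD(3)[OF assms(1), of x y z v] alg_curvD(3)[OF assms(2), of x y z v]
      alg_curvD(3)[OF assms(3), of x y z v] by simp
  moreover have "(T x y z v - r * U x y z v - s * V x y z v) + (T y z x v - r * U y z x v - s * V y z x v)
     + (T z x y v - r * U z x y v - s * V z x y v) = 0" for x y z v
  proof -
    have "(T x y z v - r * U x y z v - s * V x y z v) + (T y z x v - r * U y z x v - s * V y z x v)
     + (T z x y v - r * U z x y v - s * V z x y v)
      = (T x y z v + T y z x v + T z x y v) - r * (U x y z v + U y z x v + U z x y v)
        - s * (V x y z v + V y z x v + V z x y v)" by (simp add: algebra_simps)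
    then show ?thesis by (simp add: alg_curvD(4)[OF assms(1)] alg_curvD(4)[OF assms(2)] alg_curvD(4)[OF assms(3)])
  qed
  ultimately show ?thesis unfolding alg_curv_def by blast
qed

lemma linear_lincomb:
  "linear f \<Longrightarrow> linear g \<Longrightarrow> linear (\<lambda>x. f x - r * g x :: real)"
  using linear_compose_sub[OF _ linear_compose_scale_right[of g r], of f] by simp

lemma bilinear_lincomb:
  assumes "bilinear h" "bilinear k"
  shows "bilinear (\<lambda>x y. h x y - r * k x y :: real)"
  using assms unfolding bilinear_def by (auto intro!: linear_lincomb)

context
  fixes b :: bilin and T :: curv4
  assumes b: "metric_at b" and T: "alg_curv T"
begin

lemma traceless_ricci:
  "bilinear (\<lambda>u w. ricci b T u w - scal b T / 4 * b u w)"
  "ricci b T u w - scal b T / 4 * b u w = ricci b T w u - scal b T / 4 * b w u"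
  using b bilinear_lincomb[OF ricci_bilinear(1)[OF b T], of b "scal b T / 4"] ricci_bilinear(2)[OF b T, of u w]
  unfolding metric_at_def by auto

lemma alg_curv_weyl4: "alg_curv (weyl4 b T)"
proof -
  have "bilinear b" "\<And>x y. b x y = b y x" using b unfolding metric_at_def by auto
  from alg_curv_lincomb[OF T alg_curv_kulkarni[OF this(1,1,2,2)]
      alg_curv_kulkarni[OF traceless_ricci(1) this(1) traceless_ricci(2) this(2)], of "scal b T / 24" "1 / 2"]
  show ?thesis unfolding weyl4_def[abs_def] .
qed

lemma ricci_weyl4: "ricci b (weyl4 b T) y v = 0"
proof -
  obtain e where e: "orthonormal b e"
    using orthonormal_exists b unfolding metric_at_def by blast
  have bil: "bilinear b" and sym: "\<And>x y. b x y = b y x" using b unfolding metric_at_def by auto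
  define h where "h = (\<lambda>u w. ricci b T u w - scal b T / 4 * b u w)"
  have hb: "bilinear h" unfolding h_def by (rule traceless_ricci(1))
  have hs: "h x y = h y x" for x y unfolding h_def by (rule traceless_ricci(2))
  have tb: "(\<Sum>i\<in>UNIV. eps i * b (e i) (e i)) = 4"
    using e unfolding orthonormal_def by simp
  have th: "(\<Sum>i\<in>UNIV. eps i * h (e i) (e i)) = 0"
  proof -
    have "(\<Sum>i\<in>UNIV. eps i * h (e i) (e i))
        = (\<Sum>i\<in>UNIV. eps i * ricci b T (e i) (e i)) - scal b T / 4 * (\<Sum>i\<in>UNIV. eps i * b (e i) (e i))"
      unfolding h_def by (simp add: sum_subtractf sum_distrib_left algebra_simps)
    also have "(\<Sum>i\<in>UNIV. eps i * ricci b T (e i) (e i)) = scal b T"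
      unfolding scal_def contract_frame[OF b e ricci_bilinear(1)[OF b T]] ..
    finally show ?thesis unfolding tb by simp
  qed
  \<comment> \<open>Contracting a Kulkarni product with the metric gives
    \<open>(tr k) b + (n - 2) k\<close> in dimension n = 4. For k = b this is 6 b, which matches the
    denominator 24 = 4 * 6.\<close>
  have K: "(\<Sum>i\<in>UNIV. eps i * kulkarni k b (e i) y (e i) v) = (\<Sum>i\<in>UNIV. eps i * k (e i) (e i)) * b y v + 2 * k y v"
    if k: "bilinear k" "\<And>x y. k x y = k y x" for k
  proof -
    have "(\<Sum>i\<in>UNIV. eps i * kulkarni k b (e i) y (e i) v)
      = (\<Sum>i\<in>UNIV. eps i * k (e i) (e i)) * b y v + k y v * (\<Sum>i\<in>UNIV. eps i * b (e i) (e i))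
        - (\<Sum>i\<in>UNIV. eps i * b y (e i) * k (e i) v) - (\<Sum>i\<in>UNIV. eps i * b v (e i) * k y (e i))"
      unfolding kulkarni_def
      by (simp add: sum_subtractf sum.distrib sum_distrib_left sum_distrib_right algebra_simps sym[of _ v])
    moreover have "linear (\<lambda>x. k x v)" "linear (k y)" using k(1) unfolding bilinear_def by blast+
    ultimately show ?thesis unfolding tb
      by (simp add: frame_contraction[OF b e, of "\<lambda>x. k x v"] frame_contraction[OF b e, of "k y"])
  qed
  have "ricci b (weyl4 b T) y v = (\<Sum>i\<in>UNIV. eps i * T (e i) y (e i) v)
     - scal b T / 24 * (\<Sum>i\<in>UNIV. eps i * kulkarni b b (e i) y (e i) v)
     - 1 / 2 * (\<Sum>i\<in>UNIV. eps i * kulkarni h b (e i) y (e i) v)"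
    unfolding ricci_frame[OF b e alg_curv_weyl4] weyl4_def h_def
    by (simp add: sum_subtractf sum.distrib sum_distrib_left algebra_simps)
  also have "\<dots> = ricci b T y v - scal b T / 24 * (6 * b y v) - h y v"
    unfolding K[OF bil sym] K[OF hb hs] th tb ricci_frame[OF b e T] by simp
  also have "\<dots> = 0" unfolding h_def by simp
  finally show ?thesis .
qed

end

lemma weyl4_pullback:
  assumes b: "metric_at b" "metric_at b'" "\<And>x y. b (F x) (F y) = b' x y"
    and T: "alg_curv T" "alg_curv T'" "\<And>x y z v. T (F x) (F y) (F z) (F v) = T' x y z v"
  shows "weyl4 b' T' x y z v = weyl4 b T (F x) (F y) (F z) (F v)"
proof -
  have R: "ricci b T (F y) (F v) = ricci b' T' y v" for y v
    unfolding ricci_def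
    by (rule contract_pullback[OF b, symmetric]) (use T alg_curv_bilinear(1) in auto)
  have "scal b' T' = scal b T"
    unfolding scal_def
    by (rule contract_pullback[OF b]) (use R ricci_bilinear[OF b(1) T(1)] ricci_bilinear[OF b(2) T(2)] in auto)
  then show ?thesis by (simp add: weyl4_def kulkarni_def R b(3) T(3))
qed

lemma lower_sharp_weyl4:
  assumes "metric_at b" "alg_curv T"
  shows "lower b (\<lambda>x y z. sharp b (weyl4 b T x y z)) = weyl4 b T"
  using assms(1) sharp_eq[OF _ _ alg_curv_linear(4)[OF alg_curv_weyl4[OF assms]]]
  unfolding metric_at_def lower_def by (intro ext) blast

context metric_chart
begin

lemma metric_at: "q \<in> S \<Longrightarrow> metric_at (G q)"
  unfolding metric_at_def using bil sym sig by blast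

lemma smooth_contract:
  assumes "\<And>i j. smooth_on (\<lambda>q. h q (axis i 1) (axis j 1)) S"
  shows "smooth_on (\<lambda>q. contract (G q) (h q)) S"
proof -
  let ?M = "\<lambda>q. vec_lambda (\<lambda>i. vec_lambda (\<lambda>j. G q (axis i 1) (axis j 1))) :: real^4^4"
  have M: "Determinants.det (?M q) \<noteq> 0" if "q \<in> S" for q
  proof -
    have "?M q = gram (G q)" unfolding gram_def using sym[OF that] by simp
    then show ?thesis using det_gram[OF bil[OF that] sig[OF that]] by simp
  qed
  \<comment> \<open>The columns of the inverse solve linear systems with the Gram matrix, so
    Cramer's rule applies.\<close>
  have "smooth_on (\<lambda>q. matrix_inv (?M q) *v axis j 1) S" for j
  proof (rule smooth_on_solve[OF open_S, of ?M "\<lambda>q. axis j 1"])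
    fix q assume q: "q \<in> S"
    obtain B where "?M q ** B = Finite_Cartesian_Product.mat 1" "B ** ?M q = Finite_Cartesian_Product.mat 1"
      using M[OF q] unfolding invertible_det_nz[symmetric] invertible_def by blast
    then have "?M q ** matrix_inv (?M q) = Finite_Cartesian_Product.mat 1"
      using matrix_inv_eqI by metis
    then show "?M q *v (matrix_inv (?M q) *v axis j 1) = axis j 1"
      by (simp add: matrix_vector_mul_assoc)
  qed (use M smooth smooth_on_const in auto)
  then have "smooth_on (\<lambda>q. vec_nth (matrix_inv (?M q) *v axis j 1) i) S" for i j
    by (rule smooth_on_nth[OF open_S])
  then have "smooth_on (\<lambda>q. vec_nth (vec_nth (matrix_inv (?M q)) i) j) S" for i j
    by (simp add: matrix_vector_mult_basis column_def)
  then show ?thesis unfolding contract_def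
    by (intro smooth_on_sum smooth_on_mult assms open_S)
qed

lemma smooth_sharp_weyl4:
  assumes T: "\<And>q. q \<in> S \<Longrightarrow> alg_curv (T q)" and smT: "\<And>x y z v. smooth_on (\<lambda>q. T q x y z v) S"
  shows "smooth_on (\<lambda>q. sharp (G q) (weyl4 (G q) (T q) x y z)) S"
proof (rule smooth_sharp)
  show "linear (weyl4 (G q) (T q) x y z)" if "q \<in> S" for q
    by (rule alg_curv_linear(4)[OF alg_curv_weyl4[OF metric_at[OF that] T[OF that]]])
  have R: "smooth_on (\<lambda>q. ricci (G q) (T q) x y) S" for x y
    unfolding ricci_def by (rule smooth_contract) (rule smT)
  then have s: "smooth_on (\<lambda>q. scal (G q) (T q)) S"
    unfolding scal_def by (rule smooth_contract)
  show "smooth_on (\<lambda>q. weyl4 (G q) (T q) x y z v) S" for v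
    unfolding weyl4_def kulkarni_def divide_inverse
    by (intro smooth_on_diff smooth_on_add smooth_on_mult smooth_on_const R s smooth smT open_S)
qed

end

section \<open>Pointwise classification\<close>

text \<open>Frames count from 0 to 3, whereas \<open>exhaust_4\<close> counts from 1 to 4.\<close>

lemma four_eq_0: "(4::4) = 0"
  by simp

lemma UNIV_4': "(UNIV :: 4 set) = {0, 1, 2, 3}"
  using exhaust_4 unfolding four_eq_0 by auto

lemma sum_4': "(\<Sum>i\<in>UNIV. f (i::4)) = f 0 + f 1 + f 2 + f 3"
  unfolding UNIV_4' by (simp add: add.assoc)

lemma all_4': "(\<forall>i::4. P i) \<longleftrightarrow> P 0 \<and> P 1 \<and> P 2 \<and> P 3"
  using UNIV_4' by (metis UNIV_I empty_iff insert_iff)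

lemma eps_simps [simp]: "eps 0 = - 1" "eps 1 = - 1" "eps 2 = 1" "eps 3 = 1"
  by (simp_all add: eps_def)

definition frame4 :: "coord \<Rightarrow> coord \<Rightarrow> coord \<Rightarrow> coord \<Rightarrow> 4 \<Rightarrow> coord" where
  "frame4 a0 a1 a2 a3 i = (if i = 0 then a0 else if i = 1 then a1 else if i = 2 then a2 else a3)"

lemma frame4_simps [simp]:
  "frame4 a0 a1 a2 a3 0 = a0" "frame4 a0 a1 a2 a3 1 = a1" "frame4 a0 a1 a2 a3 2 = a2" "frame4 a0 a1 a2 a3 3 = a3"
  by (simp_all add: frame4_def)

lemma orthonormal_iff:
  assumes "\<And>x y. b x y = b y x"
  shows "orthonormal b e \<longleftrightarrow> b (e 0) (e 0) = - 1 \<and> b (e 1) (e 1) = - 1 \<and> b (e 2) (e 2) = 1 \<and> b (e 3) (e 3) = 1 \<and>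
    b (e 0) (e 1) = 0 \<and> b (e 0) (e 2) = 0 \<and> b (e 0) (e 3) = 0 \<and> b (e 1) (e 2) = 0 \<and> b (e 1) (e 3) = 0 \<and> b (e 2) (e 3) = 0"
  unfolding orthonormal_def all_4'
  using assms[of "e 1" "e 0"] assms[of "e 2" "e 0"] assms[of "e 3" "e 0"] assms[of "e 2" "e 1"]
    assms[of "e 3" "e 1"] assms[of "e 3" "e 2"] by auto

lemma alternating_4:
  fixes f :: "4 \<Rightarrow> 4 \<Rightarrow> real"
  assumes "\<And>i j. f i j = - f j i"
    and "f 0 1 = 0" "f 0 2 = 0" "f 0 3 = 0" "f 1 2 = 0" "f 1 3 = 0" "f 2 3 = 0"
  shows "f i j = 0"
proof -
  have "f i i = 0" for i using assms(1)[of i i] by simp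
  then have "\<forall>i j. f i j = 0"
    unfolding all_4'
    using assms(2-) assms(1)[of 1 0] assms(1)[of 2 0] assms(1)[of 3 0] assms(1)[of 2 1] assms(1)[of 3 1] assms(1)[of 3 2]
    by simp
  then show ?thesis by blast
qed

text \<open>A curvature tensor is a symmetric bilinear form on bivectors. With six index pairs,
  these are the 21 entries on and above the diagonal of its matrix.\<close>

definition basic_indices :: "(4 \<times> 4 \<times> 4 \<times> 4) set" where
  "basic_indices = {(0,1,0,1), (0,1,0,2), (0,1,0,3), (0,1,1,2), (0,1,1,3), (0,1,2,3),
      (0,2,0,2), (0,2,0,3), (0,2,1,2), (0,2,1,3), (0,2,2,3), (0,3,0,3), (0,3,1,2), (0,3,1,3), (0,3,2,3),
      (1,2,1,2), (1,2,1,3), (1,2,2,3), (1,3,1,3), (1,3,2,3), (2,3,2,3)}"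

lemma alg_curv_eqI:
  assumes b: "metric_at b" and e: "orthonormal b e" and T: "alg_curv T" and U: "alg_curv U"
    and eq: "\<And>i j k l. (i, j, k, l) \<in> basic_indices \<Longrightarrow>
      T (e i) (e j) (e k) (e l) = U (e i) (e j) (e k) (e l)"
  shows "T x y z v = U x y z v"
proof -
  let ?d = "\<lambda>i j k l. T (e i) (e j) (e k) (e l) - U (e i) (e j) (e k) (e l)"
  have d1: "?d i j k l = - ?d j i k l" for i j k l
    using alg_curvD(2)[OF T, of "e i" "e j"] alg_curvD(2)[OF U, of "e i" "e j"] by simp
  have d2: "?d i j k l = - ?d i j l k" for i j k l
    using alg_curvD(3)[OF T, of "e i" "e j" "e k" "e l"] alg_curvD(3)[OF U, of "e i" "e j" "e k" "e l"] by simp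
  have d3: "?d i j k l = ?d k l i j" for i j k l
    using alg_curv_pair[OF T, of "e i" "e j" "e k" "e l"] alg_curv_pair[OF U, of "e i" "e j" "e k" "e l"] by simp
  have d0: "?d i j k l = 0" if "(i, j) \<in> {(0,1),(0,2),(0,3),(1,2),(1,3),(2,3)}" "(k, l) \<in> {(0,1),(0,2),(0,3),(1,2),(1,3),(2,3)}" for i j k l
  proof -
    have "(i, j, k, l) \<in> basic_indices \<or> (k, l, i, j) \<in> basic_indices"
      using that unfolding insert_iff empty_iff prod.inject by (elim disjE conjE) (simp_all add: basic_indices_def)
    then have "?d i j k l = 0 \<or> ?d k l i j = 0"
      using eq[of i j k l] eq[of k l i j] by auto
    then show ?thesis using d3[of i j k l] by simp
  qed
  have d4: "?d i j k l = 0" if "(i, j) \<in> {(0,1),(0,2),(0,3),(1,2),(1,3),(2,3)}" for i j k l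
    by (rule alternating_4[of "\<lambda>k l. ?d i j k l"]) (rule d2, (rule d0[OF that], simp)+)
  have d: "?d i j k l = 0" for i j k l
    by (rule alternating_4[of "\<lambda>i j. ?d i j k l"]) (rule d1, (rule d4, simp)+)
  have expand: "V x y z v = (\<Sum>i\<in>UNIV. \<Sum>j\<in>UNIV. \<Sum>k\<in>UNIV. \<Sum>l\<in>UNIV. (eps i * b v (e i)) *\<^sub>R
      (eps j * b z (e j)) *\<^sub>R (eps k * b y (e k)) *\<^sub>R (eps l * b x (e l)) *\<^sub>R V (e l) (e k) (e j) (e i))"
    if V: "alg_curv V" for V
  proof -
    have 1: "\<beta> w = (\<Sum>i\<in>UNIV. (eps i * b w (e i)) *\<^sub>R \<beta> (e i))" if "linear \<beta>" for \<beta> :: "coord \<Rightarrow> real" and w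
      using frame_contraction[OF b e that, of w] by simp
    note L = alg_curv_linear[OF V]
    have "V x y' z' v' = (\<Sum>i\<in>UNIV. (eps i * b x (e i)) *\<^sub>R V (e i) y' z' v')" for y' z' v'
      by (rule 1[OF L(1)])
    moreover have "V x' y z' v' = (\<Sum>i\<in>UNIV. (eps i * b y (e i)) *\<^sub>R V x' (e i) z' v')" for x' z' v'
      by (rule 1[OF L(2)])
    moreover have "V x' y' z v' = (\<Sum>i\<in>UNIV. (eps i * b z (e i)) *\<^sub>R V x' y' (e i) v')" for x' y' v'
      by (rule 1[OF L(3)])
    moreover have "V x' y' z' v = (\<Sum>i\<in>UNIV. (eps i * b v (e i)) *\<^sub>R V x' y' z' (e i))" for x' y' z'
      by (rule 1[OF L(4)])
    ultimately show ?thesis by (simp only: scaleR_sum_right)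
  qed
  have "T (e i) (e j) (e k) (e l) = U (e i) (e j) (e k) (e l)" for i j k l using d[of i j k l] by simp
  then show ?thesis unfolding expand[OF T] expand[OF U] by simp
qed

subsection \<open>The Clifford structure of an orthonormal frame\<close>

text \<open>The action of the split quaternions normalised by sending \<open>e 0\<close> to
  \<open>e n\<close>; the Clifford relations force the remaining values. Index 3 is the default
  branch.\<close>

definition frame_cliff :: "bilin \<Rightarrow> (4 \<Rightarrow> coord) \<Rightarrow> nat \<Rightarrow> coord \<Rightarrow> coord" where
  "frame_cliff b e n x =
    (if n = 1 then b x (e 1) *\<^sub>R e 0 - b x (e 0) *\<^sub>R e 1 + b x (e 3) *\<^sub>R e 2 - b x (e 2) *\<^sub>R e 3
     else if n = 2 then b x (e 2) *\<^sub>R e 0 + b x (e 3) *\<^sub>R e 1 - b x (e 0) *\<^sub>R e 2 - b x (e 1) *\<^sub>R e 3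
     else b x (e 3) *\<^sub>R e 0 - b x (e 2) *\<^sub>R e 1 + b x (e 1) *\<^sub>R e 2 - b x (e 0) *\<^sub>R e 3)"

context
  fixes b :: bilin and e :: "4 \<Rightarrow> coord"
  assumes b: "metric_at b" and e: "orthonormal b e"
begin

lemma bilin_b: "bilinear b" and sym_b: "b x y = b y x"
  using b unfolding metric_at_def by auto

lemma b_frame:
  "b (e 0) (e 0) = - 1" "b (e 1) (e 1) = - 1" "b (e 2) (e 2) = 1" "b (e 3) (e 3) = 1"
  "b (e 0) (e 1) = 0" "b (e 0) (e 2) = 0" "b (e 0) (e 3) = 0" "b (e 1) (e 2) = 0" "b (e 1) (e 3) = 0" "b (e 2) (e 3) = 0"
  "b (e 1) (e 0) = 0" "b (e 2) (e 0) = 0" "b (e 3) (e 0) = 0" "b (e 2) (e 1) = 0" "b (e 3) (e 1) = 0" "b (e 3) (e 2) = 0"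
  using e unfolding orthonormal_def by simp_all

lemmas b_simps = bilinear_ladd[OF bilin_b] bilinear_radd[OF bilin_b] bilinear_lsub[OF bilin_b] bilinear_rsub[OF bilin_b]
  bilinear_lmul[OF bilin_b] bilinear_rmul[OF bilin_b] bilinear_lneg[OF bilin_b] bilinear_rneg[OF bilin_b] b_frame

lemma frame_expand4: "w = - b w (e 0) *\<^sub>R e 0 - b w (e 1) *\<^sub>R e 1 + b w (e 2) *\<^sub>R e 2 + b w (e 3) *\<^sub>R e 3"
  using frame_expand[OF b e, of w] unfolding sum_4' by simp

lemma linear_frame_cliff: "linear (frame_cliff b e n)"
  by (rule linearI) (simp_all add: frame_cliff_def b_simps algebra_simps)

lemma frame_cliff_skew: "b (frame_cliff b e n x) y = - b x (frame_cliff b e n y)"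
  using sym_b[of y "e 0"] sym_b[of y "e 1"] sym_b[of y "e 2"] sym_b[of y "e 3"]
  by (simp add: frame_cliff_def b_simps)

lemma frame_cliff_relations:
  "frame_cliff b e 2 (frame_cliff b e 1 x) = frame_cliff b e 3 x"
  "frame_cliff b e 1 (frame_cliff b e 1 x) = - x"
  "frame_cliff b e 2 (frame_cliff b e 2 x) = x"
  "frame_cliff b e 3 (frame_cliff b e 3 x) = x"
  "frame_cliff b e 1 (frame_cliff b e 2 x) = - frame_cliff b e 3 x"
  "frame_cliff b e 1 (frame_cliff b e 3 x) = frame_cliff b e 2 x"
  "frame_cliff b e 3 (frame_cliff b e 1 x) = - frame_cliff b e 2 x"
  "frame_cliff b e 2 (frame_cliff b e 3 x) = frame_cliff b e 1 x"
  "frame_cliff b e 3 (frame_cliff b e 2 x) = - frame_cliff b e 1 x"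
  by (simp_all add: frame_cliff_def b_simps)
    (use frame_expand4[of x] in \<open>simp_all add: algebra_simps\<close>)

lemma alg_curv_R_skew:
  assumes \<phi>: "linear \<phi>" "\<And>x y. b (\<phi> x) y = - b x (\<phi> y)"
  shows "alg_curv (lower b (R_skew b \<phi>))"
proof -
  have T: "lower b (R_skew b \<phi>) x y z v = b (\<phi> y) z * b (\<phi> x) v - b (\<phi> x) z * b (\<phi> y) v - 2 * b (\<phi> x) y * b (\<phi> z) v"
    for x y z v unfolding lower_def R_skew_def by (simp add: b_simps)
  have s: "b (\<phi> x) y = - b (\<phi> y) x" for x y using \<phi>(2)[of x y] sym_b[of x "\<phi> y"] by simp
  have "linear (\<lambda>x. lower b (R_skew b \<phi>) x y z v)" for y z v
    unfolding T by (rule linearI) (simp_all add: linear_add[OF \<phi>(1)] linear_cmul[OF \<phi>(1)] b_simps algebra_simps)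
  moreover have "lower b (R_skew b \<phi>) x y z v = - lower b (R_skew b \<phi>) y x z v" for x y z v
    unfolding T s[of y x] by (simp add: algebra_simps)
  moreover have "lower b (R_skew b \<phi>) x y z v = - lower b (R_skew b \<phi>) x y v z" for x y z v
    unfolding T s[of v z] by (simp add: algebra_simps)
  moreover have "lower b (R_skew b \<phi>) x y z v + lower b (R_skew b \<phi>) y z x v + lower b (R_skew b \<phi>) z x y v = 0" for x y z v
    unfolding T s[of z x] s[of y x] s[of z y] by (simp add: algebra_simps)
  ultimately show ?thesis unfolding alg_curv_def by blast
qed

text \<open>Since \<open>R_skew\<close> is quadratic in the endomorphism, the bracket with coefficient \<open>m i j\<close> in
  \<open>cliff_curvature\<close> is twice its polarisation.\<close>
lemma lower_cliff_curvature:
  assumes "l 0 = 0"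
  shows "lower b (cliff_curvature b (frame_cliff b e) l m) x y z v =
    (let w = (\<lambda>i. b (frame_cliff b e i x)); w' = (\<lambda>i. b (frame_cliff b e i y)); w'' = (\<lambda>i. b (frame_cliff b e i z));
      P = (\<lambda>i j. (w' i z * w j v + w' j z * w i v) - (w i z * w' j v + w j z * w' i v) - 2 * (w i y * w'' j v + w j y * w'' i v))
     in (l 1 * P 1 1 + l 2 * P 2 2 + l 3 * P 3 3) / 2 + m 1 2 * P 1 2 + m 1 3 * P 1 3 + m 2 3 * P 2 3)"
proof -
  have I: "{(i, j). 1 \<le> i \<and> i < j \<and> j \<le> 3} = {(1, 2), (1, 3), (2, 3 :: nat)}" by auto
  have J: "{1..3} = {1, 2, 3 :: nat}" by auto
  show ?thesis
    unfolding lower_def cliff_curvature_def I J R_skew_def Let_def assms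
    by (simp add: b_simps field_simps)
qed

lemma alg_curv_cliff_curvature:
  assumes "l 0 = 0"
  shows "alg_curv (lower b (cliff_curvature b (frame_cliff b e) l m))"
proof -
  let ?F = "frame_cliff b e"
  have I: "{(i, j). 1 \<le> i \<and> i < j \<and> j \<le> 3} = {(1, 2), (1, 3), (2, 3 :: nat)}" by auto
  have J: "{1..3} = {1, 2, 3 :: nat}" by auto
  let ?L = "\<lambda>i. lower b (R_skew b (?F i))" and ?M = "\<lambda>i j. lower b (R_skew b (\<lambda>u. ?F i u - ?F j u))"
  have L: "alg_curv (?L i)" for i by (rule alg_curv_R_skew[OF linear_frame_cliff frame_cliff_skew])
  have M: "alg_curv (?M i j)" for i j
    by (rule alg_curv_R_skew)
      (simp_all add: linear_compose_sub linear_frame_cliff bilinear_lsub[OF bilin_b] bilinear_rsub[OF bilin_b] frame_cliff_skew)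
  have 0: "alg_curv (\<lambda>x y z v. 0)" unfolding alg_curv_def by (simp add: linear_zero)
  \<comment> \<open>The combination is built from the zero tensor by repeated use of
    \<open>alg_curv_lincomb\<close>, which subtracts; hence the negated coefficients and the padding
    by \<open>0 * ?L 3\<close>. Each \<open>m i j\<close> contributes to \<open>?L i\<close>,
    \<open>?L j\<close> and \<open>?M i j\<close>.\<close>
  have "alg_curv (\<lambda>x y z v. ((((0 - (- l 1) * ?L 1 x y z v - (- l 2) * ?L 2 x y z v) - (- l 3) * ?L 3 x y z v
      - m 1 2 * ?M 1 2 x y z v) - m 1 3 * ?M 1 3 x y z v - m 2 3 * ?M 2 3 x y z v)
      - (- m 1 2 - m 1 3) * ?L 1 x y z v - (- m 1 2 - m 2 3) * ?L 2 x y z v) - (- m 1 3 - m 2 3) * ?L 3 x y z v - 0 * ?L 3 x y z v)"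
    by (intro alg_curv_lincomb 0 L M)
  then show ?thesis
    by (rule back_subst[of alg_curv], intro ext, unfold lower_def cliff_curvature_def I J)
      (simp add: assms b_simps algebra_simps)
qed

end

subsection \<open>Vanishing traces on null vectors\<close>

context
  fixes T :: curv4
  assumes T: "alg_curv T"
begin

lemma T_add:
  "T (x + x') y z v = T x y z v + T x' y z v" "T x (y + y') z v = T x y z v + T x y' z v"
  "T x y (z + z') v = T x y z v + T x y z' v" "T x y z (v + v') = T x y z v + T x y z v'"
  using linear_add[OF alg_curv_linear(1)[OF T, of y z v]] linear_add[OF alg_curv_linear(2)[OF T, of x z v]]
    linear_add[OF alg_curv_linear(3)[OF T, of x y v]] linear_add[OF alg_curv_linear(4)[OF T, of x y z]] by auto

lemma T_scale:
  "T (r *\<^sub>R x) y z v = r * T x y z v" "T x (r *\<^sub>R y) z v = r * T x y z v"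
  "T x y (r *\<^sub>R z) v = r * T x y z v" "T x y z (r *\<^sub>R v) = r * T x y z v"
  using linear_cmul[OF alg_curv_linear(1)[OF T, of y z v]] linear_cmul[OF alg_curv_linear(2)[OF T, of x z v]]
    linear_cmul[OF alg_curv_linear(3)[OF T, of x y v]] linear_cmul[OF alg_curv_linear(4)[OF T, of x y z]] by auto

lemma T_diff:
  "T (x - x') y z v = T x y z v - T x' y z v" "T x (y - y') z v = T x y z v - T x y' z v"
  "T x y (z - z') v = T x y z v - T x y z' v" "T x y z (v - v') = T x y z v - T x y z v'"
  using linear_diff[OF alg_curv_linear(1)[OF T, of y z v]] linear_diff[OF alg_curv_linear(2)[OF T, of x z v]]
    linear_diff[OF alg_curv_linear(3)[OF T, of x y v]] linear_diff[OF alg_curv_linear(4)[OF T, of x y z]] by auto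

lemma T_minus:
  "T (- x) y z v = - T x y z v" "T x (- y) z v = - T x y z v"
  "T x y (- z) v = - T x y z v" "T x y z (- v) = - T x y z v"
  using T_scale[where r = "- 1"] by simp_all

lemma T_alt: "T x x z v = 0" "T x y z z = 0"
  using alg_curvD(2)[OF T, of x x z v] alg_curvD(3)[OF T, of x y z z] by simp_all

lemmas T_multilinear = T_add T_scale T_diff T_minus T_alt

lemma T_jacobi_sym: "T x v v y = T y v v x"
  using alg_curv_pair[OF T, of x v v y] alg_curvD(2)[OF T, of v y x v] alg_curvD(3)[OF T, of y v x v] by simp

text \<open>In the null basis \<open>v, e 1 + e 3, e 1 - e 3, e 2 - e 0\<close> the Jacobi operator of the null vector
  \<open>v = e 0 + e 2\<close> is block triangular.  Only the middle block contributes to the traces; it has trace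
  zero, and its off-diagonal entries are the two factors below.\<close>
lemma null_product:
  assumes t1: "(\<Sum>i\<in>UNIV. eps i * T (e i) v v (e i)) = 0"
    and t2: "(\<Sum>i\<in>UNIV. \<Sum>j\<in>UNIV. eps i * eps j * (T (e i) v v (e j))\<^sup>2) = 0"
    and v: "v = e 0 + e 2"
  shows "T (e 1 + e 3) v v (e 1 + e 3) * T (e 1 - e 3) v v (e 1 - e 3) = 0"
proof -
  let ?m = "\<lambda>i j. T (e i) v v (e j)"
  have s: "?m 1 0 = ?m 0 1" "?m 2 0 = ?m 0 2" "?m 3 0 = ?m 0 3" "?m 2 1 = ?m 1 2" "?m 3 1 = ?m 1 3" "?m 3 2 = ?m 2 3"
    by (rule T_jacobi_sym)+
  \<comment> \<open>Since \<open>J(v) v = 0\<close>, the rows of \<open>e 0\<close> and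
    \<open>e 2\<close> are opposite.\<close>
  have z: "?m 2 j = - ?m 0 j" for j
    using T_alt(1)[of v v "e j"] T_add(1)[of "e 0" "e 2" v v "e j"] unfolding v[symmetric] by simp
  have z': "?m 0 2 = - ?m 0 0" "?m 1 2 = - ?m 0 1" "?m 2 3 = - ?m 0 3" "?m 2 2 = ?m 0 0"
    using z[of 0] z[of 1] z[of 3] z[of 2] s by auto
  have 1: "?m 3 3 = ?m 1 1"
    using t1 unfolding sum_4' by (simp add: z')
  have 2: "(?m 1 1)\<^sup>2 - (?m 1 3)\<^sup>2 = 0"
    using t2 unfolding sum_4' by (simp add: s z' 1)
  have "T (e 1 + e 3) v v (e 1 + e 3) * T (e 1 - e 3) v v (e 1 - e 3) = 4 * ((?m 1 1)\<^sup>2 - (?m 1 3)\<^sup>2)"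
    by (simp add: T_add T_diff s 1 power2_eq_square algebra_simps)
  then show ?thesis using 2 by simp
qed

end

text \<open>The divisor comes from \<open>R_\<Phi>(y,x)x = 3 g(y, \<Phi> x) \<Phi> x\<close>, where
  \<open>\<Phi> x\<close> is a frame vector up to sign. The default 0 includes the coefficient of
  \<open>R_0\<close>.\<close>

definition diag_coeff :: "(4 \<Rightarrow> 4 \<Rightarrow> real) \<Rightarrow> nat \<Rightarrow> real" where
  "diag_coeff E n = (if n = 1 then E 1 1 / 3 else if n = 2 then E 2 2 / 3 else if n = 3 then E 3 3 / 3 else 0)"

text \<open>The bracket of i and j contributes \<open>3 (g(y, \<Phi>_i x) \<Phi>_j x + g(y, \<Phi>_j
  x) \<Phi>_i x)\<close> to the Jacobi operator. Its frame entry carries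
  \<open>eps i * eps j\<close>, hence the minus sign for pairs with the timelike \<open>e 1\<close>;
  a common sign of all \<open>\<Phi>_i x\<close> cancels. The last branch stands for (2, 3).\<close>

definition off_coeff :: "(4 \<Rightarrow> 4 \<Rightarrow> real) \<Rightarrow> nat \<Rightarrow> nat \<Rightarrow> real" where
  "off_coeff E i j = (if i = 1 \<and> j = 2 then - E 1 2 / 3 else if i = 1 \<and> j = 3 then - E 1 3 / 3 else E 2 3 / 3)"

context
  fixes b :: bilin and T :: curv4 and e :: "4 \<Rightarrow> coord"
  assumes b: "metric_at b" and e: "orthonormal b e" and T: "alg_curv T"
    and trace1: "\<And>v e. b v v = 0 \<Longrightarrow> orthonormal b e \<Longrightarrow> (\<Sum>i\<in>UNIV. eps i * T (e i) v v (e i)) = 0"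
    and trace2: "\<And>v e. b v v = 0 \<Longrightarrow> orthonormal b e \<Longrightarrow>
      (\<Sum>i\<in>UNIV. \<Sum>j\<in>UNIV. eps i * eps j * (T (e i) v v (e j))\<^sup>2) = 0"
begin

text \<open>The null vectors \<open>e 0 + e 2 + \<alpha> (e 1 + e 3) + \<beta> / 2 (e 1 - e 3) + \<alpha> \<beta> / 2 (e 2 - e 0)\<close> are the
  decomposable ones in the identification of the four-space with a tensor product of planes.  The two
  factors are the two halves of the Weyl tensor, as binary quartic forms in \<open>\<beta>\<close> and in \<open>\<alpha>\<close>.\<close>
lemma half_products:
  fixes \<alpha> \<beta> :: real
  defines "x \<equiv> e 0 + e 2 + (\<beta> / 2) *\<^sub>R (e 1 - e 3)" and "y \<equiv> e 1 + e 3 + (\<beta> / 2) *\<^sub>R (e 2 - e 0)"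
    and "x' \<equiv> e 0 + e 2 + \<alpha> *\<^sub>R (e 1 + e 3)" and "y' \<equiv> e 1 - e 3 + \<alpha> *\<^sub>R (e 2 - e 0)"
  shows "T y x x y * T y' x' x' y' = 0"
proof -
  let ?u3 = "(1 / 2) *\<^sub>R (e 2 - e 0)"
  define u where "u = x + \<alpha> *\<^sub>R y"
  have u': "u = x' + (\<beta> / 2) *\<^sub>R y'"
    unfolding u_def x_def y_def x'_def y'_def by (simp add: algebra_simps)
  \<comment> \<open>Found by solving \<open>u = f 0 + f 2\<close>, \<open>y = f 1 + f 3\<close>,
    \<open>y' = f 1 - f 3\<close>, the position required by \<open>null_product\<close>. It is
    orthonormal because u and ?u3 are null with product 1, and y and y' are null with product -
    2.\<close>
  define f where "f = frame4 ((1 / 2) *\<^sub>R u - ?u3) ((1 / 2) *\<^sub>R (y + y')) ((1 / 2) *\<^sub>R u + ?u3) ((1 / 2) *\<^sub>R (y - y'))"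
  note bs = b_simps[OF b e]
  have f: "orthonormal b f"
    unfolding orthonormal_iff[OF sym_b[OF b e]] f_def frame4_simps u_def x_def y_def y'_def
    by (simp only: bs) (simp add: field_simps)
  have u: "b u u = 0" unfolding u_def x_def y_def by (simp only: bs) (simp add: field_simps)
  have "f 1 + f 3 = y" "f 1 - f 3 = y'"
    unfolding f_def frame4_simps by (simp_all add: algebra_simps scaleR_add_left[symmetric])
  moreover have "u = f 0 + f 2"
    unfolding f_def frame4_simps by (simp add: scaleR_add_left[symmetric])
  ultimately have "T y u u y * T y' u u y' = 0"
    using null_product[OF T trace1[OF u f] trace2[OF u f]] by simp
  \<comment> \<open>u differs from x by a multiple of y, and from x' by a multiple of y', which the
    alternating slots ignore. So one factor depends on \<beta> alone, the other on \<alpha>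
    alone.\<close>
  moreover have "T y u u y = T y x x y"
    unfolding u_def by (simp add: T_multilinear[OF T])
  moreover have "T y' u u y' = T y' x' x' y'"
    unfolding u' by (simp add: T_multilinear[OF T])
  ultimately show ?thesis by simp
qed

lemma ricci_null: "b v v = 0 \<Longrightarrow> - T (e 0) v v (e 0) - T (e 1) v v (e 1) + T (e 2) v v (e 2) + T (e 3) v v (e 3) = 0"
  using trace1[OF _ e, of v] unfolding sum_4' by simp

text \<open>On the null vectors with coefficients \<open>3, 4, 5\<close> the vanishing of the Ricci tensor gives its components
  \<open>(0, 1)\<close> and \<open>(2, 3)\<close>; the null vectors \<open>e i \<plusminus> e j\<close> give the rest of the Einstein condition.\<close>
lemma curvature_if_half_zero:
  assumes h: "half = 1 \<or> half = - 1"
    and Q: "\<And>\<alpha>. T (e 1 - half *\<^sub>R e 3 + \<alpha> *\<^sub>R (e 2 - e 0)) (e 0 + e 2 + \<alpha> *\<^sub>R (e 1 + half *\<^sub>R e 3))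
      (e 0 + e 2 + \<alpha> *\<^sub>R (e 1 + half *\<^sub>R e 3)) (e 1 - half *\<^sub>R e 3 + \<alpha> *\<^sub>R (e 2 - e 0)) = 0"
    and f: "f = frame4 (e 0) (half *\<^sub>R e 1) (half *\<^sub>R e 2) (half *\<^sub>R e 3)"
  shows "T x y z v = lower b (cliff_curvature b (frame_cliff b f) (diag_coeff (\<lambda>i j. T (e i) (e 0) (e 0) (e j)))
      (off_coeff (\<lambda>i j. T (e i) (e 0) (e 0) (e j)))) x y z v"
proof -
  let ?E = "\<lambda>i j. T (e i) (e 0) (e 0) (e j)"
  note bs = b_simps[OF b e]
  have hh: "half * half = 1" using h by auto
  have of: "orthonormal b f"
    unfolding f orthonormal_iff[OF sym_b[OF b e]] by (simp add: bs hh)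
  have d0: "diag_coeff ?E 0 = 0" by (simp add: diag_coeff_def)
  note a = alg_curvD(2)[OF T] and a' = alg_curvD(3)[OF T]
  note c = a[of "e 1" "e 0"] a[of "e 2" "e 0"] a[of "e 3" "e 0"] a[of "e 2" "e 1"] a[of "e 3" "e 1"] a[of "e 3" "e 2"]
    a'[of _ _ "e 1" "e 0"] a'[of _ _ "e 2" "e 0"] a'[of _ _ "e 3" "e 0"] a'[of _ _ "e 2" "e 1"] a'[of _ _ "e 3" "e 1"] a'[of _ _ "e 3" "e 2"]
    alg_curv_pair[OF T, of "e 0" "e 2" "e 0" "e 1"] alg_curv_pair[OF T, of "e 0" "e 3" "e 0" "e 1"]
    alg_curv_pair[OF T, of "e 1" "e 2" "e 0" "e 1"] alg_curv_pair[OF T, of "e 1" "e 3" "e 0" "e 1"]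
    alg_curv_pair[OF T, of "e 2" "e 3" "e 0" "e 1"] alg_curv_pair[OF T, of "e 0" "e 3" "e 0" "e 2"]
    alg_curv_pair[OF T, of "e 1" "e 2" "e 0" "e 2"] alg_curv_pair[OF T, of "e 1" "e 3" "e 0" "e 2"]
    alg_curv_pair[OF T, of "e 2" "e 3" "e 0" "e 2"] alg_curv_pair[OF T, of "e 1" "e 2" "e 0" "e 3"]
    alg_curv_pair[OF T, of "e 1" "e 3" "e 0" "e 3"] alg_curv_pair[OF T, of "e 2" "e 3" "e 0" "e 3"]
    alg_curv_pair[OF T, of "e 1" "e 3" "e 1" "e 2"] alg_curv_pair[OF T, of "e 2" "e 3" "e 1" "e 2"]
    alg_curv_pair[OF T, of "e 2" "e 3" "e 1" "e 3"]
  note m = T_multilinear[OF T]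
  have B: "T (e 0) (e 1) (e 2) (e 3) - T (e 0) (e 2) (e 1) (e 3) + T (e 0) (e 3) (e 1) (e 2) = 0"
    using alg_curvD(4)[OF T, of "e 0" "e 1" "e 2" "e 3"] by (simp add: c)
  have R: "b v v = 0 \<Longrightarrow> - T (e 0) v v (e 0) - T (e 1) v v (e 1) + T (e 2) v v (e 2) + T (e 3) v v (e 3) = 0" for v
    by (rule ricci_null)
  note R1 = R[of "e 0 + e 2", simplified bs m c, simplified] R[of "e 0 - e 2", simplified bs m c, simplified]
    R[of "e 0 + e 3", simplified bs m c, simplified] R[of "e 0 - e 3", simplified bs m c, simplified]
    R[of "e 1 + e 2", simplified bs m c, simplified] R[of "e 1 - e 2", simplified bs m c, simplified]
    R[of "e 1 + e 3", simplified bs m c, simplified] R[of "e 1 - e 3", simplified bs m c, simplified]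
    R[of "3 *\<^sub>R e 0 + 4 *\<^sub>R e 1 + 5 *\<^sub>R e 2", simplified bs m c, simplified]
    R[of "5 *\<^sub>R e 0 + 3 *\<^sub>R e 2 + 4 *\<^sub>R e 3", simplified bs m c, simplified]
  let ?t = "\<lambda>i j k l. T (e i) (e j) (e k) (e l)"
  \<comment> \<open>One third of the trace of \<open>J(e 0)\<close>: the part of constant curvature.
    What is left after subtracting it is the Weyl part, on which the vanishing of a half acts as a
    duality relation.\<close>
  define \<mu> where "\<mu> = (?t 0 1 0 1 - ?t 0 2 0 2 - ?t 0 3 0 3) / 3"
  have E1: "?t 2 3 2 3 = ?t 0 1 0 1" "?t 1 3 1 3 = ?t 0 2 0 2" "?t 1 2 1 2 = ?t 0 3 0 3"
    "?t 0 3 2 3 = - ?t 0 1 1 2" "?t 0 2 2 3 = ?t 0 1 1 3" "?t 1 3 2 3 = ?t 0 1 0 2" "?t 1 2 2 3 = - ?t 0 1 0 3"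
    using R1(1-8) by linarith+
  have E2: "?t 0 3 1 3 = - ?t 0 2 1 2" "?t 1 2 1 3 = - ?t 0 2 0 3"
    using R1(9,10) E1 by linarith+
  \<comment> \<open>\<open>Q\<close> is a quartic in \<alpha>, so its values at 0, 1, -1, 2, -2
    carry all five coefficients. Together with the Bianchi identity they determine the six
    components that the Einstein condition has not yet reduced to entries of
    \<open>J(e 0)\<close>.\<close>
  have "?t 0 1 1 2 = - half * ?t 0 1 0 3 \<and>
      ?t 0 1 1 3 = half * ?t 0 1 0 2 \<and>
      ?t 0 2 1 2 = - half * ?t 0 2 0 3 \<and>
      ?t 0 1 2 3 = half * (?t 0 1 0 1 - \<mu>) \<and>
      ?t 0 2 1 3 = half * (?t 0 2 0 2 + \<mu>) \<and>
      ?t 0 3 1 2 = - half * (?t 0 3 0 3 + \<mu>)"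
    using h
  proof
    assume h1: "half = 1"
    note Q' = Q[unfolded h1, simplified m c]
    note Q1 = Q'[of 0, simplified, unfolded E1 E2] Q'[of 1, simplified, unfolded E1 E2] Q'[of "- 1", simplified, unfolded E1 E2]
      Q'[of 2, simplified, unfolded E1 E2] Q'[of "- 2", simplified, unfolded E1 E2]
    show ?thesis
      unfolding h1 \<mu>_def using Q1 B by (intro conjI; argo)
  next
    assume h1: "half = - 1"
    note Q' = Q[unfolded h1, simplified m c]
    note Q1 = Q'[of 0, simplified, unfolded E1 E2] Q'[of 1, simplified, unfolded E1 E2] Q'[of "- 1", simplified, unfolded E1 E2]
      Q'[of 2, simplified, unfolded E1 E2] Q'[of "- 2", simplified, unfolded E1 E2]
    show ?thesis
      unfolding h1 \<mu>_def using Q1 B by (intro conjI; argo)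
  qed
  note E3 = this[THEN conjunct1] this[THEN conjunct2, THEN conjunct1] this[THEN conjunct2, THEN conjunct2, THEN conjunct1]
    this[THEN conjunct2, THEN conjunct2, THEN conjunct2, THEN conjunct1]
    this[THEN conjunct2, THEN conjunct2, THEN conjunct2, THEN conjunct2, THEN conjunct1]
    this[THEN conjunct2, THEN conjunct2, THEN conjunct2, THEN conjunct2, THEN conjunct2]
  have hh': "half * (half * r) = r" for r using hh by (metis mult.assoc mult_1)
  show ?thesis
  proof (rule alg_curv_eqI[OF b e T alg_curv_cliff_curvature[OF b of, of "diag_coeff ?E", OF d0]])
    fix i j k l :: 4
    assume ijkl: "(i, j, k, l) \<in> basic_indices"
    then show "?t i j k l = lower b (cliff_curvature b (frame_cliff b f) (diag_coeff ?E) (off_coeff ?E)) (e i) (e j) (e k) (e l)"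
      unfolding basic_indices_def insert_iff empty_iff prod.inject
        lower_cliff_curvature[OF b of, of "diag_coeff ?E", OF d0]
      by (elim disjE conjE FalseE; hypsubst)
        (simp_all add: frame_cliff_def f bs diag_coeff_def off_coeff_def Let_def c E1 E2 E3 \<mu>_def hh hh' field_simps)
  qed
qed

lemma curvature_classification:
  obtains half :: real where "half = 1 \<or> half = - 1"
    "T = lower b (cliff_curvature b (frame_cliff b (frame4 (e 0) (half *\<^sub>R e 1) (half *\<^sub>R e 2) (half *\<^sub>R e 3)))
      (diag_coeff (\<lambda>i j. T (e i) (e 0) (e 0) (e j))) (off_coeff (\<lambda>i j. T (e i) (e 0) (e 0) (e j))))"
proof -
  let ?x = "\<lambda>half \<alpha>. e 0 + e 2 + \<alpha> *\<^sub>R (e 1 + half *\<^sub>R e 3)" and ?y = "\<lambda>half \<alpha>. e 1 - half *\<^sub>R e 3 + \<alpha> *\<^sub>R (e 2 - e 0)"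
  let ?Q = "\<lambda>half \<alpha>. T (?y half \<alpha>) (?x half \<alpha>) (?x half \<alpha>) (?y half \<alpha>)"
  \<comment> \<open>The argument \<open>2 * \<beta>\<close> absorbs the factor 1/2 in
    \<open>half_products\<close>. As the two parameters are independent, one of the factors vanishes
    identically.\<close>
  have "?Q (- 1) \<beta> * ?Q 1 \<alpha> = 0" for \<alpha> \<beta>
    using half_products[of "2 * \<beta>" \<alpha>] by simp
  then have "(\<forall>\<alpha>. ?Q 1 \<alpha> = 0) \<or> (\<forall>\<alpha>. ?Q (- 1) \<alpha> = 0)"
    by (metis mult_eq_0_iff)
  then obtain half where half: "half = 1 \<or> half = - 1" "\<And>\<alpha>. ?Q half \<alpha> = 0" by metis
  show thesis
    by (rule that[OF half(1)]) (intro ext, rule curvature_if_half_zero[OF half refl])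
qed

end

section \<open>Similar endomorphisms\<close>

definition similar_endo :: "(coord \<Rightarrow> coord) \<Rightarrow> (coord \<Rightarrow> coord) \<Rightarrow> bool" where
  "similar_endo f g \<longleftrightarrow> (\<exists>M N. linear M \<and> linear N \<and> (\<forall>x. N (M x) = x) \<and> (\<forall>x. M (N x) = x) \<and>
     (\<forall>x. f (M x) = M (g x)))"

definition endo_trace :: "(coord \<Rightarrow> coord) \<Rightarrow> real" where
  "endo_trace f = (\<Sum>i\<in>UNIV. vec_nth (f (axis i 1)) i)"

text \<open>\<beta> is the dual basis of B. The lemma serves both conjugated bases and orthonormal
  frames, whose dual basis is \<open>eps i * b w (e i)\<close>.\<close>

lemma endo_trace_basis:
  fixes \<beta> :: "'i::finite \<Rightarrow> coord \<Rightarrow> real"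
  assumes f: "linear f" and B: "\<And>w. w = (\<Sum>j\<in>UNIV. \<beta> j w *\<^sub>R B j)" and \<beta>: "\<And>j. linear (\<beta> j)"
  shows "endo_trace f = (\<Sum>j\<in>UNIV. \<beta> j (f (B j)))"
proof -
  have "endo_trace f = (\<Sum>i\<in>UNIV. \<Sum>j\<in>UNIV. \<beta> j (axis i 1) * vec_nth (f (B j)) i)"
  proof -
    have "f (axis i 1) = (\<Sum>j\<in>UNIV. \<beta> j (axis i 1) *\<^sub>R f (B j))" for i
      using linear_sum[OF f, of "\<lambda>j. \<beta> j (axis i 1) *\<^sub>R B j" UNIV] linear_cmul[OF f] B[of "axis i 1"] by simp
    then show ?thesis unfolding endo_trace_def by simp
  qed
  also have "\<dots> = (\<Sum>j\<in>UNIV. \<Sum>i\<in>UNIV. \<beta> j (axis i 1) * vec_nth (f (B j)) i)"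
    by (rule sum.swap)
  also have "\<dots> = (\<Sum>j\<in>UNIV. \<beta> j (f (B j)))"
  proof (rule sum.cong[OF refl])
    fix j
    show "(\<Sum>i\<in>UNIV. \<beta> j (axis i 1) * vec_nth (f (B j)) i) = \<beta> j (f (B j))"
      using coord_expand[OF \<beta>, of j "f (B j)"] by (simp add: mult.commute)
  qed
  finally show ?thesis .
qed

lemma endo_trace_similar:
  assumes "similar_endo f g" and f: "linear f"
  shows "endo_trace f = endo_trace g"
proof -
  obtain M N where M: "linear M" "linear N" "\<And>x. N (M x) = x" "\<And>x. M (N x) = x" "\<And>x. f (M x) = M (g x)"
    using assms unfolding similar_endo_def by blast
  have "endo_trace f = (\<Sum>j\<in>UNIV. vec_nth (N (f (M (axis j 1)))) j)"
  proof (rule endo_trace_basis[OF f])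
    show "w = (\<Sum>j\<in>UNIV. vec_nth (N w) j *\<^sub>R M (axis j 1))" for w
      using coord_expand[OF M(1), of "N w"] by (simp add: M(4))
    show "linear (\<lambda>w. vec_nth (N w) j)" for j
      by (rule linearI) (simp_all add: linear_add[OF M(2)] linear_cmul[OF M(2)])
  qed
  then show ?thesis unfolding endo_trace_def by (simp add: M(3,5))
qed

lemma similar_endo_square:
  "similar_endo f g \<Longrightarrow> similar_endo (\<lambda>x. f (f x)) (\<lambda>x. g (g x))"
  unfolding similar_endo_def by metis

section \<open>Matrices of endomorphisms and similarity over the reals\<close>

definition index4 :: "4 \<Rightarrow> nat" where
  "index4 i = (if i = 0 then 0 else if i = 1 then 1 else if i = 2 then 2 else 3)"

lemma index4_less: "index4 i < 4"
  by (simp add: index4_def)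

lemma of_nat_index4: "of_nat (index4 i) = i"
proof -
  have "\<forall>i. of_nat (index4 i) = (i::4)" unfolding all_4' by (simp add: index4_def)
  then show ?thesis by blast
qed

lemma sum_index4: "(\<Sum>i\<in>UNIV. h (index4 i)) = (\<Sum>i\<in>{0..<4}. h i)"
  by (simp add: sum_4' index4_def eval_nat_numeral)

definition mat_fun :: "real mat \<Rightarrow> coord \<Rightarrow> coord" where
  "mat_fun M x = vec_lambda (\<lambda>i. \<Sum>j\<in>UNIV. M $$ (index4 i, index4 j) * vec_nth x j)"

definition fun_mat :: "(coord \<Rightarrow> coord) \<Rightarrow> real mat" where
  "fun_mat f = Matrix.mat 4 4 (\<lambda>(i, j). vec_nth (f (axis (of_nat j) 1)) (of_nat i))"

lemma linear_mat_fun: "linear (mat_fun M)"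
  by (rule linearI)
    (simp_all add: mat_fun_def cart_eq_iff sum.distrib sum_distrib_left algebra_simps)

lemma mat_fun_mult:
  assumes "M \<in> carrier_mat 4 4" "N \<in> carrier_mat 4 4"
  shows "mat_fun (M * N) x = mat_fun M (mat_fun N x)"
proof -
  have "(M * N) $$ (index4 i, index4 j) = (\<Sum>k\<in>UNIV. M $$ (index4 i, index4 k) * N $$ (index4 k, index4 j))" for i j
    using assms index4_less sum_index4[of "\<lambda>k. M $$ (index4 i, k) * N $$ (k, index4 j)"]
    by (simp add: scalar_prod_def)
  then have "(\<Sum>j\<in>UNIV. (M * N) $$ (index4 i, index4 j) * vec_nth x j)
      = (\<Sum>j\<in>UNIV. \<Sum>k\<in>UNIV. M $$ (index4 i, index4 k) * N $$ (index4 k, index4 j) * vec_nth x j)" for i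
    by (simp add: sum_distrib_right)
  also have "\<dots> i = (\<Sum>k\<in>UNIV. \<Sum>j\<in>UNIV. M $$ (index4 i, index4 k) * N $$ (index4 k, index4 j) * vec_nth x j)" for i
    by (rule sum.swap)
  finally show ?thesis
    by (simp add: mat_fun_def cart_eq_iff sum_distrib_left mult.assoc)
qed

lemma mat_fun_one: "mat_fun (1\<^sub>m 4) x = x"
proof -
  have "index4 i = index4 j \<longleftrightarrow> i = j" for i j using of_nat_index4 by metis
  then show ?thesis
    using index4_less by (simp add: mat_fun_def cart_eq_iff if_distrib[of "\<lambda>c. c * _"] cong: if_cong)
qed

lemma mat_fun_fun_mat:
  assumes "linear f"
  shows "mat_fun (fun_mat f) x = f x"
proof -
  have "vec_nth (f x) i = (\<Sum>j\<in>UNIV. vec_nth x j * vec_nth (f (axis j 1)) i)" for i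
  proof -
    have "linear (\<lambda>x. vec_nth (f x) i)"
      by (rule linearI) (simp_all add: linear_add[OF assms] linear_cmul[OF assms])
    from coord_expand[OF this, of x] show ?thesis by simp
  qed
  then show ?thesis
    by (simp add: mat_fun_def fun_mat_def cart_eq_iff index4_less of_nat_index4 mult.commute)
qed

text \<open>For real A and B, the real and imaginary parts of a complex intertwiner P both
  intertwine, and so does \<open>Re P + t Im P\<close> for real t. The determinant of this pencil is
  a polynomial in t; it is nonzero at the imaginary unit and therefore at some real t.\<close>

lemma real_similar_if_complex_similar:
  fixes A B :: "real mat"
  assumes A: "A \<in> carrier_mat n n" and B: "B \<in> carrier_mat n n"
    and sim: "similar_mat (map_mat complex_of_real A) (map_mat complex_of_real B)"
  shows "similar_mat A B"
proof -
  obtain P Q where PQ: "P \<in> carrier_mat n n" "Q \<in> carrier_mat n n" "P * Q = 1\<^sub>m n" "Q * P = 1\<^sub>m n"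
    "map_mat complex_of_real A = P * map_mat complex_of_real B * Q"
  proof -
    from similar_matD[OF sim] obtain m P Q where m: "{map_mat complex_of_real A, map_mat complex_of_real B, P, Q} \<subseteq> carrier_mat m m"
      and PQ: "P * Q = 1\<^sub>m m" "Q * P = 1\<^sub>m m" "map_mat complex_of_real A = P * map_mat complex_of_real B * Q"
      by blast
    have "m = n" using m A by auto
    then show thesis using that[of P Q] m PQ by auto
  qed
  let ?A = "map_mat complex_of_real A" and ?B = "map_mat complex_of_real B"
  have cB: "?B \<in> carrier_mat n n" using B by auto
  have AP: "?A * P = P * ?B"
  proof -
    have "?A * P = P * ?B * (Q * P)"
      unfolding PQ(5) using PQ(1,2) cB by (simp add: assoc_mult_mat[of _ n n _ n _ n])
    also have "\<dots> = P * ?B" unfolding PQ(4) using PQ(1) cB by (simp add: right_mult_one_mat[of _ n n])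
    finally show ?thesis .
  qed
  define C where "C = (\<lambda>t::real. Matrix.mat n n (\<lambda>(i, j). Re (P $$ (i, j)) + t * Im (P $$ (i, j))))"
  have C: "C t \<in> carrier_mat n n" for t unfolding C_def by simp
  have AC: "A * C t = C t * B" for t
  proof (rule eq_matI)
    fix i j assume ij: "i < dim_row (C t * B)" "j < dim_col (C t * B)"
    then have ij: "i < n" "j < n" using C[of t] B by auto
    have "(?A * P) $$ (i, j) = (P * ?B) $$ (i, j)" using AP by simp
    then have "(\<Sum>k = 0..<n. complex_of_real (A $$ (i, k)) * P $$ (k, j)) = (\<Sum>k = 0..<n. P $$ (i, k) * complex_of_real (B $$ (k, j)))"
      using ij A B PQ(1) by (simp add: scalar_prod_def)
    from arg_cong[OF this, of Re] arg_cong[OF this, of Im]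
    have "(\<Sum>k = 0..<n. A $$ (i, k) * Re (P $$ (k, j))) = (\<Sum>k = 0..<n. Re (P $$ (i, k)) * B $$ (k, j))"
      "(\<Sum>k = 0..<n. A $$ (i, k) * Im (P $$ (k, j))) = (\<Sum>k = 0..<n. Im (P $$ (i, k)) * B $$ (k, j))"
      by simp_all
    then have "(\<Sum>k = 0..<n. A $$ (i, k) * (Re (P $$ (k, j)) + t * Im (P $$ (k, j))))
      = (\<Sum>k = 0..<n. (Re (P $$ (i, k)) + t * Im (P $$ (i, k))) * B $$ (k, j))"
      by (simp add: distrib_left distrib_right sum.distrib mult.left_commute[of _ t] mult.assoc sum_distrib_left[symmetric])
    then show "(A * C t) $$ (i, j) = (C t * B) $$ (i, j)"
      using ij A B by (simp add: scalar_prod_def C_def)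
  qed (use A B C[of t] in auto)
  have "\<exists>t. Determinant.det (C t) \<noteq> 0"
  proof -
    let ?X = "Matrix.mat n n (\<lambda>(i, j). [:complex_of_real (Re (P $$ (i, j))), complex_of_real (Im (P $$ (i, j))):])"
    have hom: "comm_ring_hom (\<lambda>p. poly p z)" for z :: complex by unfold_locales auto
    have X: "poly (Determinant.det ?X) z = Determinant.det (map_mat (\<lambda>p. poly p z) ?X)" for z
      using comm_ring_hom.hom_det[OF hom, of z ?X] by simp
    have "map_mat (\<lambda>p. poly p \<i>) ?X = P"
      using PQ(1) by (intro eq_matI) (auto simp: complex_eq[symmetric] mult.commute)
    moreover have "Determinant.det P \<noteq> 0"
      using det_mult[OF PQ(1,2)] PQ(3) by auto
    ultimately have "Determinant.det ?X \<noteq> 0" using X[of \<i>] by auto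
    then have "finite {z. poly (Determinant.det ?X) z = 0}" by (rule poly_roots_finite)
    moreover have "infinite (range complex_of_real)"
      by (simp add: finite_image_iff inj_on_def infinite_UNIV_char_0)
    ultimately have "\<not> range complex_of_real \<subseteq> {z. poly (Determinant.det ?X) z = 0}"
      using finite_subset by blast
    then obtain t where t: "poly (Determinant.det ?X) (complex_of_real t) \<noteq> 0"
      by blast
    have "map_mat (\<lambda>p. poly p (complex_of_real t)) ?X = map_mat complex_of_real (C t)"
      unfolding C_def by (intro eq_matI) auto
    then have "complex_of_real (Determinant.det (C t)) \<noteq> 0"
      using t X by (simp add: of_real_hom.hom_det)
    then show ?thesis by auto
  qed
  then obtain t where t: "Determinant.det (C t) \<noteq> 0" by blast
  define N where "N = (1 / Determinant.det (C t)) \<cdot>\<^sub>m adj_mat (C t)"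
  have N: "N \<in> carrier_mat n n" "C t * N = 1\<^sub>m n" "N * C t = 1\<^sub>m n"
    unfolding N_def using adj_mat[OF C[of t]] t
    by (auto simp: mult_smult_distrib[OF C] mult_smult_assoc_mat[OF _ C] intro!: eq_matI)
  have "A = C t * B * N"
  proof -
    have "C t * B * N = A * (C t * N)"
      unfolding AC[symmetric] using A C[of t] N(1) by (simp add: assoc_mult_mat[of _ n n _ n _ n])
    then show ?thesis using N(2) A by (simp add: right_mult_one_mat[of _ n n])
  qed
  then show ?thesis using similar_matI[of A B "C t" N n] A B C[of t] N by blast
qed

lemma similar_endo_if_jordan:
  assumes f: "linear f" and g: "linear g"
    and "jordan_nf (complex_matrix f) bs" "jordan_nf (complex_matrix g) bs"
  shows "similar_endo f g"
proof -
  have "complex_matrix h = map_mat complex_of_real (fun_mat h)" for h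
    by (rule eq_matI) (auto simp: complex_matrix_def fun_mat_def)
  then have "similar_mat (map_mat complex_of_real (fun_mat f)) (map_mat complex_of_real (fun_mat g))"
    using assms(3,4) similar_mat_trans similar_mat_sym unfolding jordan_nf_def by metis
  then have sim: "similar_mat (fun_mat f) (fun_mat g)"
    by (rule real_similar_if_complex_similar[of _ 4, rotated 2]) (simp_all add: fun_mat_def)
  from similar_matD[OF sim] obtain n M N where n: "{fun_mat f, fun_mat g, M, N} \<subseteq> carrier_mat n n"
    and MN: "M * N = 1\<^sub>m n" "N * M = 1\<^sub>m n" "fun_mat f = M * fun_mat g * N"
    by blast
  have "n = 4" using n unfolding fun_mat_def by auto
  note n = n[unfolded this] and MN = MN[unfolded this]
  have c: "M \<in> carrier_mat 4 4" "N \<in> carrier_mat 4 4" "fun_mat g \<in> carrier_mat 4 4" using n by auto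
  have 1: "mat_fun M (mat_fun N x) = x" "mat_fun N (mat_fun M x) = x" for x
    using mat_fun_mult[OF c(1,2), of x] mat_fun_mult[OF c(2,1), of x] MN mat_fun_one by auto
  have "f x = mat_fun M (g (mat_fun N x))" for x
  proof -
    have "f x = mat_fun (M * fun_mat g * N) x"
      unfolding MN(3)[symmetric] by (rule mat_fun_fun_mat[OF f, symmetric])
    then show ?thesis
      by (simp only: mat_fun_mult[OF mult_carrier_mat[OF c(1,3)] c(2)] mat_fun_mult[OF c(1,3)] mat_fun_fun_mat[OF g])
  qed
  then have "f (mat_fun M x) = mat_fun M (g x)" for x using 1 by simp
  then show ?thesis unfolding similar_endo_def using linear_mat_fun 1 by blast
qed

subsection \<open>Traces of Jacobi operators\<close>

text \<open>A null vector is the limit of timelike vectors \<open>v + t w\<close>. By homogeneity p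
  takes there the value c times the n-th power of minus the squared length, and this tends to
  0.\<close>

lemma null_limit:
  fixes p :: "coord \<Rightarrow> real"
  assumes b: "metric_at b" and e: "orthonormal b e"
    and p1: "\<And>v. b v v = - 1 \<Longrightarrow> p v = c" and hom: "\<And>r v. p (r *\<^sub>R v) = (r\<^sup>2) ^ n * p v" and n: "n \<noteq> 0"
    and cont: "\<And>v w. continuous_on UNIV (\<lambda>t. p (v + t *\<^sub>R w))"
    and v: "b v v = 0"
  shows "p v = 0"
proof -
  \<comment> \<open>The sign makes \<open>b v w\<close> nonpositive, so that \<open>v + t w\<close>
    is timelike for every t > 0.\<close>
  define w where "w = (if b v (e 0) \<le> 0 then e 0 else - e 0)"
  have bil: "bilinear b" and sym: "\<And>x y. b x y = b y x" using b unfolding metric_at_def by auto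
  have ww: "b w w = - 1" unfolding w_def using e
    by (simp add: orthonormal_iff[OF sym] bilinear_lneg[OF bil] bilinear_rneg[OF bil])
  have vw: "b v w \<le> 0" unfolding w_def by (auto simp: bilinear_rneg[OF bil])
  define s where "s t = t\<^sup>2 - 2 * t * b v w" for t
  have ps: "p (v + t *\<^sub>R w) = (s t) ^ n * c" if t: "t > 0" for t
  proof -
    have "2 * t * b v w \<le> 0" using t vw by (simp add: mult_nonneg_nonpos)
    then have s: "s t > 0" unfolding s_def using t by (smt (verit) zero_less_power)
    have bb: "b (v + t *\<^sub>R w) (v + t *\<^sub>R w) = - s t"
      using v ww sym[of w v]
      by (simp add: s_def bilinear_ladd[OF bil] bilinear_radd[OF bil] bilinear_lmul[OF bil] bilinear_rmul[OF bil] power2_eq_square algebra_simps)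
    define u where "u = (1 / sqrt (s t)) *\<^sub>R (v + t *\<^sub>R w)"
    have "b u u = - 1"
      unfolding u_def using s bb by (simp add: bilinear_lmul[OF bil] bilinear_rmul[OF bil])
    moreover have "v + t *\<^sub>R w = sqrt (s t) *\<^sub>R u" unfolding u_def using s by simp
    ultimately show ?thesis using p1 hom s by simp
  qed
  have "((\<lambda>t. p (v + t *\<^sub>R w)) \<longlongrightarrow> p (v + 0 *\<^sub>R w)) (at 0)"
    using cont[of v w] unfolding continuous_on_def by blast
  then have "((\<lambda>t. p (v + t *\<^sub>R w)) \<longlongrightarrow> p (v + 0 *\<^sub>R w)) (at_right 0)"
    by (rule tendsto_within_subset) simp
  then have "((\<lambda>t. p (v + t *\<^sub>R w)) \<longlongrightarrow> p v) (at_right 0)" by simp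
  moreover have "\<forall>\<^sub>F t in at_right 0. p (v + t *\<^sub>R w) = (s t) ^ n * c"
    using ps by (auto simp: eventually_at_right_field intro: exI[of _ 1])
  ultimately have "((\<lambda>t. (s t) ^ n * c) \<longlongrightarrow> p v) (at_right 0)"
    by (rule Lim_transform_eventually)
  moreover have "((\<lambda>t. (s t) ^ n * c) \<longlongrightarrow> (s 0) ^ n * c) (at_right 0)"
    unfolding s_def by (intro tendsto_intros)
  ultimately have "p v = (s 0) ^ n * c"
    by (rule tendsto_unique[rotated]) simp
  then show ?thesis using n by (simp add: s_def)
qed

context
  fixes b :: bilin and R :: curv
  assumes b: "metric_at b" and T: "alg_curv (lower b R)"
begin

lemma linear_curvature: "linear (R x y)" "linear (\<lambda>y. R x y z)" "linear (\<lambda>x. R x y z)"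
proof -
  have bil: "bilinear b" and sig: "signature_2_2 b" using b unfolding metric_at_def by auto
  note L = alg_curv_linear[OF T, unfolded lower_def]
  note eqI = metric_eqI[OF bil sig]
  show "linear (R x y)"
    by (rule linearI; rule eqI)
      (use linear_add[OF L(3)] linear_cmul[OF L(3)] in \<open>simp_all add: bilinear_ladd[OF bil] bilinear_lmul[OF bil]\<close>)
  show "linear (\<lambda>y. R x y z)"
    by (rule linearI; rule eqI)
      (use linear_add[OF L(2)] linear_cmul[OF L(2)] in \<open>simp_all add: bilinear_ladd[OF bil] bilinear_lmul[OF bil]\<close>)
  show "linear (\<lambda>x. R x y z)"
    by (rule linearI; rule eqI)
      (use linear_add[OF L(1)] linear_cmul[OF L(1)] in \<open>simp_all add: bilinear_ladd[OF bil] bilinear_lmul[OF bil]\<close>)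
qed

lemma linear_jacobi: "linear (jacobi R x)"
  unfolding jacobi_def by (rule linear_curvature(3))

lemma jacobi_trace:
  assumes e: "orthonormal b e"
  shows "endo_trace (jacobi R v) = (\<Sum>i\<in>UNIV. eps i * lower b R (e i) v v (e i))"
    and "endo_trace (\<lambda>y. jacobi R v (jacobi R v y)) =
      (\<Sum>i\<in>UNIV. \<Sum>j\<in>UNIV. eps i * eps j * (lower b R (e i) v v (e j))\<^sup>2)"
proof -
  let ?J = "jacobi R v"
  have lin: "linear (\<lambda>w. eps i * b w (e i))" for i
    using b unfolding metric_at_def
    by (auto intro!: linearI simp: bilinear_ladd bilinear_lmul algebra_simps)
  have J: "b (?J x) y = lower b R x v v y" for x y unfolding jacobi_def lower_def ..
  show "endo_trace ?J = (\<Sum>i\<in>UNIV. eps i * lower b R (e i) v v (e i))"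
    unfolding J[symmetric] by (rule endo_trace_basis[OF linear_jacobi frame_expand[OF b e] lin])
  have "endo_trace (\<lambda>y. ?J (?J y)) = (\<Sum>i\<in>UNIV. eps i * b (?J (?J (e i))) (e i))"
    by (rule endo_trace_basis[OF _ frame_expand[OF b e] lin])
      (use linear_compose[OF linear_jacobi linear_jacobi] in \<open>simp add: o_def\<close>)
  also have "\<dots> = (\<Sum>i\<in>UNIV. \<Sum>j\<in>UNIV. eps i * eps j * (lower b R (e i) v v (e j))\<^sup>2)"
  proof (rule sum.cong[OF refl])
    fix i
    have "b (?J (?J (e i))) (e i) = lower b R (?J (e i)) v v (e i)" by (rule J)
    also have "\<dots> = (\<Sum>j\<in>UNIV. eps j * b (?J (e i)) (e j) * lower b R (e j) v v (e i))"
      by (rule frame_contraction[OF b e alg_curvD(1)[OF T], symmetric])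
    also have "\<dots> = (\<Sum>j\<in>UNIV. eps j * (lower b R (e i) v v (e j))\<^sup>2)"
      unfolding J T_jacobi_sym[OF T, of "e _" v "e i"] by (simp add: power2_eq_square mult.assoc)
    finally show "eps i * b (?J (?J (e i))) (e i) = (\<Sum>j\<in>UNIV. eps i * eps j * (lower b R (e i) v v (e j))\<^sup>2)"
      by (simp add: sum_distrib_left mult.assoc)
  qed
  finally show "endo_trace (\<lambda>y. ?J (?J y)) = (\<Sum>i\<in>UNIV. \<Sum>j\<in>UNIV. eps i * eps j * (lower b R (e i) v v (e j))\<^sup>2)" .
qed

text \<open>The sums are the traces of J(v) and of its square, constant on unit timelike vectors by
  similarity. They have degree 2 and 4 in v, which are the exponents 1 and 2 of
  \<open>null_limit\<close>.\<close>

lemma null_traces: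
  assumes sim: "\<And>x y. b x x = - 1 \<Longrightarrow> b y y = - 1 \<Longrightarrow> similar_endo (jacobi R x) (jacobi R y)"
    and e: "orthonormal b e" and v: "b v v = 0"
  shows "(\<Sum>i\<in>UNIV. eps i * lower b R (e i) v v (e i)) = 0"
    and "(\<Sum>i\<in>UNIV. \<Sum>j\<in>UNIV. eps i * eps j * (lower b R (e i) v v (e j))\<^sup>2) = 0"
proof -
  have e0: "b (e 0) (e 0) = - 1" using e unfolding orthonormal_def by simp
  note m = T_add[OF T] T_scale[OF T]
  let ?p = "\<lambda>v. \<Sum>i\<in>UNIV. eps i * lower b R (e i) v v (e i)"
  let ?p2 = "\<lambda>v. \<Sum>i\<in>UNIV. \<Sum>j\<in>UNIV. eps i * eps j * (lower b R (e i) v v (e j))\<^sup>2"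
  show "?p v = 0"
  proof (rule null_limit[OF b e, of ?p "?p (e 0)" 1, OF _ _ _ _ v])
    show "?p x = ?p (e 0)" if "b x x = - 1" for x
      unfolding jacobi_trace[OF e, symmetric] by (rule endo_trace_similar[OF sim[OF that e0] linear_jacobi])
    show "?p (r *\<^sub>R x) = (r\<^sup>2) ^ 1 * ?p x" for r x
      by (simp add: m sum_distrib_left power2_eq_square ac_simps)
    show "continuous_on UNIV (\<lambda>t. ?p (x + t *\<^sub>R w))" for x w
      unfolding m by (intro continuous_intros)
  qed simp
  show "?p2 v = 0"
  proof (rule null_limit[OF b e, of ?p2 "?p2 (e 0)" 2, OF _ _ _ _ v])
    show "?p2 x = ?p2 (e 0)" if "b x x = - 1" for x
      unfolding jacobi_trace[OF e, symmetric]
      by (rule endo_trace_similar[OF similar_endo_square[OF sim[OF that e0]]])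
        (use linear_compose[OF linear_jacobi linear_jacobi] in \<open>simp add: o_def\<close>)
    show "?p2 (r *\<^sub>R x) = (r\<^sup>2) ^ 2 * ?p2 x" for r x
      by (simp add: m sum_distrib_left power2_eq_square ac_simps)
    show "continuous_on UNIV (\<lambda>t. ?p2 (x + t *\<^sub>R w))" for x w
      unfolding m by (intro continuous_intros)
  qed simp
qed

end

section \<open>Smooth families of matrices\<close>

lemma bounded_bilinear_matrix_mult:
  "bounded_bilinear ((**) :: real^4^4 \<Rightarrow> real^4^4 \<Rightarrow> real^4^4)"
proof -
  have "linear (\<lambda>X :: real^4^4. X ** Y)" "linear ((**) Y)" for Y :: "real^4^4"
    by (rule linearI; simp add: cart_eq_iff matrix_matrix_mult_def sum.distrib
        sum_distrib_left algebra_simps)+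
  then show ?thesis unfolding bilinear_conv_bounded_bilinear[symmetric] bilinear_def by blast
qed

lemma bounded_linear_transpose: "bounded_linear (Finite_Cartesian_Product.transpose :: real^4^4 \<Rightarrow> real^4^4)"
  unfolding linear_conv_bounded_linear[symmetric]
  by (rule linearI) (simp_all add: cart_eq_iff Finite_Cartesian_Product.transpose_def)

interpretation matrix_mult: bounded_bilinear "(**) :: real^4^4 \<Rightarrow> real^4^4 \<Rightarrow> real^4^4"
  by (rule bounded_bilinear_matrix_mult)

lemmas linear_matrix_mult = matrix_mult.bounded_linear_left[THEN bounded_linear.linear]
  matrix_mult.bounded_linear_right[THEN bounded_linear.linear]

text \<open>Matrices become vectors indexed by pairs, so that an endomorphism of the space of
  matrices has a determinant and Cramer's rule solves linear matrix equations.\<close>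

definition flatten :: "real^4^4 \<Rightarrow> real^(4 \<times> 4)" where
  "flatten X = vec_lambda (\<lambda>p. vec_nth (vec_nth X (fst p)) (snd p))"

definition unflatten :: "real^(4 \<times> 4) \<Rightarrow> real^4^4" where
  "unflatten z = vec_lambda (\<lambda>i. vec_lambda (\<lambda>j. vec_nth z (i, j)))"

lemma flatten_unflatten [simp]: "flatten (unflatten z) = z" "unflatten (flatten X) = X"
  by (simp_all add: flatten_def unflatten_def cart_eq_iff)

lemma linear_flatten: "linear flatten" "linear unflatten"
  by (rule linearI; simp add: flatten_def unflatten_def cart_eq_iff)+

definition op_matrix :: "(real^4^4 \<Rightarrow> real^4^4) \<Rightarrow> real^(4 \<times> 4)^(4 \<times> 4)" where
  "op_matrix \<Lambda> = matrix (\<lambda>z. flatten (\<Lambda> (unflatten z)))"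

lemma op_matrix_mult:
  assumes "linear \<Lambda>"
  shows "op_matrix \<Lambda> *v flatten X = flatten (\<Lambda> X)"
proof -
  have "linear (\<lambda>z. flatten (\<Lambda> (unflatten z)))"
    using linear_compose[OF linear_compose[OF linear_flatten(2) assms] linear_flatten(1)] by (simp add: o_def)
  then show ?thesis unfolding op_matrix_def by (simp add: matrix_works)
qed

lemma op_matrix_nth:
  "vec_nth (vec_nth (op_matrix \<Lambda>) p) r = vec_nth (vec_nth (\<Lambda> (unflatten (axis r 1))) (fst p)) (snd p)"
  by (simp add: op_matrix_def matrix_def flatten_def)

lemma det_op_matrix:
  assumes "linear \<Lambda>"
  shows "Determinants.det (op_matrix \<Lambda>) \<noteq> 0 \<longleftrightarrow> inj \<Lambda>"
proof
  assume "inj \<Lambda>"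
  have "z = 0" if "op_matrix \<Lambda> *v z = 0" for z
  proof -
    have "flatten (\<Lambda> (unflatten z)) = flatten 0"
      using op_matrix_mult[OF assms, of "unflatten z"] that linear_0[OF linear_flatten(1)] by simp
    then have "\<Lambda> (unflatten z) = \<Lambda> 0" using flatten_unflatten(2) linear_0[OF assms] by metis
    then have "unflatten z = 0" using \<open>inj \<Lambda>\<close> injD by metis
    then show ?thesis using flatten_unflatten(1)[of z] linear_0[OF linear_flatten(1)] by metis
  qed
  then have "\<exists>B. B ** op_matrix \<Lambda> = Finite_Cartesian_Product.mat 1"
    using matrix_left_invertible_ker by blast
  then show "Determinants.det (op_matrix \<Lambda>) \<noteq> 0"
    by (simp add: invertible_det_nz[symmetric] invertible_left_inverse)
next
  assume "Determinants.det (op_matrix \<Lambda>) \<noteq> 0"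
  then obtain B where B: "B ** op_matrix \<Lambda> = Finite_Cartesian_Product.mat 1"
    unfolding invertible_det_nz[symmetric] invertible_left_inverse by blast
  show "inj \<Lambda>"
  proof (rule injI)
    fix X Y
    assume "\<Lambda> X = \<Lambda> Y"
    then have "B *v (op_matrix \<Lambda> *v flatten X) = B *v (op_matrix \<Lambda> *v flatten Y)"
      using op_matrix_mult[OF assms] by metis
    then have "flatten X = flatten Y" by (simp add: matrix_vector_mul_assoc B)
    then show "X = Y" using flatten_unflatten(2) by metis
  qed
qed

lemma Ck_on_matrix_nth:
  assumes "open S" "Ck_on k X S"
  shows "Ck_on k (\<lambda>q. vec_nth (vec_nth (X q :: real^4^4) i) j) S"
  using Ck_on_bounded_linear[OF assms(1) bounded_linear_vec_nth Ck_on_bounded_linear[OF assms(1) bounded_linear_vec_nth assms(2)]] .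

lemma Ck_on_op_solve:
  fixes \<Lambda> :: "'a::real_normed_vector \<Rightarrow> real^4^4 \<Rightarrow> real^4^4"
  assumes S: "open S" and lin: "\<And>q. q \<in> S \<Longrightarrow> linear (\<Lambda> q)" and inj: "\<And>q. q \<in> S \<Longrightarrow> inj (\<Lambda> q)"
    and ck: "\<And>X. Ck_on k (\<lambda>q. \<Lambda> q X) S" and y: "Ck_on k y S" and eq: "\<And>q. q \<in> S \<Longrightarrow> \<Lambda> q (w q) = y q"
  shows "Ck_on k w S"
proof -
  have "Ck_on k (\<lambda>q. flatten (w q)) S"
  proof (rule Ck_on_solve[OF S, of _ "\<lambda>q. op_matrix (\<Lambda> q)" "\<lambda>q. flatten (y q)"])
    show "Ck_on k (\<lambda>q. vec_nth (vec_nth (op_matrix (\<Lambda> q)) i) j) S" for i j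
      unfolding op_matrix_nth by (rule Ck_on_matrix_nth[OF S ck])
    show "Ck_on k (\<lambda>q. vec_nth (flatten (y q)) i) S" for i
      unfolding flatten_def using Ck_on_matrix_nth[OF S y] by simp
  qed (use det_op_matrix lin inj op_matrix_mult eq in auto)
  from Ck_on_bounded_linear[OF S linear_flatten(2)[unfolded linear_conv_bounded_linear] this] show ?thesis by simp
qed

lemma smooth_on_op_solve:
  fixes \<Lambda> :: "'a::real_normed_vector \<Rightarrow> real^4^4 \<Rightarrow> real^4^4"
  assumes "open S" "\<And>q. q \<in> S \<Longrightarrow> linear (\<Lambda> q)" "\<And>q. q \<in> S \<Longrightarrow> inj (\<Lambda> q)"
    and "\<And>X. smooth_on (\<lambda>q. \<Lambda> q X) S" "smooth_on y S" "\<And>q. q \<in> S \<Longrightarrow> \<Lambda> q (w q) = y q"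
  shows "smooth_on w S"
  using assms Ck_on_op_solve[of S \<Lambda> _ y w] unfolding smooth_on_def by blast

lemma open_inj:
  fixes \<Lambda> :: "'a::real_normed_vector \<Rightarrow> real^4^4 \<Rightarrow> real^4^4"
  assumes S: "open S" "q0 \<in> S" and lin: "\<And>q. q \<in> S \<Longrightarrow> linear (\<Lambda> q)"
    and cont: "\<And>X. continuous_on S (\<lambda>q. \<Lambda> q X)" and inj: "inj (\<Lambda> q0)"
  obtains S' where "open S'" "q0 \<in> S'" "S' \<subseteq> S" "\<And>q. q \<in> S' \<Longrightarrow> inj (\<Lambda> q)"
proof
  let ?d = "\<lambda>q. Determinants.det (op_matrix (\<Lambda> q))"
  let ?S = "S \<inter> ?d -` (- {0})"
  have "Ck_on 0 ?d S"
  proof (rule Ck_on_det[OF S(1)])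
    show "Ck_on 0 (\<lambda>q. vec_nth (vec_nth (op_matrix (\<Lambda> q)) i) j) S" for i j
      unfolding op_matrix_nth by (rule Ck_on_matrix_nth[OF S(1)]) (use cont in simp)
  qed
  then have "continuous_on S ?d" by simp
  then show "open ?S" by (rule continuous_open_preimage[OF _ S(1)]) (simp add: open_Compl)
  show "q0 \<in> ?S" using S lin inj det_op_matrix by auto
  show "inj (\<Lambda> q)" if "q \<in> ?S" for q using that det_op_matrix[OF lin] by auto
qed simp

subsection \<open>The square root of a matrix close to the identity\<close>

text \<open>The inverse function theorem for squaring, whose derivative at the identity is
  multiplication by 2. Injectivity of \<open>X \<mapsto> root s ** X + X ** root s\<close> is kept
  for comparing and commuting roots, the equation for \<open>root'\<close> for smoothness.\<close>

lemma matrix_square_root: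
  obtains V :: "(real^4^4) set" and root root' where "open V" "Finite_Cartesian_Product.mat 1 \<in> V"
    "root (Finite_Cartesian_Product.mat 1) = Finite_Cartesian_Product.mat 1"
    "\<And>s. s \<in> V \<Longrightarrow> root s ** root s = s"
    "\<And>s. s \<in> V \<Longrightarrow> inj (\<lambda>X. root s ** X + X ** root s)"
    "\<And>s. s \<in> V \<Longrightarrow> (root has_derivative root' s) (at s)"
    "\<And>s H. s \<in> V \<Longrightarrow> root s ** root' s H + root' s H ** root s = H"
proof -
  let ?I = "Finite_Cartesian_Product.mat 1 :: real^4^4"
  let ?f = "\<lambda>Y :: real^4^4. Y ** Y"
  have bl: "bounded_linear (\<lambda>X. Y ** X + X ** Y)" for Y :: "real^4^4"
    by (intro bounded_linear_add matrix_mult.bounded_linear_left matrix_mult.bounded_linear_right)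
  define f' where "f' = (\<lambda>Y :: real^4^4. Blinfun (\<lambda>X. Y ** X + X ** Y))"
  have f': "blinfun_apply (f' Y) = (\<lambda>X. Y ** X + X ** Y)" for Y
    unfolding f'_def by (rule bounded_linear_Blinfun_apply[OF bl])
  have "linear f'"
    by (rule linearI; rule blinfun_eqI)
      (simp_all add: f' blinfun.add_left blinfun.scaleR_left matrix_mult.add_left matrix_mult.add_right
        matrix_mult.scaleR_left matrix_mult.scaleR_right scaleR_add_right)
  then have cont: "continuous_on UNIV f'" by (rule linear_continuous_on[OF linear_conv_bounded_linear[THEN iffD1]])
  have der: "(?f has_derivative blinfun_apply (f' Y)) (at Y)" for Y
    unfolding f' using matrix_mult.FDERIV[OF has_derivative_ident has_derivative_ident, of Y UNIV] by simp
  have inv: "((1 / 2) *\<^sub>R id_blinfun) o\<^sub>L f' ?I = id_blinfun"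
    by (rule blinfun_eqI) (simp add: f' blinfun.scaleR_left scaleR_add_left[symmetric] scaleR_add_right)
  obtain U' V g g' where *: "open U'" "?I \<in> U'" "open V" "?f ?I \<in> V" "homeomorphism U' V ?f g"
    "\<And>y. y \<in> V \<Longrightarrow> (g has_derivative (g' y)) (at y)"
    "\<And>y. y \<in> V \<Longrightarrow> g' y = Hilbert_Choice.inv (blinfun_apply (f' (g y)))"
    "\<And>y. y \<in> V \<Longrightarrow> bij (blinfun_apply (f' (g y)))"
    by (rule inverse_function_theorem[OF open_UNIV der cont UNIV_I inv], rule that)
  show thesis
  proof
    show "open V" by fact
    show "?I \<in> V" using *(4) by simp
    show "g ?I = ?I" using homeomorphism_apply1[OF *(5,2)] by simp
    show "g s ** g s = s" if "s \<in> V" for s using homeomorphism_apply2[OF *(5) that] .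
    show "inj (\<lambda>X. g s ** X + X ** g s)" if "s \<in> V" for s
      using bij_is_inj[OF *(8)[OF that]] unfolding f' .
    show "(g has_derivative g' s) (at s)" if "s \<in> V" for s by (rule *(6)[OF that])
    show "g s ** g' s H + g' s H ** g s = H" if "s \<in> V" for s H
      using surj_f_inv_f[OF bij_is_surj[OF *(8)[OF that]], of H] unfolding *(7)[OF that] f' .
  qed
qed

text \<open>A bootstrap: the derivative of the root solves a linear equation whose coefficients are
  the root itself. If these are C^k then so is the derivative, and the root is C^(k+1).\<close>

lemma smooth_on_root:
  fixes root :: "real^4^4 \<Rightarrow> real^4^4" and s :: "'a::real_normed_vector \<Rightarrow> real^4^4"
  assumes V: "open V" and inj: "\<And>y. y \<in> V \<Longrightarrow> inj (\<lambda>X. root y ** X + X ** root y)"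
    and D: "\<And>y. y \<in> V \<Longrightarrow> (root has_derivative root' y) (at y)"
    and eq: "\<And>y H. y \<in> V \<Longrightarrow> root y ** root' y H + root' y H ** root y = H"
    and S: "open S" and s: "smooth_on s S" "\<And>q. q \<in> S \<Longrightarrow> s q \<in> V"
  shows "smooth_on (\<lambda>q. root (s q)) S"
  unfolding smooth_on_def
proof
  fix k
  show "Ck_on k (\<lambda>q. root (s q)) S"
  proof (induction k)
    case 0
    have "continuous_on V root"
      using D has_derivative_continuous by (metis continuous_at_imp_continuous_on)
    then show ?case using continuous_on_compose2[OF _ smooth_on_continuous_on[OF s(1)]] s(2) by auto
  next
    case (Suc k)
    show ?case
    proof (rule Ck_on_SucI[OF S has_derivative_compose[OF smooth_on_has_derivative[OF s(1)] D[OF s(2)]]])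
      fix v
      have lin: "linear (\<lambda>X. root (s q) ** X + X ** root (s q))" for q
        by (intro linear_compose_add linear_matrix_mult)
      show "Ck_on k (\<lambda>q. root' (s q) (frechet_derivative s (at q) v)) S"
        by (rule Ck_on_op_solve[OF S lin inj[OF s(2)], where y = "\<lambda>q. frechet_derivative s (at q) v"])
          (use s(2) eq smooth_on_derivative[OF s(1), of v] in
            \<open>auto intro!: Ck_on_add[OF S] Ck_on_bilinear[OF S bounded_bilinear_matrix_mult] Suc.IH Ck_on_const
              simp: smooth_on_def\<close>)
    qed
  qed
qed

subsection \<open>Smooth intertwiners\<close>

text \<open>With \<open>L q X = A q X - X A q0\<close> and \<open>pr\<close> the orthogonal projection to the kernel \<open>K\<close> of \<open>L q0\<close>, the
  operator \<open>T q = (L q0)\<^sup>* (L q) + pr\<close> is invertible for \<open>q\<close> close to \<open>q0\<close> and maps the kernel of \<open>L q\<close> into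
  \<open>K\<close>, hence onto it because the dimensions agree.  So the solution of \<open>T q X = 1\<close> is an intertwiner.\<close>
lemma smooth_intertwiner:
  fixes A :: "'a::real_normed_vector \<Rightarrow> real^4^4"
  assumes S: "open S" "q0 \<in> S" and A: "smooth_on A S"
    and sim: "\<And>q. q \<in> S \<Longrightarrow> \<exists>M N. M ** N = Finite_Cartesian_Product.mat 1 \<and>
      N ** M = Finite_Cartesian_Product.mat 1 \<and> A q ** M = M ** A q0"
  obtains S' h where "open S'" "q0 \<in> S'" "S' \<subseteq> S" "smooth_on h S'" "h q0 = Finite_Cartesian_Product.mat 1"
    "\<And>q. q \<in> S' \<Longrightarrow> A q ** h q = h q ** A q0"
proof -
  let ?I = "Finite_Cartesian_Product.mat 1 :: real^4^4"
  define L where "L q X = A q ** X - X ** A q0" for q and X :: "real^4^4"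
  have linL: "linear (L q)" for q
    unfolding L_def by (intro linear_compose_sub linear_matrix_mult)
  define K where "K q = {X. L q X = 0}" for q
  have subK: "subspace (K q)" for q unfolding K_def by (rule linear_subspace_kernel[OF linL])
  obtain B where B: "B \<subseteq> K q0" "pairwise real_inner_class.orthogonal B" "\<And>x. x \<in> B \<Longrightarrow> norm x = 1" "independent B" "span B = K q0"
    using orthonormal_basis_subspace[OF subK] by metis
  have finB: "finite B" using B(4) by (rule independent_imp_finite)
  define pr where "pr X = (\<Sum>b\<in>B. (X \<bullet> b) *\<^sub>R b)" for X
  have lin_pr: "linear pr"
    unfolding pr_def by (rule linearI) (simp_all add: inner_add_left scaleR_add_left sum.distrib scaleR_sum_right)
  have pr_K: "pr X \<in> K q0" for X
    unfolding pr_def using B(1) by (intro subspace_sum[OF subK] subspace_scale[OF subK]) auto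
  have pr_id: "pr X = X" if "X \<in> K q0" for X
    unfolding pr_def by (rule orthonormal_basis_expand) (use B that finB in auto)
  define T where "T q X = adjoint (L q0) (L q X) + pr X" for q X
  have linT: "linear (T q)" for q
    unfolding T_def
    by (intro linear_compose_add lin_pr linear_compose[OF linL adjoint_linear[OF linL], unfolded o_def])
  have injT: "inj (T q0)"
  proof (rule linear_injective_0[OF linT, THEN iffD2], intro allI impI)
    fix X assume "T q0 X = 0"
    then have "adjoint (L q0) (L q0 X) = - pr X" unfolding T_def by (simp add: eq_neg_iff_add_eq_0)
    then have "pr X \<bullet> adjoint (L q0) (L q0 X) = - (pr X \<bullet> pr X)" by simp
    moreover have "pr X \<bullet> adjoint (L q0) (L q0 X) = L q0 (pr X) \<bullet> L q0 X" by (rule adjoint_works[OF linL])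
    \<comment> \<open>The range of the adjoint is orthogonal to the kernel of \<open>L q0\<close>,
      so the two summands of \<open>T q0 X\<close> vanish separately.\<close>
    ultimately have P0: "pr X = 0" using pr_K[of X] unfolding K_def by simp
    then have "X \<bullet> adjoint (L q0) (L q0 X) = 0" using \<open>T q0 X = 0\<close> unfolding T_def by simp
    then have "L q0 X \<bullet> L q0 X = 0" using adjoint_works[OF linL, of X q0 "L q0 X"] by simp
    then have "X \<in> K q0" unfolding K_def by simp
    then show "X = 0" using pr_id P0 by simp
  qed
  have smL: "smooth_on (\<lambda>q. L q X) S" for X
    unfolding L_def
    by (intro smooth_on_diff smooth_on_bilinear[OF _ bounded_bilinear_matrix_mult] smooth_on_const A S)
  have smT: "smooth_on (\<lambda>q. T q X) S" for X
    unfolding T_def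
    by (intro smooth_on_add smooth_on_const S smL
        smooth_on_bounded_linear[OF _ adjoint_linear[OF linL, unfolded linear_conv_bounded_linear]])
  obtain S' where S': "open S'" "q0 \<in> S'" "S' \<subseteq> S" "\<And>q. q \<in> S' \<Longrightarrow> inj (T q)"
    using open_inj[OF S linT smooth_on_continuous_on[OF smT] injT] by blast
  have ex: "\<exists>X. T q X = ?I \<and> A q ** X = X ** A q0" if q: "q \<in> S'" for q
  proof -
    obtain M N where MN: "M ** N = ?I" "N ** M = ?I" "A q ** M = M ** A q0" using sim q S'(3) by blast
    \<comment> \<open>Left multiplication by M sends K into the kernel of \<open>L q\<close>, and
      \<open>T q\<close> brings it back. So \<phi> maps K injectively into itself, hence onto, and
      reaches the identity matrix.\<close>
    define \<phi> where "\<phi> X = T q (M ** X)" for X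
    have lin\<phi>: "linear \<phi>" unfolding \<phi>_def
      using linear_compose[OF linear_matrix_mult(2)[of M] linT[of q]] by (simp add: o_def)
    have MX: "A q ** (M ** X) = (M ** X) ** A q0" if "X \<in> K q0" for X
    proof -
      have "A q0 ** X = X ** A q0" using that unfolding K_def L_def by simp
      then show ?thesis using MN(3) by (metis matrix_mul_assoc)
    qed
    have "\<phi> ` K q0 \<subseteq> K q0"
    proof safe
      fix X assume "X \<in> K q0"
      then have "L q (M ** X) = 0" using MX unfolding L_def by simp
      then have "\<phi> X = pr (M ** X)" unfolding \<phi>_def T_def
        using linear_0[OF adjoint_linear[OF linL]] by simp
      then show "\<phi> X \<in> K q0" using pr_K by simp
    qed
    moreover have "inj \<phi>"
    proof (rule injI)
      fix X Y assume "\<phi> X = \<phi> Y"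
      then have "M ** X = M ** Y" unfolding \<phi>_def using S'(4)[OF q] injD by metis
      then have "(N ** M) ** X = (N ** M) ** Y" by (metis matrix_mul_assoc)
      then show "X = Y" unfolding MN(2) by simp
    qed
    then have "dim (\<phi> ` K q0) = dim (K q0)"
      using dim_image_eq[OF lin\<phi>] inj_on_subset by blast
    ultimately have "\<phi> ` K q0 = K q0"
      using subspace_dim_equal[OF linear_subspace_image[OF lin\<phi> subK] subK] by simp
    moreover have "?I \<in> K q0" unfolding K_def L_def by simp
    ultimately obtain X where X: "X \<in> K q0" "\<phi> X = ?I" by (metis imageE)
    then show ?thesis using MX[OF X(1)] unfolding \<phi>_def by blast
  qed
  define h where "h q = (SOME X. T q X = ?I \<and> A q ** X = X ** A q0)" for q
  have h: "T q (h q) = ?I" "A q ** h q = h q ** A q0" if "q \<in> S'" for q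
    using someI_ex[OF ex[OF that]] unfolding h_def by auto
  have "smooth_on h S'"
    by (rule smooth_on_op_solve[OF S'(1) linT S'(4) smooth_on_subset[OF smT S'(3)] smooth_on_const h(1)])
  moreover have "h q0 = ?I"
  proof -
    have I: "?I \<in> K q0" unfolding K_def L_def by simp
    then have "T q0 ?I = ?I"
      unfolding T_def using pr_id linear_0[OF adjoint_linear[OF linL]] unfolding K_def by simp
    then show ?thesis using h(1)[OF S'(2)] S'(4)[OF S'(2)] injD by metis
  qed
  ultimately show thesis using that[OF S'(1-3)] h(2) by blast
qed

section \<open>Frames with constant Jacobi operator\<close>

lemma smooth_on_matrix:
  assumes "open S" "\<And>y. smooth_on (\<lambda>q. f q y :: coord) S"
  shows "smooth_on (\<lambda>q. matrix (f q) :: real^4^4) S"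
proof -
  have "smooth_on (\<lambda>q. flatten (matrix (f q))) S"
    by (rule smooth_on_componentwise[OF assms(1)])
      (simp add: flatten_def matrix_def smooth_on_nth[OF assms])
  from smooth_on_bounded_linear[OF assms(1) linear_flatten(2)[unfolded linear_conv_bounded_linear] this]
  show ?thesis by simp
qed

lemma similar_endo_matrix:
  assumes "similar_endo f g" "linear f" "linear g"
  shows "\<exists>M N. M ** N = Finite_Cartesian_Product.mat 1 \<and> N ** M = Finite_Cartesian_Product.mat 1 \<and>
    matrix f ** M = M ** (matrix g :: real^4^4)"
proof -
  obtain M N where M: "linear M" "linear N" "\<And>x. N (M x) = x" "\<And>x. M (N x) = x" "\<And>x. f (M x) = M (g x)"
    using assms(1) unfolding similar_endo_def by blast
  have "matrix M ** matrix N = Finite_Cartesian_Product.mat 1" "matrix N ** matrix M = Finite_Cartesian_Product.mat 1"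
    "matrix f ** matrix M = matrix M ** (matrix g :: real^4^4)"
    by (simp_all add: matrix_eq matrix_vector_mul_assoc[symmetric] matrix_works M assms)
  then show ?thesis by blast
qed

lemma gram_inner:
  assumes "bilinear b" "\<And>x y. b x y = b y x"
  shows "y \<bullet> (gram b *v x) = b x y"
proof -
  have "linear (b x)" using assms unfolding bilinear_def by blast
  from coord_expand[OF this, of y] show ?thesis
    unfolding gram_mult[OF assms(1)] by (simp add: inner_vec_def)
qed

lemma jacobi_scale: "(\<And>x y z. linear (R x y) \<and> linear (\<lambda>y. R x y z)) \<Longrightarrow> jacobi R (r *\<^sub>R x) y = (r * r) *\<^sub>R jacobi R x y"
  unfolding jacobi_def by (metis linear_cmul scaleR_scaleR)

context metric_chart
begin

context
  fixes R :: "coord \<Rightarrow> curv" and q0 :: coord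
  assumes q0: "q0 \<in> S" and alg: "\<And>q. q \<in> S \<Longrightarrow> alg_curv (lower (G q) (R q))"
    and smR: "\<And>x y z. smooth_on (\<lambda>q. R q x y z) S"
    and sim: "\<And>q q' x x'. q \<in> S \<Longrightarrow> q' \<in> S \<Longrightarrow> G q x x = - 1 \<Longrightarrow> G q' x' x' = - 1 \<Longrightarrow>
      similar_endo (jacobi (R q) x) (jacobi (R q') x')"
begin

text \<open>\<open>x q\<close> is the normalised direction of the constant vector \<open>e0\<close>.  The intertwiner \<open>h0\<close> of the
  Jacobi operators is made to respect the splitting of the tangent space into the line of \<open>x q\<close> and
  its orthogonal complement, and then replaced by the isometry in its polar decomposition.\<close>
lemma local_isometry:
  fixes e0 :: coord
  assumes e0: "G q0 e0 e0 = - 1"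
  obtains S' F where "open S'" "q0 \<in> S'" "S' \<subseteq> S" "\<And>y. smooth_on (\<lambda>q. F q *v y) S'"
    "\<And>q y z. q \<in> S' \<Longrightarrow> G q (F q *v y) (F q *v z) = G q0 y z"
    "\<And>q y. q \<in> S' \<Longrightarrow> jacobi (R q) (F q *v e0) (F q *v y) = F q *v (jacobi (R q0) e0 y)"
proof -
  let ?I = "Finite_Cartesian_Product.mat 1 :: real^4^4"
  define S1 where "S1 = S \<inter> (\<lambda>q. G q e0 e0) -` {..<0}"
  have "continuous_on S (\<lambda>q. G q e0 e0)" by (rule smooth_on_continuous_on[OF smooth])
  then have S1: "open S1" "q0 \<in> S1" "S1 \<subseteq> S"
    unfolding S1_def using q0 e0 open_S by (auto intro: continuous_open_preimage)
  have neg: "G q e0 e0 < 0" if "q \<in> S1" for q using that unfolding S1_def by simp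
  define x where "x q = (1 / sqrt (- G q e0 e0)) *\<^sub>R e0" for q
  \<comment> \<open>The Jacobi operator of \<open>x q\<close>. Being quadratic in the vector, it is
    free of the square root.\<close>
  define J where "J q y = (- 1 / G q e0 e0) *\<^sub>R R q y e0 e0" for q y
  define P where "P q y = (G q y e0 / G q e0 e0) *\<^sub>R e0" for q y
  have met: "metric_at (G q)" if "q \<in> S" for q by (rule metric_at[OF that])
  have linR: "linear (R q x y)" "linear (\<lambda>y. R q x y z)" "linear (\<lambda>x. R q x y z)" if "q \<in> S" for q x y z
    by (rule linear_curvature[OF met[OF that] alg[OF that]])+
  have linG: "linear (\<lambda>y. G q y z)" if "q \<in> S" for q z using bil[OF that] unfolding bilinear_def by blast
  have linJ: "linear (J q)" if "q \<in> S" for q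
    unfolding J_def by (intro linear_compose_scale_right linR that)
  have linP: "linear (P q)" if "q \<in> S" for q
    unfolding P_def by (rule linearI)
      (simp_all add: linear_add[OF linG[OF that]] linear_cmul[OF linG[OF that]] add_divide_distrib scaleR_add_left)
  have xx: "G q (x q) (x q) = - 1" if "q \<in> S1" for q
    using neg[OF that] bil[of q] that S1(3) unfolding x_def
    by (simp add: bilinear_lmul bilinear_rmul subset_iff)
  have J: "J q y = jacobi (R q) (x q) y" if "q \<in> S1" for q y
  proof -
    have "jacobi (R q) (x q) y = (1 / sqrt (- G q e0 e0) * (1 / sqrt (- G q e0 e0))) *\<^sub>R jacobi (R q) e0 y"
      unfolding x_def by (rule jacobi_scale) (use linR that S1(3) in blast)
    also have "1 / sqrt (- G q e0 e0) * (1 / sqrt (- G q e0 e0)) = - 1 / G q e0 e0"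
      using neg[OF that] by (simp add: field_simps)
    finally show ?thesis unfolding J_def jacobi_def by simp
  qed
  have J0: "J q0 y = jacobi (R q0) e0 y" for y unfolding J_def jacobi_def e0 by simp
  have G_J: "G q (J q y) z = G q y (J q z)" if "q \<in> S" for q y z
    using T_jacobi_sym[OF alg[OF that], of y e0 z] sym[OF that, of y "R q z e0 e0"]
    by (simp add: J_def bilinear_lmul[OF bil[OF that]] bilinear_rmul[OF bil[OF that]]
        bilinear_lneg[OF bil[OF that]] bilinear_rneg[OF bil[OF that]] lower_def)
  have G_P: "G q (P q y) z = G q y (P q z)" if "q \<in> S" for q y z
    using sym[OF that, of e0 z]
    by (simp add: P_def bilinear_lmul[OF bil[OF that]] bilinear_rmul[OF bil[OF that]])
  have Je0: "J q e0 = 0" if "q \<in> S" for q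
    by (rule eqI[OF that that])
      (simp add: J_def bilinear_lmul[OF bil[OF that]] bilinear_lneg[OF bil[OF that]] bilinear_lzero[OF bil[OF that]]
        T_alt(1)[OF alg[OF that], unfolded lower_def])
  have JP: "J q (P q y) = 0" if "q \<in> S" for q y
    unfolding P_def linear_cmul[OF linJ[OF that]] Je0[OF that] by simp
  have PJ: "P q (J q y) = 0" if "q \<in> S" for q y
    using G_J[OF that, of y e0] Je0[OF that] unfolding P_def by (simp add: bilinear_rzero[OF bil[OF that]])
  have PP: "P q (P q y) = P q y" if "q \<in> S1" for q y
    using neg[OF that] bil[of q] that S1(3) unfolding P_def by (simp add: bilinear_lmul subset_iff)
  have smJ: "smooth_on (\<lambda>q. J q y) S1" for y
    unfolding J_def
    by (intro smooth_on_scaleR smooth_on_divide smooth_on_const smooth_on_subset[OF smooth] smooth_on_subset[OF smR] S1)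
      (use neg in force)
  have smP: "smooth_on (\<lambda>q. P q y) S1" for y
    unfolding P_def
    by (intro smooth_on_scaleR smooth_on_divide smooth_on_const smooth_on_subset[OF smooth] S1)
      (use neg in force)
  have mJ: "matrix (J q) *v y = J q y" and mP: "matrix (P q) *v y = P q y" if "q \<in> S1" for q y
    using that S1(3) linJ linP by (auto simp: matrix_works)
  have "\<exists>M N. M ** N = ?I \<and> N ** M = ?I \<and> matrix (J q) ** M = M ** matrix (J q0)" if "q \<in> S1" for q
  proof (rule similar_endo_matrix)
    have "similar_endo (jacobi (R q) (x q)) (jacobi (R q0) e0)"
      using that S1(3) xx q0 e0 by (intro sim) auto
    then show "similar_endo (J q) (J q0)"
      using J[OF that] J0 by (metis (no_types, lifting) ext)
  qed (use that S1(3) linJ q0 in auto)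
  from smooth_intertwiner[OF S1(1,2) smooth_on_matrix[OF S1(1) smJ] this] obtain S2 h0 where
    S2: "open S2" "q0 \<in> S2" "S2 \<subseteq> S1" and smh0: "smooth_on h0 S2" and h0: "h0 q0 = ?I"
    and Jh0': "\<And>q. q \<in> S2 \<Longrightarrow> matrix (J q) ** h0 q = h0 q ** matrix (J q0)" by blast
  have S2S: "q \<in> S1" "q \<in> S" if "q \<in> S2" for q using that S2(3) S1(3) by auto
  have Jh0: "J q (h0 q *v y) = h0 q *v J q0 y" if "q \<in> S2" for q y
  proof -
    have "matrix (J q) *v (h0 q *v y) = h0 q *v (matrix (J q0) *v y)"
      using Jh0'[OF that] by (metis matrix_vector_mul_assoc)
    then show ?thesis using mJ S2S that S1(2) by simp
  qed
  \<comment> \<open>The block diagonal part of h0 with respect to the projections P. It still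
    intertwines, because J kills the line of e0 and P kills the range of J.\<close>
  define H where "H q = matrix (P q) ** h0 q ** matrix (P q0) + (?I - matrix (P q)) ** h0 q ** (?I - matrix (P q0))" for q
  have H: "H q *v y = P q (h0 q *v P q0 y) + (h0 q *v (y - P q0 y) - P q (h0 q *v (y - P q0 y)))" if "q \<in> S2" for q y
    unfolding H_def
    using mP S2S[OF that] S1(2)
    by (simp add: matrix_vector_mult_add_rdistrib matrix_vector_mult_diff_rdistrib matrix_vector_mul_assoc[symmetric])
  have smH: "smooth_on H S2"
    unfolding H_def
    by (intro smooth_on_add smooth_on_diff smooth_on_bilinear[OF _ bounded_bilinear_matrix_mult] smooth_on_const smh0
        smooth_on_subset[OF smooth_on_matrix[OF S1(1) smP]] S2)
  have H0: "H q0 = ?I"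
    using H[OF S2(2)] linear_diff[OF linP[OF q0]] PP[OF S1(2)] h0 by (simp add: matrix_eq)
  have JH: "J q (H q *v y) = H q *v J q0 y" if q: "q \<in> S2" for q y
  proof -
    note q' = S2S(2)[OF q]
    have "J q (H q *v y) = h0 q *v J q0 y"
      unfolding H[OF q]
      by (simp add: linear_add[OF linJ[OF q']] linear_diff[OF linJ[OF q']] JP[OF q'] Jh0[OF q]
          linear_diff[OF linJ[OF q0]] JP[OF q0])
    moreover have "P q (h0 q *v J q0 y) = 0" using Jh0[OF q, of y] PJ[OF q'] by metis
    ultimately show ?thesis unfolding H[OF q] by (simp add: PJ[OF q0] linear_0[OF linP[OF q']])
  qed
  have PH: "P q (H q *v y) = H q *v P q0 y" if q: "q \<in> S2" for q y
    unfolding H[OF q] PP[OF S1(2)]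
    by (simp add: linear_add[OF linP[OF S2S(2)[OF q]]] linear_diff[OF linP[OF S2S(2)[OF q]]] PP[OF S2S(1)[OF q]]
        linear_0[OF linP[OF S2S(2)[OF q]]])
  have "Determinants.det (gram (G q0)) \<noteq> 0" by (rule det_gram[OF bil[OF q0] sig[OF q0]])
  then obtain Gi where Gi: "gram (G q0) ** Gi = ?I" "Gi ** gram (G q0) = ?I"
    unfolding invertible_det_nz[symmetric] invertible_def by blast
  have gi: "z \<bullet> (gram (G q) *v y) = G q y z" if "q \<in> S" for q y z
    by (rule gram_inner) (use bil sym that in auto)
  have Gi_inner: "G q0 (Gi *v y) z = z \<bullet> y" for y z
    using gi[OF q0, of z "Gi *v y"] by (simp add: matrix_vector_mul_assoc Gi)
  have tr: "z \<bullet> (Finite_Cartesian_Product.transpose M *v u) = (M *v z) \<bullet> u" for M :: "real^4^4" and z u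
    using dot_lmul_matrix[of u M z] by (simp add: inner_commute)
  \<comment> \<open>This is the adjoint of H, taken from \<open>G q\<close> to \<open>G q0\<close>,
    composed with H; the next fact is its defining property.\<close>
  define s where "s q = Gi ** (Finite_Cartesian_Product.transpose (H q) ** (gram (G q) ** H q))" for q
  have s: "G q0 (s q *v y) z = G q (H q *v y) (H q *v z)" if "q \<in> S2" for q y z
    unfolding s_def by (simp only: matrix_vector_mul_assoc[symmetric] Gi_inner tr gi[OF S2S(2)[OF that]])
  have eq0: "u = w" if "\<And>z. G q0 u z = G q0 w z" for u w by (rule eqI[OF q0 q0 that])
  have s0: "s q0 = ?I"
    unfolding matrix_eq using s[OF S2(2)] H0 by (auto intro: eq0)
  have smg: "smooth_on (\<lambda>q. gram (G q)) S2"
  proof -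
    have "gram (G q) = matrix (\<lambda>w. vec_lambda (\<lambda>i. G q w (axis i 1)))" for q
      by (simp add: gram_def matrix_def)
    moreover have "smooth_on (\<lambda>q. vec_lambda (\<lambda>i. G q w (axis i 1)) :: coord) S2" for w
      by (rule smooth_on_componentwise[OF S2(1)])
        (use smooth_on_subset[OF smooth] S2S(2) in \<open>simp add: subset_iff\<close>)
    ultimately show ?thesis using smooth_on_matrix[OF S2(1)] by simp
  qed
  have sms: "smooth_on s S2"
    unfolding s_def
    by (intro smooth_on_bilinear[OF _ bounded_bilinear_matrix_mult] smooth_on_const smg smH S2(1)
        smooth_on_bounded_linear[OF _ bounded_linear_transpose])
  obtain V root root' where V: "open V" "?I \<in> V" "root ?I = ?I" "\<And>s. s \<in> V \<Longrightarrow> root s ** root s = s"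
    "\<And>s. s \<in> V \<Longrightarrow> inj (\<lambda>X. root s ** X + X ** root s)"
    "\<And>s. s \<in> V \<Longrightarrow> (root has_derivative root' s) (at s)"
    "\<And>s H. s \<in> V \<Longrightarrow> root s ** root' s H + root' s H ** root s = H"
    by (rule matrix_square_root, rule that)
  define S3 where "S3 = S2 \<inter> s -` V"
  have S3: "open S3" "q0 \<in> S3" "S3 \<subseteq> S2"
    unfolding S3_def using S2 s0 V(1,2) smooth_on_continuous_on[OF sms] by (auto intro: continuous_open_preimage)
  have sV: "s q \<in> V" if "q \<in> S3" for q using that unfolding S3_def by simp
  define \<rho> where "\<rho> q = root (s q)" for q
  have sm\<rho>: "smooth_on \<rho> S3"
    unfolding \<rho>_def
    by (rule smooth_on_root[OF V(1,5,6,7) S3(1) smooth_on_subset[OF sms S3(3)] sV])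
  have \<rho>0: "\<rho> q0 = ?I" unfolding \<rho>_def s0 V(3) ..
  have \<rho>\<rho>: "\<rho> q ** \<rho> q = s q" if "q \<in> S3" for q unfolding \<rho>_def by (rule V(4)[OF sV[OF that]])
  \<comment> \<open>The commutator X of the root with C satisfies
    \<open>\<rho> X + X \<rho> = 0\<close>, because the square of \<rho> commutes with C; that
    equation has only the zero solution.\<close>
  have commute: "\<rho> q ** C = C ** \<rho> q" if q: "q \<in> S3" and C: "s q ** C = C ** s q" for q C
  proof -
    let ?X = "\<rho> q ** C - C ** \<rho> q"
    have "\<rho> q ** ?X + ?X ** \<rho> q = (\<rho> q ** \<rho> q) ** C - C ** (\<rho> q ** \<rho> q)"
      by (simp add: matrix_mult.diff_left matrix_mult.diff_right matrix_mul_assoc)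
    then have "\<rho> q ** ?X + ?X ** \<rho> q = \<rho> q ** 0 + 0 ** \<rho> q"
      unfolding \<rho>\<rho>[OF q] C by simp
    then have "?X = 0" using injD[OF V(5)[OF sV[OF q]], of ?X 0] unfolding \<rho>_def by simp
    then show ?thesis by simp
  qed
  \<comment> \<open>Used for f = J and f = P. A self-adjoint f that H carries to a self-adjoint f'
    commutes with s, hence with its root.\<close>
  have \<rho>C: "\<rho> q *v f y = f (\<rho> q *v y)"
    if q: "q \<in> S3" and f: "linear f" "\<And>y z. G q0 (f y) z = G q0 y (f z)" "\<And>y. f' (H q *v y) = H q *v f y"
      "\<And>y z. G q (f' y) z = G q y (f' z)" for f f' q y
  proof -
    have q2: "q \<in> S2" using q S3(3) by blast
    have "s q *v f y = f (s q *v y)" for y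
      by (rule eq0) (simp add: s[OF q2] f(2,4) f(3)[symmetric])
    then have "s q ** matrix f = matrix f ** s q"
      by (simp add: matrix_eq matrix_vector_mul_assoc[symmetric] matrix_works f(1))
    from commute[OF q this] have "\<rho> q *v (matrix f *v y) = matrix f *v (\<rho> q *v y)"
      by (simp add: matrix_vector_mul_assoc)
    then show ?thesis by (simp add: matrix_works f(1))
  qed
  \<comment> \<open>The adjoint of \<rho> is a second root of s. The difference X of the two
    satisfies \<open>\<rho> X + X \<tau> = 0\<close>, and close to q0, where both are the identity,
    this forces X = 0. So \<rho> is self-adjoint.\<close>
  define \<tau> where "\<tau> q = Gi ** (Finite_Cartesian_Product.transpose (\<rho> q) ** gram (G q0))" for q
  have \<tau>: "G q0 (\<tau> q *v y) z = G q0 y (\<rho> q *v z)" for q y z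
    unfolding \<tau>_def by (simp only: matrix_vector_mul_assoc[symmetric] Gi_inner tr gi[OF q0])
  have \<tau>0: "\<tau> q0 = ?I" unfolding matrix_eq using \<tau>[of q0] \<rho>0 by (auto intro: eq0)
  have sm\<tau>: "smooth_on \<tau> S3"
    unfolding \<tau>_def
    by (intro smooth_on_bilinear[OF _ bounded_bilinear_matrix_mult] smooth_on_const sm\<rho> S3(1)
        smooth_on_bounded_linear[OF _ bounded_linear_transpose])
  obtain S4 where S4: "open S4" "q0 \<in> S4" "S4 \<subseteq> S3" and inj4: "\<And>q. q \<in> S4 \<Longrightarrow> inj (\<lambda>X. \<rho> q ** X + X ** \<tau> q)"
  proof (rule open_inj[OF S3(1,2), of "\<lambda>q X. \<rho> q ** X + X ** \<tau> q"])
    show "linear (\<lambda>X. \<rho> q ** X + X ** \<tau> q)" for q by (intro linear_compose_add linear_matrix_mult)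
    show "continuous_on S3 (\<lambda>q. \<rho> q ** X + X ** \<tau> q)" for X
      by (intro continuous_intros matrix_mult.continuous_on smooth_on_continuous_on sm\<rho> sm\<tau>)
    show "inj (\<lambda>X. \<rho> q0 ** X + X ** \<tau> q0)"
      unfolding \<rho>0 \<tau>0 matrix_mul_lid matrix_mul_rid scaleR_2[symmetric] by (rule injI) simp
  qed blast
  have \<rho>_sym: "G q0 (\<rho> q *v y) z = G q0 y (\<rho> q *v z)" if q: "q \<in> S4" for q y z
  proof -
    have q3: "q \<in> S3" "q \<in> S2" using q S4(3) S3(3) by auto
    have "G q0 ((\<tau> q ** \<tau> q) *v y) z = G q0 (s q *v y) z" for y z
    proof -
      have "G q0 ((\<tau> q ** \<tau> q) *v y) z = G q0 y (s q *v z)"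
        by (simp add: matrix_vector_mul_assoc[symmetric] \<tau> \<rho>\<rho>[OF q3(1), symmetric])
      also have "\<dots> = G q0 (s q *v z) y" by (rule sym[OF q0])
      also have "\<dots> = G q0 (s q *v y) z" unfolding s[OF q3(2)] by (rule sym) (use q3 S2S in auto)
      finally show ?thesis .
    qed
    then have \<tau>\<tau>: "\<tau> q ** \<tau> q = s q" unfolding matrix_eq by (blast intro: eq0)
    let ?X = "\<rho> q - \<tau> q"
    have "\<rho> q ** ?X + ?X ** \<tau> q = \<rho> q ** 0 + 0 ** \<tau> q"
      using \<rho>\<rho>[OF q3(1)] \<tau>\<tau> by (simp add: matrix_mult.diff_left matrix_mult.diff_right)
    then have "?X = 0" using injD[OF inj4[OF q], of ?X 0] by simp
    then show ?thesis using \<tau>[of q y z] by simp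
  qed
  obtain S5 where S5: "open S5" "q0 \<in> S5" "S5 \<subseteq> S4" and inj5: "\<And>q. q \<in> S5 \<Longrightarrow> inj (\<lambda>X :: real^4^4. X ** \<rho> q)"
  proof (rule open_inj[OF S4(1,2), of "\<lambda>q X :: real^4^4. X ** \<rho> q"])
    show "continuous_on S4 (\<lambda>q. X ** \<rho> q)" for X :: "real^4^4"
      by (rule continuous_on_subset[OF _ S4(3)])
        (intro smooth_on_continuous_on smooth_on_bilinear[OF S3(1) bounded_bilinear_matrix_mult] smooth_on_const sm\<rho>)
    show "inj (\<lambda>X :: real^4^4. X ** \<rho> q0)" unfolding \<rho>0 by (auto intro: injI)
    show "linear (\<lambda>X :: real^4^4. X ** \<rho> q)" for q by (rule linear_matrix_mult)
  qed (rule that)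
  have S5S: "q \<in> S4" "q \<in> S3" "q \<in> S2" "q \<in> S1" "q \<in> S" if "q \<in> S5" for q
    using that S5(3) S4(3) S3(3) S2(3) S1(3) by blast+
  have surj: "surj (\<lambda>X :: real^4^4. X ** \<rho> q)" if "q \<in> S5" for q
    using linear_injective_imp_surjective[OF linear_matrix_mult(1) inj5[OF that]] by simp
  have "\<exists>N. N ** \<rho> q = ?I" if "q \<in> S5" for q using surj[OF that] unfolding surj_def by metis
  then obtain N where N: "\<And>q. q \<in> S5 \<Longrightarrow> N q ** \<rho> q = ?I" by metis
  have N': "\<rho> q ** N q = ?I" if "q \<in> S5" for q using N[OF that] matrix_left_right_inverse by blast
  have Nv: "N q *v (\<rho> q *v y) = y" "\<rho> q *v (N q *v y) = y" if "q \<in> S5" for q y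
    using N[OF that] N'[OF that] by (simp_all add: matrix_vector_mul_assoc)
  \<comment> \<open>The isometric factor in the polar decomposition
    \<open>H = F \<rho>\<close>.\<close>
  define F where "F q = H q ** N q" for q
  have F: "F q *v y = H q *v (N q *v y)" for q y unfolding F_def by (simp add: matrix_vector_mul_assoc)
  have F\<rho>: "F q ** \<rho> q = H q" if "q \<in> S5" for q
    unfolding F_def by (simp add: matrix_mul_assoc[symmetric] N[OF that])
  have smF: "smooth_on F S5"
  proof (rule smooth_on_op_solve[OF S5(1) linear_matrix_mult(1) inj5 _ _ F\<rho>])
    have "smooth_on \<rho> S5" by (rule smooth_on_subset[OF sm\<rho>]) (use S5S in blast)
    then show "smooth_on (\<lambda>q. X ** \<rho> q) S5" for X :: "real^4^4"
      by (rule smooth_on_bilinear[OF S5(1) bounded_bilinear_matrix_mult smooth_on_const])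
    show "smooth_on H S5" by (rule smooth_on_subset[OF smH]) (use S5S in blast)
  qed
  have GF: "G q (F q *v y) (F q *v z) = G q0 y z" if q: "q \<in> S5" for q y z
  proof -
    have "G q (F q *v y) (F q *v z) = G q0 (s q *v (N q *v y)) (N q *v z)"
      unfolding F by (rule s[OF S5S(3)[OF q], symmetric])
    also have "\<dots> = G q0 y z"
      unfolding \<rho>\<rho>[OF S5S(2)[OF q], symmetric] matrix_vector_mul_assoc[symmetric] \<rho>_sym[OF S5S(1)[OF q]] Nv[OF q] ..
    finally show ?thesis .
  qed
  have NC: "N q *v f y = f (N q *v y)" if q: "q \<in> S5" and c: "\<And>y. \<rho> q *v f y = f (\<rho> q *v y)" for q f y
    using c[of "N q *v y"] Nv[OF q] by metis
  have JF: "J q (F q *v y) = F q *v J q0 y" if q: "q \<in> S5" for q y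
    unfolding F JH[OF S5S(3)[OF q]] NC[where f = "J q0", OF q \<rho>C[OF S5S(2)[OF q] linJ[OF q0] G_J[OF q0] JH[OF S5S(3)[OF q]] G_J[OF S5S(5)[OF q]]]] ..
  have PF: "P q (F q *v y) = F q *v P q0 y" if q: "q \<in> S5" for q y
    unfolding F PH[OF S5S(3)[OF q]] NC[where f = "P q0", OF q \<rho>C[OF S5S(2)[OF q] linP[OF q0] G_P[OF q0] PH[OF S5S(3)[OF q]] G_P[OF S5S(5)[OF q]]]] ..
  \<comment> \<open>F respects the projections P, so \<open>F e0\<close> lies on the line of e0. Its
    length fixes it up to sign, and the quadratic Jacobi operator does not see the sign.\<close>
  have jF: "jacobi (R q) (F q *v e0) y = J q y" if q: "q \<in> S5" for q y
  proof -
    have "P q0 e0 = e0" unfolding P_def e0 by simp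
    then have "F q *v e0 = P q (F q *v e0)" using PF[OF q, of e0] by simp
    then obtain r where r: "F q *v e0 = r *\<^sub>R e0" unfolding P_def by blast
    have "r * r * G q e0 e0 = - 1"
      using GF[OF q, of e0 e0] e0 unfolding r
      by (simp add: bilinear_lmul[OF bil[OF S5S(5)[OF q]]] bilinear_rmul[OF bil[OF S5S(5)[OF q]]])
    then have "r * r = - 1 / G q e0 e0" using neg[OF S5S(4)[OF q]] by (simp add: field_simps)
    moreover have "jacobi (R q) (r *\<^sub>R e0) y = (r * r) *\<^sub>R jacobi (R q) e0 y"
      by (rule jacobi_scale) (use linR S5S(5)[OF q] in blast)
    ultimately show ?thesis unfolding r J_def jacobi_def by simp
  qed
  show thesis
  proof (rule that[of S5 F])
    show "S5 \<subseteq> S" using S5S by blast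
    show "smooth_on (\<lambda>q. F q *v y) S5" for y
    proof -
      have "bounded_linear (\<lambda>M :: real^4^4. M *v y)"
        unfolding linear_conv_bounded_linear[symmetric]
        by (rule linearI) (simp_all add: matrix_vector_mult_add_rdistrib scaleR_matrix_vector_assoc)
      from smooth_on_bounded_linear[OF S5(1) this smF] show ?thesis .
    qed
    show "jacobi (R q) (F q *v e0) (F q *v y) = F q *v jacobi (R q0) e0 y" if "q \<in> S5" for q y
      unfolding jF[OF that] JF[OF that] J0 ..
  qed (use S5 GF in auto)
qed

lemma local_frame:
  obtains S' f E where "open S'" "q0 \<in> S'" "S' \<subseteq> S" "\<And>i. smooth_on (\<lambda>q. f q i) S'"
    "\<And>q. q \<in> S' \<Longrightarrow> orthonormal (G q) (f q)"
    "\<And>q i j. q \<in> S' \<Longrightarrow> lower (G q) (R q) (f q i) (f q 0) (f q 0) (f q j) = E i j"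
proof -
  obtain e where e: "orthonormal (G q0) e" using orthonormal_exists[OF sig[OF q0]] by blast
  then have "G q0 (e 0) (e 0) = - 1" unfolding orthonormal_def by simp
  from local_isometry[OF this] obtain S' F where S': "open S'" "q0 \<in> S'" "S' \<subseteq> S" "\<And>y. smooth_on (\<lambda>q. F q *v y) S'"
    and F: "\<And>q y z. q \<in> S' \<Longrightarrow> G q (F q *v y) (F q *v z) = G q0 y z"
    "\<And>q y. q \<in> S' \<Longrightarrow> jacobi (R q) (F q *v e 0) (F q *v y) = F q *v (jacobi (R q0) (e 0) y)" by metis
  show thesis
  proof (rule that[of S' "\<lambda>q i. F q *v e i" "\<lambda>i j. G q0 (jacobi (R q0) (e 0) (e i)) (e j)"])
    show "lower (G q) (R q) (F q *v e i) (F q *v e 0) (F q *v e 0) (F q *v e j) = G q0 (jacobi (R q0) (e 0) (e i)) (e j)"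
      if "q \<in> S'" for q i j
      using F[OF that] unfolding lower_def jacobi_def by metis
  qed (use S' F e in \<open>auto simp: orthonormal_def\<close>)
qed

end

end

section \<open>The local normal form of the curvature\<close>

text \<open>For h = - 1 three vectors are reversed. This changes the orientation and thereby
  exchanges the two halves of the Weyl tensor.\<close>

definition half_frame :: "real \<Rightarrow> (4 \<Rightarrow> coord) \<Rightarrow> 4 \<Rightarrow> coord" where
  "half_frame h e = frame4 (e 0) (h *\<^sub>R e 1) (h *\<^sub>R e 2) (h *\<^sub>R e 3)"

lemma orthonormal_half_frame:
  assumes b: "metric_at b" and e: "orthonormal b e" and h: "h = 1 \<or> h = - 1"
  shows "orthonormal b (half_frame h e)"
proof -
  have "h * h = 1" using h by auto
  then show ?thesis
    unfolding half_frame_def orthonormal_iff[OF sym_b[OF b e]] by (simp add: b_simps[OF b e])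
qed

text \<open>In an orthonormal frame the matrices of the three endomorphisms depend on h only, so the
  curvature components are constants of h, l and m, the same at all points.\<close>

lemma cliff_components_const:
  assumes b: "metric_at b" and e: "orthonormal b e" and b': "metric_at b'" and e': "orthonormal b' e'"
    and h: "h = 1 \<or> h = - 1" and l: "l 0 = 0"
  shows "lower b (cliff_curvature b (frame_cliff b (half_frame h e)) l m) (e i) (e j) (e k) (e n)
    = lower b' (cliff_curvature b' (frame_cliff b' (half_frame h e')) l m) (e' i) (e' j) (e' k) (e' n)"
proof -
  have "c (frame_cliff c (half_frame h a) N (a i)) (a j) = (let d = (\<lambda>i j. if i = j then eps i else 0) in
     if N = 1 then h * d i 1 * d 0 j - h * d i 0 * d 1 j + d i 3 * d 2 j - d i 2 * d 3 j
     else if N = 2 then h * d i 2 * d 0 j + d i 3 * d 1 j - h * d i 0 * d 2 j - d i 1 * d 3 j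
     else h * d i 3 * d 0 j - d i 2 * d 1 j + d i 1 * d 2 j - h * d i 0 * d 3 j)"
    if c: "metric_at c" and a: "orthonormal c a" for c a i j N
  proof -
    have o: "c (a i) (a j) = (if i = j then eps i else 0)" for i j
      using a unfolding orthonormal_def by blast
    note bil = bilin_b[OF c a]
    note bs = bilinear_ladd[OF bil] bilinear_radd[OF bil] bilinear_lsub[OF bil] bilinear_rsub[OF bil]
      bilinear_lmul[OF bil] bilinear_rmul[OF bil] bilinear_lneg[OF bil] bilinear_rneg[OF bil]
    \<comment> \<open>Two reversed vectors contribute \<open>h * h = 1\<close>, so h survives only
      in the terms with \<open>a 0\<close>.\<close>
    have "c (frame_cliff c (half_frame h a) N (a i)) (a j) =
      (if N = 1 then h * c (a i) (a 1) * c (a 0) (a j) - h * c (a i) (a 0) * c (a 1) (a j) + c (a i) (a 3) * c (a 2) (a j) - c (a i) (a 2) * c (a 3) (a j)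
       else if N = 2 then h * c (a i) (a 2) * c (a 0) (a j) + c (a i) (a 3) * c (a 1) (a j) - h * c (a i) (a 0) * c (a 2) (a j) - c (a i) (a 1) * c (a 3) (a j)
       else h * c (a i) (a 3) * c (a 0) (a j) - c (a i) (a 2) * c (a 1) (a j) + c (a i) (a 1) * c (a 2) (a j) - h * c (a i) (a 0) * c (a 3) (a j))"
      unfolding frame_cliff_def half_frame_def frame4_simps
      by (rule disjE[OF h]) (simp_all add: bs)
    then show ?thesis unfolding o Let_def .
  qed
  note w = this[OF b e] this[OF b' e']
  show ?thesis
    unfolding lower_cliff_curvature[where l = l, OF b orthonormal_half_frame[OF b e h] l]
      lower_cliff_curvature[where l = l, OF b' orthonormal_half_frame[OF b' e' h] l]
    by (simp only: Let_def w)
qed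

lemma curvature_eqI:
  assumes "metric_at b" "lower b R x y z = lower b R' x y z"
  shows "R x y z = R' x y z"
  using assms metric_eqI[of b "R x y z" "R' x y z"] unfolding lower_def metric_at_def by metis

context metric_chart
begin

text \<open>The classification gives a sign h at each point, and it has to be made constant near q0.
  If both signs yield the same components, any choice is right; otherwise some component separates
  them, and its continuity keeps the sign of q0 on a neighborhood.\<close>

lemma local_cliff:
  fixes R :: "coord \<Rightarrow> curv"
  assumes q0: "q0 \<in> S" and alg: "\<And>q. q \<in> S \<Longrightarrow> alg_curv (lower (G q) (R q))"
    and smR: "\<And>x y z. smooth_on (\<lambda>q. R q x y z) S"
    and sim: "\<And>q q' x x'. q \<in> S \<Longrightarrow> q' \<in> S \<Longrightarrow> G q x x = - 1 \<Longrightarrow> G q' x' x' = - 1 \<Longrightarrow>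
      similar_endo (jacobi (R q) x) (jacobi (R q') x')"
  obtains S' f l m where "open S'" "q0 \<in> S'" "S' \<subseteq> S" "\<And>i. smooth_on (\<lambda>q. f q i) S'"
    "\<And>q. q \<in> S' \<Longrightarrow> orthonormal (G q) (f q)" "l 0 = 0"
    "\<And>q x y z. q \<in> S' \<Longrightarrow> R q x y z = cliff_curvature (G q) (frame_cliff (G q) (f q)) l m x y z"
    "(\<And>y. ricci (G q0) (lower (G q0) (R q0)) y y = 0) \<Longrightarrow> - l 1 + l 2 + l 3 = 0"
proof -
  obtain S1 f E where S1: "open S1" "q0 \<in> S1" "S1 \<subseteq> S"
    and smf: "\<And>i. smooth_on (\<lambda>q. f q i) S1" and of: "\<And>q. q \<in> S1 \<Longrightarrow> orthonormal (G q) (f q)"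
    and E: "\<And>q i j. q \<in> S1 \<Longrightarrow> lower (G q) (R q) (f q i) (f q 0) (f q 0) (f q j) = E i j"
    apply (rule local_frame[OF q0, of R])
       apply (erule alg)
      apply (rule smR)
     apply (rule sim; assumption)
    apply (rule that; assumption)
    done
  let ?T = "\<lambda>q. lower (G q) (R q)" and ?l = "diag_coeff E" and ?m = "off_coeff E"
  let ?C = "\<lambda>h q. lower (G q) (cliff_curvature (G q) (frame_cliff (G q) (half_frame h (f q))) ?l ?m)"
  have l0: "?l 0 = 0" by (simp add: diag_coeff_def)
  have S1S: "q \<in> S" if "q \<in> S1" for q using that S1(3) by blast
  note met = metric_at[OF S1S] and T = alg[OF S1S]
  have C_alg: "alg_curv (?C h q)" if "q \<in> S1" "h = 1 \<or> h = - 1" for h q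
    by (rule alg_curv_cliff_curvature[OF met[OF that(1)] orthonormal_half_frame[OF met[OF that(1)] of[OF that(1)] that(2)], of ?l, OF l0])
  have ex: "\<exists>h. (h = 1 \<or> h = - 1) \<and> ?T q = ?C h q" if q: "q \<in> S1" for q
  proof -
    have n1: "(\<Sum>i\<in>UNIV. eps i * ?T q (e i) v v (e i)) = 0" if "G q v v = 0" "orthonormal (G q) e" for v e
      by (rule null_traces(1)[OF met[OF q] T[OF q] sim[OF S1S[OF q] S1S[OF q]] that(2,1)])
    have n2: "(\<Sum>i\<in>UNIV. \<Sum>j\<in>UNIV. eps i * eps j * (?T q (e i) v v (e j))\<^sup>2) = 0" if "G q v v = 0" "orthonormal (G q) e" for v e
      by (rule null_traces(2)[OF met[OF q] T[OF q] sim[OF S1S[OF q] S1S[OF q]] that(2,1)])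
    show ?thesis
      by (rule curvature_classification[OF met[OF q] of[OF q] T[OF q] n1 n2])
        (auto simp: E[OF q] half_frame_def)
  qed
  define comp where "comp h i j k n = ?C h q0 (f q0 i) (f q0 j) (f q0 k) (f q0 n)" for h i j k n
  have comp: "?C h q (f q i) (f q j) (f q k) (f q n) = comp h i j k n" if "q \<in> S1" "h = 1 \<or> h = - 1" for h q i j k n
    unfolding comp_def by (rule cliff_components_const[where l = ?l, OF met[OF that(1)] of[OF that(1)] met[OF S1(2)] of[OF S1(2)] that(2) l0])
  obtain h where h: "h = 1 \<or> h = - 1" and h0: "?T q0 = ?C h q0" using ex[OF S1(2)] by blast
  have "\<exists>S2. open S2 \<and> q0 \<in> S2 \<and> S2 \<subseteq> S1 \<and> (\<forall>q\<in>S2. ?T q = ?C h q)"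
  proof (cases "\<forall>i j k n. comp h i j k n = comp (- h) i j k n")
    case True
    have "?T q = ?C h q" if q: "q \<in> S1" for q
    proof -
      obtain h' where h': "h' = 1 \<or> h' = - 1" "?T q = ?C h' q" using ex[OF q] by blast
      have "h' = h \<or> h' = - h" using h h'(1) by auto
      then have eq: "comp h' i j k n = comp h i j k n" for i j k n using True by metis
      have "?T q (f q i) (f q j) (f q k) (f q n) = ?C h q (f q i) (f q j) (f q k) (f q n)" for i j k n
        unfolding h'(2) comp[OF q h'(1)] comp[OF q h] by (rule eq)
      then show ?thesis
        by (intro ext, rule alg_curv_eqI[OF met[OF q] of[OF q] T[OF q] C_alg[OF q h]])
    qed
    then show ?thesis using S1 by blast
  next
    case False
    then obtain i j k n where ne: "comp h i j k n \<noteq> comp (- h) i j k n" by blast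
    let ?t = "\<lambda>q. G q (R q (f q i) (f q j) (f q k)) (f q n)"
    have lin: "linear (R q x y)" "linear (\<lambda>y. R q x y z)" "linear (\<lambda>x. R q x y z)" if "q \<in> S1" for q x y z
      by (rule linear_curvature[OF met[OF that] T[OF that]])+
    have linG: "linear (G q x)" "linear (\<lambda>x. G q x y)" if "q \<in> S1" for q x y
      using bil[OF S1S[OF that]] unfolding bilinear_def by blast+
    have 1: "smooth_on (\<lambda>q. R q (f q i) y z) S1" for y z
      by (rule smooth_on_linear_apply[OF S1(1) lin(3) smooth_on_subset[OF smR S1(3)] smf])
    have 2: "smooth_on (\<lambda>q. R q (f q i) (f q j) z) S1" for z
      by (rule smooth_on_linear_apply[where h = "\<lambda>q y. R q (f q i) y z", OF S1(1) lin(2) 1 smf])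
    have 3: "smooth_on (\<lambda>q. R q (f q i) (f q j) (f q k)) S1"
      by (rule smooth_on_linear_apply[where h = "\<lambda>q. R q (f q i) (f q j)", OF S1(1) lin(1) 2 smf])
    have 4: "smooth_on (\<lambda>q. G q (R q (f q i) (f q j) (f q k)) y) S1" for y
      by (rule smooth_on_linear_apply[where h = "\<lambda>q x. G q x y", OF S1(1) linG(2) smooth_on_subset[OF smooth S1(3)] 3])
    have "smooth_on ?t S1"
      by (rule smooth_on_linear_apply[OF S1(1) linG(1) 4 smf])
    then have cont: "continuous_on S1 ?t" by (rule smooth_on_continuous_on)
    \<comment> \<open>The component takes at most two values, so avoiding the value for - h is an
      open condition that leaves only h.\<close>
    define S2 where "S2 = S1 \<inter> ?t -` (- {comp (- h) i j k n})"
    have "open S2" unfolding S2_def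
      by (rule continuous_open_preimage[OF cont S1(1)]) (simp add: open_Compl)
    moreover have "?t q0 = comp h i j k n"
      using h0 comp[OF S1(2) h, of i j k n] unfolding lower_def by metis
    then have "q0 \<in> S2" using ne S1(2) unfolding S2_def by simp
    moreover have "?T q = ?C h q" if q: "q \<in> S2" for q
    proof -
      have q1: "q \<in> S1" using q unfolding S2_def by blast
      obtain h' where h': "h' = 1 \<or> h' = - 1" "?T q = ?C h' q" using ex[OF q1] by blast
      have "?t q = comp h' i j k n"
        using h'(2) comp[OF q1 h'(1), of i j k n] unfolding lower_def by metis
      then have "h' \<noteq> - h" using q unfolding S2_def by auto
      then have "h' = h" using h h'(1) by auto
      then show ?thesis using h'(2) by simp
    qed
    ultimately show ?thesis unfolding S2_def by blast
  qed
  then obtain S2 where S2: "open S2" "q0 \<in> S2" "S2 \<subseteq> S1" "\<And>q. q \<in> S2 \<Longrightarrow> ?T q = ?C h q" by blast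
  show thesis
  proof (rule that[of S2 "\<lambda>q. half_frame h (f q)" ?l ?m])
    show "smooth_on (\<lambda>q. half_frame h (f q) i) S2" for i
    proof -
      have "smooth_on (\<lambda>q. h *\<^sub>R f q i) S2" "smooth_on (\<lambda>q. f q i) S2" for i
        by (intro smooth_on_scaleR smooth_on_const smooth_on_subset[OF smf] S2)+
      then show ?thesis unfolding half_frame_def frame4_def
        by (cases "i = 0"; cases "i = 1"; cases "i = 2") simp_all
    qed
    show "orthonormal (G q) (half_frame h (f q))" if "q \<in> S2" for q
      using that S2(3) by (intro orthonormal_half_frame met of h) auto
    show "R q x y z = cliff_curvature (G q) (frame_cliff (G q) (half_frame h (f q))) ?l ?m x y z" if "q \<in> S2" for q x y z
      by (rule curvature_eqI[OF met]) (use S2(3,4) that in auto)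
    \<comment> \<open>The Ricci tensor on \<open>f q0 0\<close> is minus the trace of its Jacobi
      operator, and that trace is three times the left-hand side.\<close>
    show "- ?l 1 + ?l 2 + ?l 3 = 0" if ric: "\<And>y. ricci (G q0) (?T q0) y y = 0"
    proof -
      let ?t = "\<lambda>i. ?T q0 (f q0 i) (f q0 0) (f q0 0) (f q0 i)"
      have a: "?T q0 (f q0 i) (f q0 0) (f q0 i) (f q0 0) = - ?t i" for i
        by (rule alg_curvD(3)[OF T[OF S1(2)]])
      have "- ?t 0 - ?t 1 + ?t 2 + ?t 3 = 0"
        using ric[of "f q0 0"] a[of 0] a[of 1] a[of 2] a[of 3]
        unfolding ricci_frame[OF met[OF S1(2)] of[OF S1(2)] T[OF S1(2)]] sum_4' eps_simps by linarith
      moreover have "?t 0 = 0" by (rule T_alt(1)[OF T[OF S1(2)]])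
      ultimately show ?thesis by (simp add: E[OF S1(2)] diag_coeff_def)
    qed
  qed (use S2 S1 l0 in auto)
qed

end

section \<open>Charts\<close>

lemma cliff_curvature_natural:
  assumes F: "linear F" "\<And>x y. b (F x) (F y) = b' x y" "\<And>i x. \<phi> i (F x) = F (\<phi>' i x)"
  shows "cliff_curvature b \<phi> l m (F x) (F y) (F z) = F (cliff_curvature b' \<phi>' l m x y z)"
proof -
  have 0: "R_zero b (F x) (F y) (F z) = F (R_zero b' x y z)"
    by (simp add: R_zero_def F(2) linear_diff[OF F(1)] linear_cmul[OF F(1)])
  have 1: "R_skew b \<psi> (F x) (F y) (F z) = F (R_skew b' \<psi>' x y z)" if "\<And>x. \<psi> (F x) = F (\<psi>' x)" for \<psi> \<psi>'
    by (simp add: R_skew_def that F(2) linear_diff[OF F(1)] linear_cmul[OF F(1)])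
  have 2: "R_skew b (\<phi> i) (F x) (F y) (F z) = F (R_skew b' (\<phi>' i) x y z)" for i
    by (rule 1) (rule F(3))
  have "R_skew b (\<lambda>u. \<phi> i u - \<phi> j u) (F x) (F y) (F z) = F (R_skew b' (\<lambda>u. \<phi>' i u - \<phi>' j u) x y z)" for i j
    by (rule 1) (simp add: F(3) linear_diff[OF F(1)])
  then show ?thesis
    unfolding cliff_curvature_def
    by (simp add: 0 2 linear_add[OF F(1)] linear_diff[OF F(1)] linear_cmul[OF F(1)] linear_sum[OF F(1)]
        split_beta)
qed

locale manifold_2_2 =
  fixes X :: "'m topology" and A :: "'m chart set" and g :: "'m bilin_field"
  assumes manifold: "smooth_manifold X A" and metric: "metric_2_2 A g"
begin

lemma chart_openin: "c \<in> A \<Longrightarrow> openin X (fst c)"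
  and chart_open: "c \<in> A \<Longrightarrow> open (snd c ` fst c)"
  using manifold unfolding smooth_manifold_def is_chart_def by blast+

lemma chart_homeomorphic:
  "c \<in> A \<Longrightarrow> homeomorphic_map (subtopology X (fst c)) (top_of_set (snd c ` fst c)) (snd c)"
  using manifold unfolding smooth_manifold_def is_chart_def by blast

lemma topspace_chart: "c \<in> A \<Longrightarrow> topspace (subtopology X (fst c)) = fst c"
  by (rule topspace_subtopology_subset[OF openin_subset[OF chart_openin]])

lemma chart_inj: "c \<in> A \<Longrightarrow> inj_on (snd c) (fst c)"
  using homeomorphic_imp_injective_map[OF chart_homeomorphic] topspace_chart by metis

lemma point_at [simp]: "c \<in> A \<Longrightarrow> p \<in> fst c \<Longrightarrow> point_at c (snd c p) = p"
  unfolding point_at_def by (rule inv_into_f_f[OF chart_inj])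

lemma image_ofE:
  assumes "c \<in> A" "q \<in> image_of c U"
  obtains "point_at c q \<in> U" "point_at c q \<in> fst c" "snd c (point_at c q) = q"
  using assms unfolding image_of_def by auto

lemma image_of_subset: "image_of c U \<subseteq> snd c ` fst c"
  unfolding image_of_def by blast

lemma open_image_of:
  assumes c: "c \<in> A" and U: "openin X U"
  shows "open (image_of c U)"
proof -
  have "openin (subtopology X (fst c)) (U \<inter> fst c)"
    using U by (auto simp: openin_subtopology)
  then have "openin (top_of_set (snd c ` fst c)) (snd c ` (U \<inter> fst c))"
    using homeomorphic_imp_open_map[OF chart_homeomorphic[OF c]] unfolding open_map_def by blast
  then show ?thesis unfolding image_of_def using openin_open_trans chart_open[OF c] by blast
qed

lemma openin_chart_vimage:
  assumes c: "c \<in> A" and S: "open S"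
  shows "openin X {p \<in> fst c. snd c p \<in> S}"
proof -
  have "continuous_map (subtopology X (fst c)) (top_of_set (snd c ` fst c)) (snd c)"
    by (rule homeomorphic_imp_continuous_map[OF chart_homeomorphic[OF c]])
  moreover have "openin (top_of_set (snd c ` fst c)) (snd c ` fst c \<inter> S)"
    using S by (rule openin_open_Int)
  ultimately have "openin (subtopology X (fst c)) {p \<in> topspace (subtopology X (fst c)). snd c p \<in> snd c ` fst c \<inter> S}"
    by (rule openin_continuous_map_preimage)
  then have "openin (subtopology X (fst c)) {p \<in> fst c. snd c p \<in> snd c ` fst c \<inter> S}"
    unfolding topspace_chart[OF c] .
  moreover have "{p \<in> fst c. snd c p \<in> snd c ` fst c \<inter> S} = {p \<in> fst c. snd c p \<in> S}" by auto
  ultimately show ?thesis using openin_open_subtopology[OF chart_openin[OF c]] by (simp only:)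
qed

lemma smooth_transition: "c \<in> A \<Longrightarrow> d \<in> A \<Longrightarrow> smooth_on (transition c d) (image_of c (fst d))"
  using manifold unfolding smooth_manifold_def by blast

lemma transition_chart [simp]: "c \<in> A \<Longrightarrow> p \<in> fst c \<Longrightarrow> transition c d (snd c p) = snd d p"
  by (simp add: transition_def)

lemma mem_image_of: "p \<in> U \<Longrightarrow> p \<in> fst c \<Longrightarrow> snd c p \<in> image_of c U"
  unfolding image_of_def by blast

lemma transition_derivative:
  assumes "c \<in> A" "d \<in> A" "p \<in> fst c" "p \<in> fst d"
  shows "(transition c d has_derivative change c d p) (at (snd c p))"
  unfolding change_def
  by (rule smooth_on_has_derivative[OF smooth_transition[OF assms(1,2)] mem_image_of[OF assms(4,3)]])

lemma linear_change:
  assumes "c \<in> A" "d \<in> A" "p \<in> fst c" "p \<in> fst d"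
  shows "linear (change c d p)"
  using transition_derivative[OF assms] has_derivative_linear by blast

text \<open>The chain rule in the form of a cocycle identity; it makes fields transported from a
  single chart consistent.\<close>

lemma change_change:
  assumes c: "c \<in> A" "p \<in> fst c" and d: "d \<in> A" "p \<in> fst d" and e: "e \<in> A" "p \<in> fst e"
  shows "change d e p (change c d p x) = change c e p x"
proof -
  let ?S = "image_of c (fst d \<inter> fst e)"
  have "openin X (fst d \<inter> fst e)" using chart_openin d e by blast
  then have S: "open ?S" by (rule open_image_of[OF c(1)])
  have q: "snd c p \<in> ?S" using c d e by (simp add: mem_image_of)
  have "((\<lambda>q. transition d e (transition c d q)) has_derivative (\<lambda>x. change d e p (change c d p x))) (at (snd c p))"
    using has_derivative_compose[OF transition_derivative[OF c(1) d(1) c(2) d(2)]] transition_derivative[OF d(1) e(1) d(2) e(2)]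
      transition_chart[OF c] by simp
  then have "(transition c e has_derivative (\<lambda>x. change d e p (change c d p x))) (at (snd c p))"
  proof (rule has_derivative_transform_within_open[OF _ S q])
    fix q assume "q \<in> ?S"
    then obtain r where "r \<in> fst c" "r \<in> fst d" "q = snd c r" unfolding image_of_def by blast
    then show "transition d e (transition c d q) = transition c e q" using c d e by simp
  qed
  then show ?thesis
    using has_derivative_unique[OF transition_derivative[OF c(1) e(1) c(2) e(2)]] by metis
qed

lemma change_self:
  assumes c: "c \<in> A" "p \<in> fst c"
  shows "change c c p x = x"
proof -
  have "((\<lambda>q. q) has_derivative (\<lambda>x. x)) (at (snd c p))" by (rule has_derivative_ident)
  then have "(transition c c has_derivative (\<lambda>x. x)) (at (snd c p))"
  proof (rule has_derivative_transform_within_open[OF _ chart_open[OF c(1)]])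
    show "snd c p \<in> snd c ` fst c" using c by blast
    show "q = transition c c q" if "q \<in> snd c ` fst c" for q using that c by auto
  qed
  then show ?thesis using has_derivative_unique[OF transition_derivative[OF c(1,1,2,2)]] by metis
qed

lemma change_inverse:
  assumes "c \<in> A" "p \<in> fst c" "d \<in> A" "p \<in> fst d"
  shows "change d c p (change c d p x) = x"
  by (simp add: change_change[OF assms assms(1,2)] change_self[OF assms(1,2)])

lemma metric_change:
  assumes "c \<in> A" "d \<in> A" "p \<in> fst c" "p \<in> fst d"
  shows "g d p (change c d p x) (change c d p y) = g c p x y"
  using metric assms unfolding metric_2_2_def by blast

lemma metric_at_chart: "c \<in> A \<Longrightarrow> p \<in> fst c \<Longrightarrow> metric_at (g c p)"
  using metric unfolding metric_2_2_def metric_at_def by blast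

abbreviation metric_in :: "'m chart \<Rightarrow> coord \<Rightarrow> bilin" where
  "metric_in c \<equiv> \<lambda>q. g c (point_at c q)"

lemma metric_chart_subset:
  assumes c: "c \<in> A" and S: "open S" "S \<subseteq> snd c ` fst c"
  shows "metric_chart (metric_in c) S"
proof
  fix q assume "q \<in> S"
  then have "point_at c q \<in> fst c" using S c by auto
  from metric_at_chart[OF c this] show "bilinear (metric_in c q)" "signature_2_2 (metric_in c q)"
    "metric_in c q x y = metric_in c q y x" for x y
    unfolding metric_at_def by auto
next
  show "smooth_on (\<lambda>q. metric_in c q x y) S" for x y
    using metric c smooth_on_subset[OF _ S(2)] unfolding metric_2_2_def by blast
qed (rule S(1))

lemma metric_chart_full: "c \<in> A \<Longrightarrow> metric_chart (metric_in c) (snd c ` fst c)"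
  by (rule metric_chart_subset[OF _ chart_open]) auto

lemma metric_charts_transition:
  assumes c: "c \<in> A" and d: "d \<in> A"
  shows "metric_charts (metric_in c) (image_of c (fst d)) (metric_in d) (snd d ` fst d) (transition c d)"
proof -
  interpret C1: metric_chart "metric_in c" "image_of c (fst d)"
    by (rule metric_chart_subset[OF c open_image_of[OF c chart_openin[OF d]] image_of_subset])
  interpret C2: metric_chart "metric_in d" "snd d ` fst d" by (rule metric_chart_full[OF d])
  show ?thesis
  proof
    fix q assume "q \<in> image_of c (fst d)"
    then obtain p where p: "p \<in> fst c" "p \<in> fst d" "q = snd c p" unfolding image_of_def by blast
    then show "transition c d q \<in> snd d ` fst d" using c by simp
    show "metric_in d (transition c d q) (frechet_derivative (transition c d) (at q) x) (frechet_derivative (transition c d) (at q) y)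
        = metric_in c q x y" for x y
      using metric_change[OF c d p(1,2), of x y] c d p unfolding change_def by simp
  qed (rule smooth_transition[OF c d])
qed

text \<open>What the Riemann and the Weyl tensor have in common, so that both parts of the theorem
  are instances of one construction.\<close>

definition tensor_field :: "'m curv_field \<Rightarrow> bool" where
  "tensor_field K \<longleftrightarrow>
     (\<forall>c\<in>A. \<forall>p\<in>fst c. alg_curv (lower (g c p) (K c p))) \<and>
     (\<forall>c\<in>A. \<forall>x y z. smooth_on (\<lambda>q. K c (point_at c q) x y z) (snd c ` fst c)) \<and>
     (\<forall>c\<in>A. \<forall>d\<in>A. \<forall>p\<in>fst c \<inter> fst d. \<forall>x y z.
        K d p (change c d p x) (change c d p y) (change c d p z) = change c d p (K c p x y z))"

lemma riemann_eq:
  assumes "c \<in> A" "p \<in> fst c"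
  shows "riemann \<sigma> g c p x y z = \<sigma> *\<^sub>R metric_chart.curv (metric_in c) (snd c p) x y z"
  unfolding riemann_def
  using metric_chart.curvature_operator_eq[OF metric_chart_full[OF assms(1)]] assms(2) by simp

lemma tensor_field_riemann: "tensor_field (riemann \<sigma> g)"
  unfolding tensor_field_def
proof (intro conjI ballI allI)
  fix c p assume c: "c \<in> A" and p: "p \<in> fst c"
  interpret metric_chart "metric_in c" "snd c ` fst c" by (rule metric_chart_full[OF c])
  have q: "snd c p \<in> snd c ` fst c" using p by blast
  have gq: "metric_in c (snd c p) = g c p" using c p by simp
  note bil' = bil[OF q, unfolded gq] and sym' = sym[OF q, unfolded gq]
  have l: "lower (g c p) (riemann \<sigma> g c p) x y z v = \<sigma> * g c p (curv (snd c p) x y z) v" for x y z v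
    unfolding lower_def riemann_eq[OF c p] by (simp add: bilinear_lmul[OF bil'])
  show "alg_curv (lower (g c p) (riemann \<sigma> g c p))"
    unfolding alg_curv_def l
  proof (intro conjI allI)
    fix x y z v
    show "linear (\<lambda>x. \<sigma> * g c p (curv (snd c p) x y z) v)"
      by (rule linearI)
        (simp_all add: linear_add[OF linear_curv(3)[OF q]] linear_cmul[OF linear_curv(3)[OF q]]
          bilinear_ladd[OF bil'] bilinear_lmul[OF bil'] algebra_simps)
    show "\<sigma> * g c p (curv (snd c p) x y z) v = - (\<sigma> * g c p (curv (snd c p) y x z) v)"
      by (subst curv_antisym) (simp add: bilinear_lneg[OF bil'])
    show "\<sigma> * g c p (curv (snd c p) x y z) v = - (\<sigma> * g c p (curv (snd c p) x y v) z)"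
      using curv_skew[OF q, of x y z v] sym'[of z "curv (snd c p) x y v"] unfolding gq by simp
    have "g c p (curv (snd c p) x y z + curv (snd c p) y z x + curv (snd c p) z x y) v = 0"
      unfolding curv_bianchi[OF q] by (rule bilinear_lzero[OF bil'])
    then show "\<sigma> * g c p (curv (snd c p) x y z) v + \<sigma> * g c p (curv (snd c p) y z x) v + \<sigma> * g c p (curv (snd c p) z x y) v = 0"
      unfolding bilinear_ladd[OF bil'] distrib_left[symmetric] by simp
  qed
next
  fix c x y z assume c: "c \<in> A"
  interpret metric_chart "metric_in c" "snd c ` fst c" by (rule metric_chart_full[OF c])
  show "smooth_on (\<lambda>q. riemann \<sigma> g c (point_at c q) x y z) (snd c ` fst c)"
  proof (rule smooth_on_cong[OF open_S])
    show "smooth_on (\<lambda>q. \<sigma> *\<^sub>R curv q x y z) (snd c ` fst c)"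
      by (intro smooth_on_scaleR smooth_on_const smooth_curv open_S)
  qed (use c in \<open>auto simp: riemann_eq\<close>)
next
  fix c d p x y z assume c: "c \<in> A" and d: "d \<in> A" and "p \<in> fst c \<inter> fst d"
  then have p: "p \<in> fst c" "p \<in> fst d" by auto
  interpret metric_charts "metric_in c" "image_of c (fst d)" "metric_in d" "snd d ` fst d" "transition c d"
    by (rule metric_charts_transition[OF c d])
  show "riemann \<sigma> g d p (change c d p x) (change c d p y) (change c d p z) = change c d p (riemann \<sigma> g c p x y z)"
    using curv_change[OF mem_image_of[OF p(2,1)], of x y z] c p
    by (simp add: riemann_eq[OF c p(1)] riemann_eq[OF d p(2)] linear_cmul[OF linear_DF[OF mem_image_of[OF p(2,1)]]] change_def)
qed

lemma lower_weyl:
  assumes c: "c \<in> A" and p: "p \<in> fst c"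
  shows "lower (g c p) (weyl \<sigma> g c p) = weyl4 (g c p) (lower (g c p) (riemann \<sigma> g c p))"
    and "alg_curv (lower (g c p) (weyl \<sigma> g c p))"
    and "ricci (g c p) (lower (g c p) (weyl \<sigma> g c p)) y v = 0"
proof -
  have T: "alg_curv (lower (g c p) (riemann \<sigma> g c p))"
    using tensor_field_riemann c p unfolding tensor_field_def by blast
  note m = metric_at_chart[OF c p]
  show *: "lower (g c p) (weyl \<sigma> g c p) = weyl4 (g c p) (lower (g c p) (riemann \<sigma> g c p))"
    using lower_sharp_weyl4[OF m T] unfolding weyl_def[abs_def] .
  show "alg_curv (lower (g c p) (weyl \<sigma> g c p))" "ricci (g c p) (lower (g c p) (weyl \<sigma> g c p)) y v = 0"
    unfolding * by (rule alg_curv_weyl4[OF m T], rule ricci_weyl4[OF m T])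
qed

lemma tensor_field_weyl: "tensor_field (weyl \<sigma> g)"
  unfolding tensor_field_def
proof (intro conjI ballI allI)
  show "alg_curv (lower (g c p) (weyl \<sigma> g c p))" if "c \<in> A" "p \<in> fst c" for c p
    by (rule lower_weyl(2)[OF that])
next
  fix c x y z assume c: "c \<in> A"
  interpret metric_chart "metric_in c" "snd c ` fst c" by (rule metric_chart_full[OF c])
  let ?T = "\<lambda>q. lower (metric_in c q) (riemann \<sigma> g c (point_at c q))"
  have T: "alg_curv (?T q)" if "q \<in> snd c ` fst c" for q
    using tensor_field_riemann c that unfolding tensor_field_def by auto
  have "smooth_on (\<lambda>q. ?T q x y z v) (snd c ` fst c)" for x y z v
    unfolding lower_def
  proof (rule smooth_on_linear_apply[OF open_S, of "\<lambda>q w. metric_in c q w v"])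
    show "linear (\<lambda>w. metric_in c q w v)" if "q \<in> snd c ` fst c" for q
      using bil[OF that] unfolding bilinear_def by blast
    show "smooth_on (\<lambda>q. riemann \<sigma> g c (point_at c q) x y z) (snd c ` fst c)"
      using tensor_field_riemann c unfolding tensor_field_def by blast
  qed (rule smooth)
  from smooth_sharp_weyl4[of ?T, OF T this]
  show "smooth_on (\<lambda>q. weyl \<sigma> g c (point_at c q) x y z) (snd c ` fst c)"
    unfolding weyl_def by blast
next
  fix c d p x y z assume c: "c \<in> A" and d: "d \<in> A" and "p \<in> fst c \<inter> fst d"
  then have p: "p \<in> fst c" "p \<in> fst d" by auto
  let ?F = "change c d p"
  note mc = metric_at_chart[OF c p(1)] and md = metric_at_chart[OF d p(2)]
  have bd: "bilinear (g d p)" and sd: "signature_2_2 (g d p)" using md unfolding metric_at_def by auto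
  have g: "g d p (?F x) (?F y) = g c p x y" for x y by (rule metric_change[OF c d p])
  have T: "alg_curv (lower (g c p) (riemann \<sigma> g c p))" "alg_curv (lower (g d p) (riemann \<sigma> g d p))"
    using tensor_field_riemann c d p unfolding tensor_field_def by blast+
  have R: "riemann \<sigma> g d p (?F x) (?F y) (?F z) = ?F (riemann \<sigma> g c p x y z)" for x y z
    using tensor_field_riemann c d p unfolding tensor_field_def by blast
  have W: "weyl4 (g c p) (lower (g c p) (riemann \<sigma> g c p)) x y z v
      = weyl4 (g d p) (lower (g d p) (riemann \<sigma> g d p)) (?F x) (?F y) (?F z) (?F v)" for v
    by (rule weyl4_pullback[OF md mc g T(2,1)]) (simp add: lower_def R g)
  show "weyl \<sigma> g d p (?F x) (?F y) (?F z) = ?F (weyl \<sigma> g c p x y z)"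
  proof (rule metric_eqI[OF bd sd])
    fix v
    \<comment> \<open>\<open>weyl\<close> comes from \<open>sharp\<close> and is known through its
      pairings only; by surjectivity of the coordinate change, test vectors of the form
      \<open>?F u\<close> suffice.\<close>
    obtain u where u: "v = ?F u" using change_inverse[OF d p(2) c p(1)] by metis
    have "g d p (weyl \<sigma> g d p (?F x) (?F y) (?F z)) v = g c p (weyl \<sigma> g c p x y z) u"
      using W[of u] unfolding u lower_weyl(1)[OF c p(1), symmetric] lower_weyl(1)[OF d p(2), symmetric] lower_def by simp
    then show "g d p (weyl \<sigma> g d p (?F x) (?F y) (?F z)) v = g d p (?F (weyl \<sigma> g c p x y z)) v"
      unfolding u g .
  qed
qed

text \<open>The Clifford structure is constructed in one chart \<open>c\<close> around \<open>P\<close> and transported to the other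
  charts by the coordinate changes.\<close>
theorem tensor_field_cliff:
  assumes K: "tensor_field K" and jordan: "globally_jordan A g K" and P: "P \<in> topspace X"
  obtains U \<Phi> l m where "openin X U" "P \<in> U" "cliff_1_1_structure A g U \<Phi>" "l 0 = 0"
    "\<And>c p x y z. c \<in> A \<Longrightarrow> p \<in> U \<Longrightarrow> p \<in> fst c \<Longrightarrow> K c p x y z = cliff_curvature (g c p) (\<lambda>i. \<Phi> i c p) l m x y z"
    "(\<And>c p y. c \<in> A \<Longrightarrow> p \<in> fst c \<Longrightarrow> ricci (g c p) (lower (g c p) (K c p)) y y = 0) \<Longrightarrow> - l 1 + l 2 + l 3 = 0"
proof -
  have alg: "alg_curv (lower (g c p) (K c p))" if "c \<in> A" "p \<in> fst c" for c p
    using K that unfolding tensor_field_def by blast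
  have smK: "smooth_on (\<lambda>q. K c (point_at c q) x y z) (snd c ` fst c)" if "c \<in> A" for c x y z
    using K that unfolding tensor_field_def by blast
  have chK: "K d p (change c d p x) (change c d p y) (change c d p z) = change c d p (K c p x y z)"
    if "c \<in> A" "d \<in> A" "p \<in> fst c" "p \<in> fst d" for c d p x y z
    using K that unfolding tensor_field_def by blast
  obtain c where c: "c \<in> A" "P \<in> fst c" using P manifold unfolding smooth_manifold_def by blast
  let ?S = "snd c ` fst c" and ?G = "metric_in c"
  interpret metric_chart ?G ?S by (rule metric_chart_full[OF c(1)])
  obtain bs where bs: "\<And>p x. p \<in> fst c \<Longrightarrow> g c p x x = - 1 \<Longrightarrow> jordan_nf (complex_matrix (jacobi (K c p) x)) bs"
    using jordan c(1) unfolding globally_jordan_def by blast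
  have inS: "point_at c q \<in> fst c" "snd c (point_at c q) = q" if "q \<in> ?S" for q using that c by auto
  have sim: "similar_endo (jacobi (K c (point_at c q)) x) (jacobi (K c (point_at c q')) x')"
    if "q \<in> ?S" "q' \<in> ?S" "?G q x x = - 1" "?G q' x' x' = - 1" for q q' x x'
    by (rule similar_endo_if_jordan[OF linear_jacobi[OF metric_at_chart alg] linear_jacobi[OF metric_at_chart alg] bs bs])
      (use inS[OF that(1)] inS[OF that(2)] that(3,4) c(1) in auto)
  have "snd c P \<in> ?S" using c by blast
  then obtain S' f l m where S': "open S'" "snd c P \<in> S'" "S' \<subseteq> ?S" and smf: "\<And>i. smooth_on (\<lambda>q. f q i) S'"
    and of: "\<And>q. q \<in> S' \<Longrightarrow> orthonormal (?G q) (f q)" and l0: "l 0 = 0"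
    and Kq: "\<And>q x y z. q \<in> S' \<Longrightarrow> K c (point_at c q) x y z = cliff_curvature (?G q) (frame_cliff (?G q) (f q)) l m x y z"
    and ric: "(\<And>y. ricci (?G (snd c P)) (lower (?G (snd c P)) (K c (point_at c (snd c P)))) y y = 0) \<Longrightarrow> - l 1 + l 2 + l 3 = 0"
    apply (rule local_cliff[of _ "\<lambda>q. K c (point_at c q)"])
        apply (rule alg[OF c(1) inS(1)], assumption)
       apply (rule smK[OF c(1)])
      apply (rule sim; assumption)
    subgoal premises prems for S' f l m
      by (rule that[of S' f l m, OF prems(2-)]) simp_all
    done
  define U where "U = {p \<in> fst c. snd c p \<in> S'}"
  have U: "openin X U" unfolding U_def by (rule openin_chart_vimage[OF c(1) S'(1)])
  have PU: "P \<in> U" unfolding U_def using c S' by simp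
  have Uc: "p \<in> fst c" "snd c p \<in> S'" if "p \<in> U" for p using that unfolding U_def by auto
  define \<phi> where "\<phi> n p = frame_cliff (g c p) (f (snd c p)) n" for n p
  define \<Phi> where "\<Phi> n d p x = change c d p (\<phi> n p (change d c p x))" for n d p x
  have op: "orthonormal (g c p) (f (snd c p))" if "p \<in> U" for p
    using of[OF Uc(2)[OF that]] Uc(1)[OF that] c(1) by simp
  have mp: "metric_at (g c p)" if "p \<in> U" for p by (rule metric_at_chart[OF c(1) Uc(1)[OF that]])
  have lin\<phi>: "linear (\<phi> n p)" if "p \<in> U" for n p
    unfolding \<phi>_def by (rule linear_frame_cliff[OF mp[OF that] op[OF that]])
  have \<Phi>_F: "\<Phi> n d p (change c d p x) = change c d p (\<phi> n p x)" if "d \<in> A" "p \<in> fst d" "p \<in> U" for n d p x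
    unfolding \<Phi>_def change_inverse[OF c(1) Uc(1)[OF that(3)] that(1,2)] ..
  have F_ex: "\<exists>u. x = change c d p u" if "d \<in> A" "p \<in> fst d" "p \<in> U" for d p x
    using change_inverse[OF that(1,2) c(1) Uc(1)[OF that(3)]] by metis
  have linF: "linear (change c d p)" if "d \<in> A" "p \<in> fst d" "p \<in> U" for d p
    by (rule linear_change[OF c(1) that(1) Uc(1)[OF that(3)] that(2)])
  have gF: "g d p (change c d p x) (change c d p y) = g c p x y" if "d \<in> A" "p \<in> fst d" "p \<in> U" for d p x y
    by (rule metric_change[OF c(1) that(1) Uc(1)[OF that(3)] that(2)])
  have smooth\<Phi>: "smooth_endo_field A U (\<Phi> n)" for n
    unfolding smooth_endo_field_def
  proof (intro conjI ballI allI)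
    fix d p assume d: "d \<in> A" and "p \<in> U \<inter> fst d"
    then have p: "p \<in> U" "p \<in> fst d" by auto
    show "linear (\<Phi> n d p)"
      unfolding \<Phi>_def[abs_def]
      using linear_compose[OF linear_compose[OF linear_change[OF d c(1) p(2) Uc(1)[OF p(1)]] lin\<phi>[OF p(1)]] linF[OF d p(2,1)]]
      by (simp add: o_def)
  next
    fix d x assume d: "d \<in> A"
    let ?W = "image_of d U" and ?t = "transition d c"
    have W: "open ?W" by (rule open_image_of[OF d U])
    have Wp: "point_at d q \<in> U" "point_at d q \<in> fst d" "snd d (point_at d q) = q" if "q \<in> ?W" for q
      using image_ofE[OF d that] by blast+
    have t: "?t q = snd c (point_at d q)" for q by (simp add: transition_def)
    have tS: "?t q \<in> S'" if "q \<in> ?W" for q unfolding t by (rule Uc(2)[OF Wp(1)[OF that]])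
    have tp: "point_at c (?t q) = point_at d q" if "q \<in> ?W" for q
      unfolding t using c(1) Uc(1)[OF Wp(1)[OF that]] by simp
    have WC: "?W \<subseteq> image_of d (fst c)" unfolding image_of_def using Uc by blast
    have smt: "smooth_on ?t ?W" by (rule smooth_on_subset[OF smooth_transition[OF d c(1)] WC])
    let ?V = "image_of c (fst d)"
    have V: "open ?V" by (rule open_image_of[OF c(1) chart_openin[OF d]])
    have tV: "?t q \<in> ?V" if "q \<in> ?W" for q
      unfolding t using Wp[OF that] Uc by (intro mem_image_of) auto
    \<comment> \<open>The derivative is taken at a base point that moves with q through the other
      transition map.\<close>
    have smD: "smooth_on (\<lambda>q. frechet_derivative (transition c d) (at (?t q)) w) ?W" for w
      by (rule smooth_on_compose[OF W V tV smooth_on_derivative[OF smooth_transition[OF c(1) d]] smt])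
    have sm\<phi>: "smooth_on (\<lambda>r. frame_cliff (?G r) (f r) n w) S'" for w
    proof -
      have "smooth_on (\<lambda>r. ?G r w (f r i)) S'" for i
        using bil S'(3) by (intro smooth_on_linear_apply[OF S'(1) _ smooth_on_subset[OF smooth S'(3)] smf])
          (auto simp: bilinear_def)
      then have "smooth_on (\<lambda>r. ?G r w (f r i) *\<^sub>R f r j) S'" for i j
        by (rule smooth_on_scaleR[OF S'(1) _ smf])
      then show ?thesis
        unfolding frame_cliff_def
        by (cases "n = 1"; cases "n = 2") (simp_all add: smooth_on_add smooth_on_diff S'(1))
    qed
    have "smooth_on (\<lambda>q. frame_cliff (?G (?t q)) (f (?t q)) n w) ?W" for w
      by (rule smooth_on_compose[OF W S'(1) tS sm\<phi> smt])
    moreover have "linear (frame_cliff (?G (?t q)) (f (?t q)) n)" if "q \<in> ?W" for q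
      using tS[OF that] S'(3) of by (intro linear_frame_cliff metric_at) auto
    ultimately have a: "smooth_on (\<lambda>q. frame_cliff (?G (?t q)) (f (?t q)) n (frechet_derivative ?t (at q) x)) ?W"
      using smooth_on_linear_apply[OF W _ _ smooth_on_derivative[OF smt], of "\<lambda>q. frame_cliff (?G (?t q)) (f (?t q)) n"] by blast
    have b: "linear (frechet_derivative (transition c d) (at (?t q)))" if "q \<in> ?W" for q
      by (rule smooth_on_linear_derivative[OF smooth_transition[OF c(1) d] tV[OF that]])
    have "smooth_on (\<lambda>q. frechet_derivative (transition c d) (at (?t q))
        (frame_cliff (?G (?t q)) (f (?t q)) n (frechet_derivative ?t (at q) x))) ?W"
      by (rule smooth_on_linear_apply[where h = "\<lambda>q. frechet_derivative (transition c d) (at (?t q))", OF W b smD a])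
    then show "smooth_on (\<lambda>q. \<Phi> n d (point_at d q) x) ?W"
    proof (rule smooth_on_cong[OF W, rotated])
      show "frechet_derivative (transition c d) (at (?t q)) (frame_cliff (?G (?t q)) (f (?t q)) n (frechet_derivative ?t (at q) x))
          = \<Phi> n d (point_at d q) x" if "q \<in> ?W" for q
        unfolding \<Phi>_def \<phi>_def change_def tp[OF that] Wp(3)[OF that] t[symmetric] ..
    qed
  next
    fix d e p x assume d: "d \<in> A" and e: "e \<in> A" and "p \<in> U \<inter> fst d \<inter> fst e"
    then have p: "p \<in> U" "p \<in> fst d" "p \<in> fst e" by auto
    note pc = Uc(1)[OF p(1)]
    show "\<Phi> n e p (change d e p x) = change d e p (\<Phi> n d p x)"
      unfolding \<Phi>_def
      by (simp add: change_change[OF d p(2) e p(3) c(1) pc] change_change[OF c(1) pc d p(2) e p(3)])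
  qed
  have cliff: "cliff_1_1_structure A g U \<Phi>"
    unfolding cliff_1_1_structure_def
  proof (intro conjI ballI)
    fix d p assume d: "d \<in> A" and "p \<in> U \<inter> fst d"
    then have p: "p \<in> U" "p \<in> fst d" by auto
    note F = \<Phi>_F[OF d p(2,1)] and ex = F_ex[OF d p(2,1)] and L = linF[OF d p(2,1)]
    note rel = frame_cliff_relations[OF mp[OF p(1)] op[OF p(1)], folded \<phi>_def]
    show "\<forall>x y. g d p (\<Phi> i d p x) y = - g d p x (\<Phi> i d p y)" for i
    proof (intro allI)
      fix x y
      obtain u v where u: "x = change c d p u" and v: "y = change c d p v" using ex by metis
      show "g d p (\<Phi> i d p x) y = - g d p x (\<Phi> i d p y)"
        unfolding u v F gF[OF d p(2,1)] \<phi>_def by (rule frame_cliff_skew[OF mp[OF p(1)] op[OF p(1)]])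
    qed
    \<comment> \<open>Every vector in the chart d is the image of one in c, so relations between the
      \<open>\<phi>\<close> carry over; s absorbs the signs.\<close>
    have lift: "\<Phi> i d p (\<Phi> j d p x) = s *\<^sub>R \<Phi> k d p x" if "\<And>u. \<phi> i p (\<phi> j p u) = s *\<^sub>R \<phi> k p u" for i j k s x
    proof -
      obtain u where u: "x = change c d p u" using ex by metis
      show ?thesis unfolding u F that linear_cmul[OF L] ..
    qed
    have lift': "\<Phi> i d p (\<Phi> i d p x) = s *\<^sub>R x" if "\<And>u. \<phi> i p (\<phi> i p u) = s *\<^sub>R u" for i s x
    proof -
      obtain u where u: "x = change c d p u" using ex by metis
      show ?thesis unfolding u F that linear_cmul[OF L] ..
    qed
    show "\<forall>x. \<Phi> 3 d p x = \<Phi> 2 d p (\<Phi> 1 d p x)"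
      using lift[of 2 1 1 3] rel(1) by simp
    show "\<forall>x. \<Phi> 1 d p (\<Phi> 1 d p x) = - x" "\<forall>x. \<Phi> 2 d p (\<Phi> 2 d p x) = x" "\<forall>x. \<Phi> 3 d p (\<Phi> 3 d p x) = x"
      using lift'[of 1 "- 1"] lift'[of 2 1] lift'[of 3 1] rel by simp_all
    have "\<Phi> 1 d p (\<Phi> 2 d p x) = - \<Phi> 3 d p x" "\<Phi> 2 d p (\<Phi> 1 d p x) = \<Phi> 3 d p x"
      "\<Phi> 1 d p (\<Phi> 3 d p x) = \<Phi> 2 d p x" "\<Phi> 3 d p (\<Phi> 1 d p x) = - \<Phi> 2 d p x"
      "\<Phi> 2 d p (\<Phi> 3 d p x) = \<Phi> 1 d p x" "\<Phi> 3 d p (\<Phi> 2 d p x) = - \<Phi> 1 d p x" for x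
      using lift[of 1 2 "- 1" 3] lift[of 2 1 1 3] lift[of 1 3 1 2] lift[of 3 1 "- 1" 2] lift[of 2 3 1 1] lift[of 3 2 "- 1" 1] rel
      by simp_all
    then show "i \<noteq> j \<longrightarrow> (\<forall>x. \<Phi> i d p (\<Phi> j d p x) + \<Phi> j d p (\<Phi> i d p x) = 0)" if "i \<in> {1..3}" "j \<in> {1..3}" for i j
    proof -
      have "i = 1 \<or> i = 2 \<or> i = 3" "j = 1 \<or> j = 2 \<or> j = 3" using that by auto
      then show ?thesis
        using \<open>\<And>x. \<Phi> 1 d p (\<Phi> 2 d p x) = - \<Phi> 3 d p x\<close> \<open>\<And>x. \<Phi> 2 d p (\<Phi> 1 d p x) = \<Phi> 3 d p x\<close>
          \<open>\<And>x. \<Phi> 1 d p (\<Phi> 3 d p x) = \<Phi> 2 d p x\<close> \<open>\<And>x. \<Phi> 3 d p (\<Phi> 1 d p x) = - \<Phi> 2 d p x\<close>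
          \<open>\<And>x. \<Phi> 2 d p (\<Phi> 3 d p x) = \<Phi> 1 d p x\<close> \<open>\<And>x. \<Phi> 3 d p (\<Phi> 2 d p x) = - \<Phi> 1 d p x\<close>
        by (elim disjE) simp_all
    qed
  qed (rule smooth\<Phi>)
  show thesis
  proof (rule that[of U \<Phi> l m, OF U PU cliff l0])
    fix d p x y z assume d: "d \<in> A" and p: "p \<in> U" "p \<in> fst d"
    obtain u v w where u: "x = change c d p u" "y = change c d p v" "z = change c d p w"
      using F_ex[OF d p(2,1)] by metis
    have Kp: "K c p u v w = cliff_curvature (g c p) (\<lambda>i. \<phi> i p) l m u v w"
      using Kq[OF Uc(2)[OF p(1)], of u v w] Uc(1)[OF p(1)] c(1) unfolding \<phi>_def by simp
    show "K d p x y z = cliff_curvature (g d p) (\<lambda>i. \<Phi> i d p) l m x y z"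
      unfolding u chK[OF c(1) d Uc(1)[OF p(1)] p(2)] Kp
      by (rule cliff_curvature_natural[where \<phi> = "\<lambda>i. \<Phi> i d p" and \<phi>' = "\<lambda>i. \<phi> i p"
            and b = "g d p" and b' = "g c p" and F = "change c d p",
            OF linF[OF d p(2,1)] gF[OF d p(2,1)] \<Phi>_F[OF d p(2,1)], symmetric])
  next
    assume r: "\<And>c p y. c \<in> A \<Longrightarrow> p \<in> fst c \<Longrightarrow> ricci (g c p) (lower (g c p) (K c p)) y y = 0"
    show "- l 1 + l 2 + l 3 = 0" by (rule ric) (use r c in simp)
  qed
qed

end

theorem theorem1p5:
  fixes X :: "'m topology" and A :: "'m chart set" and g :: "'m bilin_field" and \<sigma> :: real
  assumes "smooth_manifold X A" and "connected_space X"
    and "metric_2_2 A g"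
    and "\<sigma> = 1 \<or> \<sigma> = - 1"
  shows
    "(globally_jordan_osserman \<sigma> A g \<longrightarrow>
       (\<forall>P\<in>topspace X. \<exists>U \<Phi> l m.
          openin X U \<and> P \<in> U \<and> cliff_1_1_structure A g U \<Phi> \<and>
          (\<forall>c\<in>A. \<forall>p\<in>U \<inter> fst c. \<forall>x y z.
             riemann \<sigma> g c p x y z = cliff_curvature (g c p) (\<lambda>i. \<Phi> i c p) l m x y z)))
     \<and>
     (globally_conformally_jordan_osserman \<sigma> A g \<longrightarrow>
       (\<forall>P\<in>topspace X. \<exists>U \<Phi> l m.
          openin X U \<and> P \<in> U \<and> cliff_1_1_structure A g U \<Phi> \<and>
          l 0 - l 1 + l 2 + l 3 = 0 \<and>
          (\<forall>c\<in>A. \<forall>p\<in>U \<inter> fst c. \<forall>x y z.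
             weyl \<sigma> g c p x y z = cliff_curvature (g c p) (\<lambda>i. \<Phi> i c p) l m x y z)))"
proof -
  interpret manifold_2_2 X A g by unfold_locales (rule assms)+
  show ?thesis
  proof (intro conjI impI ballI, goal_cases)
    case (1 P)
    then have "globally_jordan A g (riemann \<sigma> g)" unfolding globally_jordan_osserman_def by blast
    from tensor_field_riemann this 1(2) show ?case by (rule tensor_field_cliff) blast
  next
    case (2 P)
    then have J: "globally_jordan A g (weyl \<sigma> g)" unfolding globally_conformally_jordan_osserman_def by blast
    show ?case
    proof (rule tensor_field_cliff[OF tensor_field_weyl J 2(2)], goal_cases)
      case (1 U \<Phi> l m)
      \<comment> \<open>The contraction of the Weyl tensor vanishes, which is the premise of the
        trace relation; \<open>l 0 = 0\<close> then completes the side condition.\<close>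
      have "- l 1 + l 2 + l 3 = 0" by (rule 1(6)) (rule lower_weyl(3))
      then have "l 0 - l 1 + l 2 + l 3 = 0" using 1(4) by simp
      then show ?case using 1(1-3,5) by blast
    qed
  qed
qed

end
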